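(* Let $\Omega$ be a rectangle. For the lowest-order rectangular Raviart-Thomas element on general rectangular meshes $\mathcal T_h$ of $\Omega$, the computed eigenvalues are asymptotic upper bounds for the exact Dirichlet Laplacian eigenvalues: for each index $k$, $\lambda_{k,h}\ge\lambda_k$ for all $h$ small enough.
   Context: $\Omega\subset\mathbb R^2$ is an axis-parallel rectangle. $\mathcal T_h$ is a tensor-product rectangular mesh of $\overline\Omega$ obtained from grid lines $x_0<\dots<x_{n_1}$, $y_0<\dots<y_{n_2}$ with elements $K_{i,j}=[x_{i-1},x_i]\times[y_{j-1},y_j]$ of size $h_{x_i}\times h_{y_j}$, and $h=\max\{h_{x_i},h_{y_j}\}$. $(\cdot,\cdot)$ is the $L^2(\Omega)$ inner product. With $Q_{mn}=\operatorname{span}\{x^iy^j:0\le i\le m,0\le j\le n\}$, $\boldsymbol\Sigma_h=\{\boldsymbol\tau_h\in\boldsymbol H(\operatorname{div},\Omega):\boldsymbol\tau_h|_K\in Q_{10}(K)\times Q_{01}(K)\ \forall K\in\mathcal T_h\}$ and $V_h=\{v_h\in L^2(\Omega): v_h|_K \text{ constant }\forall K\in\mathcal T_h\}$. $0<\lambda_1\le\lambda_2\le\cdots$ are the eigenvalues (with multiplicity) of $-\Delta u=\lambda u$ in $\Omega$, $u=0$ on $\partial\Omega$. $0<\lambda_{1,h}\le\lambda_{2,h}\le\cdots\le\lambda_{N,h}$ ($N=\#\mathcal T_h$) are the eigenvalues (with multiplicity) of the discrete mixed problem: find $(\lambda_h,\boldsymbol\sigma_h,u_h)\in\mathbb R\times\boldsymbol\Sigma_h\times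 V_h$, $u_h\neq0$, with $(\boldsymbol\sigma_h,\boldsymbol\tau_h)-(\operatorname{div}\boldsymbol\tau_h,u_h)=0$ and $(\operatorname{div}\boldsymbol\sigma_h,v_h)=\lambda_h(u_h,v_h)$ for all $(\boldsymbol\tau_h,v_h)\in\boldsymbol\Sigma_h\times V_h$. *)

theory Defs
  imports "HOL-Analysis.Analysis"
begin

text \<open>Points of the plane are pairs in \<^typ>\<open>real \<times> real\<close>.  Elements of $L^2$ are represented by
  functions on the whole plane; only their values almost everywhere on the domain matter.\<close>

definition rectangle :: "real \<Rightarrow> real \<Rightarrow> real \<Rightarrow> real \<Rightarrow> (real \<times> real) set" where
  "rectangle a b c d = {a<..<b} \<times> {c<..<d}"

definition L2_on :: "(real \<times> real) set \<Rightarrow> (real \<times> real \<Rightarrow> real) set" where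
  "L2_on \<Omega> = {f. f \<in> borel_measurable (lebesgue_on \<Omega>) \<and>
                  integrable (lebesgue_on \<Omega>) (\<lambda>p. (f p)\<^sup>2)}"

definition L2_inner :: "(real \<times> real) set \<Rightarrow> (real \<times> real \<Rightarrow> real) \<Rightarrow> (real \<times> real \<Rightarrow> real) \<Rightarrow> real" where
  "L2_inner \<Omega> f g = integral\<^sup>L (lebesgue_on \<Omega>) (\<lambda>p. f p * g p)"

definition L2_inner_vec ::
  "(real \<times> real) set \<Rightarrow> (real \<times> real \<Rightarrow> real \<times> real) \<Rightarrow> (real \<times> real \<Rightarrow> real \<times> real) \<Rightarrow> real" where
  "L2_inner_vec \<Omega> \<sigma> \<tau> = integral\<^sup>L (lebesgue_on \<Omega>) (\<lambda>p. \<sigma> p \<bullet> \<tau> p)"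


definition dx :: "(real \<times> real \<Rightarrow> real) \<Rightarrow> real \<times> real \<Rightarrow> real" where
  "dx f p = deriv (\<lambda>s. f (s, snd p)) (fst p)"

definition dy :: "(real \<times> real \<Rightarrow> real) \<Rightarrow> real \<times> real \<Rightarrow> real" where
  "dy f p = deriv (\<lambda>t. f (fst p, t)) (snd p)"

text \<open>\<open>C_on m S f\<close>: on the open set \<open>S\<close>, all partial derivatives of \<open>f\<close> up to order \<open>m\<close>
  exist and are continuous.\<close>

primrec C_on :: "nat \<Rightarrow> (real \<times> real) set \<Rightarrow> (real \<times> real \<Rightarrow> real) \<Rightarrow> bool" where
  "C_on 0 S f = continuous_on S f"
| "C_on (Suc m) S f =
     (continuous_on S f \<and>
      (\<forall>p\<in>S. (\<lambda>s. f (s, snd p)) differentiable (at (fst p)) \<and>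
             (\<lambda>t. f (fst p, t)) differentiable (at (snd p))) \<and>
      C_on m S (dx f) \<and> C_on m S (dy f))"

definition test_functions :: "(real \<times> real) set \<Rightarrow> (real \<times> real \<Rightarrow> real) set" where
  "test_functions \<Omega> = {\<phi>. (\<forall>m. C_on m UNIV \<phi>) \<and>
                           (\<exists>K. compact K \<and> K \<subseteq> \<Omega> \<and> (\<forall>p. p \<notin> K \<longrightarrow> \<phi> p = 0))}"


definition is_weak_div ::
  "(real \<times> real) set \<Rightarrow> (real \<times> real \<Rightarrow> real \<times> real) \<Rightarrow> (real \<times> real \<Rightarrow> real) \<Rightarrow> bool" where
  "is_weak_div \<Omega> \<tau> g \<longleftrightarrow>
     g \<in> L2_on \<Omega> \<and>
     (\<forall>\<phi>\<in>test_functions \<Omega>.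
        L2_inner_vec \<Omega> \<tau> (\<lambda>p. (dx \<phi> p, dy \<phi> p)) = - L2_inner \<Omega> g \<phi>)"

definition Hdiv :: "(real \<times> real) set \<Rightarrow> (real \<times> real \<Rightarrow> real \<times> real) set" where
  "Hdiv \<Omega> = {\<tau>. (\<lambda>p. fst (\<tau> p)) \<in> L2_on \<Omega> \<and> (\<lambda>p. snd (\<tau> p)) \<in> L2_on \<Omega> \<and>
                 (\<exists>g. is_weak_div \<Omega> \<tau> g)}"

text \<open>The weak divergence is unique up to null sets, so the choice of representative is
  irrelevant inside $L^2$ inner products.\<close>

definition weak_div :: "(real \<times> real) set \<Rightarrow> (real \<times> real \<Rightarrow> real \<times> real) \<Rightarrow> real \<times> real \<Rightarrow> real" where
  "weak_div \<Omega> \<tau> = (SOME g. is_weak_div \<Omega> \<tau> g)"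


definition is_grid :: "real \<Rightarrow> real \<Rightarrow> nat \<Rightarrow> (nat \<Rightarrow> real) \<Rightarrow> bool" where
  "is_grid a b n x \<longleftrightarrow> 1 \<le> n \<and> x 0 = a \<and> x n = b \<and> (\<forall>i<n. x i < x (Suc i))"

definition mesh_cells :: "nat \<Rightarrow> (nat \<Rightarrow> real) \<Rightarrow> nat \<Rightarrow> (nat \<Rightarrow> real) \<Rightarrow> (real \<times> real) set set" where
  "mesh_cells n1 x n2 y =
     {{x (i - 1)..x i} \<times> {y (j - 1)..y j} | i j. i \<in> {1..n1} \<and> j \<in> {1..n2}}"

definition mesh_size :: "nat \<Rightarrow> (nat \<Rightarrow> real) \<Rightarrow> nat \<Rightarrow> (nat \<Rightarrow> real) \<Rightarrow> real" where
  "mesh_size n1 x n2 y =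
     Max ((\<lambda>i. x i - x (i - 1)) ` {1..n1} \<union> (\<lambda>j. y j - y (j - 1)) ` {1..n2})"

definition Q_poly :: "nat \<Rightarrow> nat \<Rightarrow> (real \<times> real \<Rightarrow> real) set" where
  "Q_poly m n = {q. \<exists>c. \<forall>s t. q (s, t) = (\<Sum>i\<le>m. \<Sum>j\<le>n. c i j * s ^ i * t ^ j)}"

definition RT_flux ::
  "(real \<times> real) set \<Rightarrow> (real \<times> real) set set \<Rightarrow> (real \<times> real \<Rightarrow> real \<times> real) set" where
  "RT_flux \<Omega> T = {\<tau> \<in> Hdiv \<Omega>. \<forall>K\<in>T. \<exists>q\<^sub>1\<in>Q_poly 1 0. \<exists>q\<^sub>2\<in>Q_poly 0 1.
                     AE p in lebesgue_on K. \<tau> p = (q\<^sub>1 p, q\<^sub>2 p)}"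

definition RT_scalar ::
  "(real \<times> real) set \<Rightarrow> (real \<times> real) set set \<Rightarrow> (real \<times> real \<Rightarrow> real) set" where
  "RT_scalar \<Omega> T = {v \<in> L2_on \<Omega>. \<forall>K\<in>T. \<exists>c. AE p in lebesgue_on K. v p = c}"


text \<open>Both eigenspaces below are defined for every real \<open>\<mu>\<close> and contain zero; \<open>\<mu>\<close> is an
  eigenvalue iff its eigenspace is nontrivial.\<close>

definition dirichlet_eigenspace ::
  "(real \<times> real) set \<Rightarrow> real \<Rightarrow> (real \<times> real \<Rightarrow> real) set" where
  "dirichlet_eigenspace \<Omega> \<mu> =
     {u. continuous_on (closure \<Omega>) u \<and> C_on 2 \<Omega> u \<and>
         (\<forall>p\<in>\<Omega>. - (dx (dx u) p + dy (dy u) p) = \<mu> * u p) \<and>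
         (\<forall>p\<in>frontier \<Omega>. u p = 0)}"

definition RT_eigenspace ::
  "(real \<times> real) set \<Rightarrow> (real \<times> real) set set \<Rightarrow> real \<Rightarrow> (real \<times> real \<Rightarrow> real) set" where
  "RT_eigenspace \<Omega> T \<mu> =
     {u \<in> RT_scalar \<Omega> T. \<exists>\<sigma>\<in>RT_flux \<Omega> T.
        (\<forall>\<tau>\<in>RT_flux \<Omega> T. L2_inner_vec \<Omega> \<sigma> \<tau> - L2_inner \<Omega> (weak_div \<Omega> \<tau>) u = 0) \<and>
        (\<forall>v\<in>RT_scalar \<Omega> T. L2_inner \<Omega> (weak_div \<Omega> \<sigma>) v = \<mu> * L2_inner \<Omega> u v)}"

text \<open>The linear space \<open>E\<close> has finite dimension \<open>m\<close> after identifying functions that agree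
  almost everywhere on \<open>\<Omega>\<close>.\<close>

definition has_dim_ae :: "(real \<times> real) set \<Rightarrow> (real \<times> real \<Rightarrow> real) set \<Rightarrow> nat \<Rightarrow> bool" where
  "has_dim_ae \<Omega> E m \<longleftrightarrow>
     (\<exists>e :: nat \<Rightarrow> real \<times> real \<Rightarrow> real.
        (\<forall>i<m. e i \<in> E) \<and>
        (\<forall>c. (AE p in lebesgue_on \<Omega>. (\<Sum>i<m. c i * e i p) = 0) \<longrightarrow> (\<forall>i<m. c i = 0)) \<and>
        (\<forall>u\<in>E. \<exists>c. AE p in lebesgue_on \<Omega>. u p = (\<Sum>i<m. c i * e i p)))"

text \<open>\<open>ev\<close>, restricted to the index set \<open>I\<close>, lists in nondecreasing order all eigenvalues of the
  problem with eigenspaces \<open>E \<mu>\<close>, each one as often as its multiplicity.\<close>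

definition lists_eigenvalues ::
  "(real \<times> real) set \<Rightarrow> (real \<Rightarrow> (real \<times> real \<Rightarrow> real) set) \<Rightarrow> nat set \<Rightarrow> (nat \<Rightarrow> real) \<Rightarrow> bool" where
  "lists_eigenvalues \<Omega> E I ev \<longleftrightarrow>
     mono_on I ev \<and>
     (\<forall>\<mu>. finite {k \<in> I. ev k = \<mu>} \<and> has_dim_ae \<Omega> (E \<mu>) (card {k \<in> I. ev k = \<mu>}))"

end

(*
The lowest-order element on a tensor-product mesh decouples: the discrete operator is
A_x (x) I + I (x) A_y, where A_x is the one-dimensional mixed operator, whose eigenvalues are the
nonzero eigenvalues of the conforming piecewise linear discretization of the Neumann problem on
[a,b].  By the min-max principle the p-th one is at least (p pi / (b - a))^2, so the discrete
eigenvalues are sums ev_p + fv_q that dominate the exact eigenvalues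
(p pi / (b - a))^2 + (q pi / (d - c))^2 pair by pair.  Hence the bound holds on every mesh; h has to
be small only so that the discrete problem has k eigenvalues at all.

In the min-max argument the trial space of dimension p + 1 is cut down by the p conditions of vanishing
at the zeros of w = cos (p pi (s - a) / (b - a)); on such functions Picone's identity with w gives the
inequality without any Fourier analysis.  For the Dirichlet problem it suffices that the
multiplicities are at least those given by the sine modes, so completeness of these is not needed.
*)

theory Submission
  imports Defs "HOL-Real_Asymp.Real_Asymp"
begin

section \<open>Simultaneous diagonalization\<close>

text \<open>The obstacle is the flux space: \<open>Hdiv\<close> speaks only about smooth compactly
  supported test functions, and \<open>weak_div\<close> is an arbitrary representative. Facts about
  edges and cells are recovered by letting tensor products of bump functions converge pointwise.
  Indicators of open cells yield the mean divergence of a cell; a multiple of the indicator of a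
  grid line, null for area but visible to edge integrals, yields continuity of the normal flux. What
  remains is a problem about nodal values, and fluxes living in a single row or column split it into
  one-dimensional ones.

  The discrete scalar is paired with the increments of the Neumann modes. This kills the constant
  mode, which is why only the nonzero Neumann eigenvalues occur.

  The two families of sums need not be ordered alike when sorted, so they are compared by counting
  index pairs below a level. For this an upper bound on the discrete multiplicities and a lower
  bound on the exact ones are enough. Each dimension count is a homogeneous linear system with more
  unknowns than equations.\<close>

lemma homogeneous_system:
  fixes A :: "'i \<Rightarrow> 'j \<Rightarrow> real"
  assumes "finite I" "finite J" "card I < card J"
  shows "\<exists>c. (\<exists>j\<in>J. c j \<noteq> 0) \<and> (\<forall>i\<in>I. (\<Sum>j\<in>J. A i j * c j) = 0)"
  using assms
proof (induction I arbitrary: A J rule: finite_induct)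
  case empty
  then obtain j where "j \<in> J" by fastforce
  then show ?case by (intro exI[of _ "\<lambda>_. 1"]) auto
next
  case (insert i0 I)
  show ?case
  proof (cases "\<forall>j\<in>J. A i0 j = 0")
    case True
    have "card I < card J" using insert by simp
    then obtain c where "\<exists>j\<in>J. c j \<noteq> 0" "\<forall>i\<in>I. (\<Sum>j\<in>J. A i j * c j) = 0"
      using insert.IH[OF insert.prems(1), of A] by blast
    then show ?thesis using True by (intro exI[of _ c]) auto
  next
    case False
    then obtain j0 where j0: "j0 \<in> J" "A i0 j0 \<noteq> 0" by auto
    let ?J = "J - {j0}"
    have fJ: "finite ?J" and cJ: "card I < card ?J"
      using insert.prems insert.hyps j0 by auto
    obtain c where c: "\<exists>j\<in>?J. c j \<noteq> 0"
      "\<And>i. i \<in> I \<Longrightarrow> (\<Sum>j\<in>?J. (A i j - A i j0 * A i0 j / A i0 j0) * c j) = 0"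
      using insert.IH[OF fJ cJ, of "\<lambda>i j. A i j - A i j0 * A i0 j / A i0 j0"] by blast
    define c' where "c' = c(j0 := - (\<Sum>j\<in>?J. A i0 j * c j) / A i0 j0)"
    have split: "(\<Sum>j\<in>J. A i j * c' j) = A i j0 * c' j0 + (\<Sum>j\<in>?J. A i j * c j)" for i
    proof -
      have "(\<Sum>j\<in>J. A i j * c' j) = A i j0 * c' j0 + (\<Sum>j\<in>?J. A i j * c' j)"
        using sum.remove[OF insert.prems(1) j0(1)] by simp
      also have "(\<Sum>j\<in>?J. A i j * c' j) = (\<Sum>j\<in>?J. A i j * c j)"
        by (rule sum.cong) (auto simp: c'_def)
      finally show ?thesis .
    qed
    have "(\<Sum>j\<in>J. A i j * c' j) = 0" if "i \<in> insert i0 I" for i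
    proof (cases "i = i0")
      case True
      then show ?thesis using split[of i0] j0 by (simp add: c'_def)
    next
      case False
      with that have "i \<in> I" by simp
      from c(2)[OF this]
      have "(\<Sum>j\<in>?J. A i j * c j) = A i j0 / A i0 j0 * (\<Sum>j\<in>?J. A i0 j * c j)"
        by (simp add: algebra_simps sum_subtractf sum_distrib_left sum_divide_distrib)
      then show ?thesis using split[of i] by (simp add: c'_def)
    qed
    moreover have "\<exists>j\<in>J. c' j \<noteq> 0" using c(1) by (auto simp: c'_def)
    ultimately show ?thesis by blast
  qed
qed

text \<open>Two symmetric bilinear forms on vectors with entries 0 to \<open>n\<close>, the form
  \<open>M\<close> being positive definite. Vectors are total functions on the naturals, so the two
  \<open>cong\<close> axioms say that entries beyond \<open>n\<close> are invisible. Continuity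
  refers to the product topology, in which Tychonoff's theorem supplies compactness.\<close>

locale form_pair =
  fixes n :: nat and M K :: "(nat \<Rightarrow> real) \<Rightarrow> (nat \<Rightarrow> real) \<Rightarrow> real" and m :: real
  assumes M_linear: "M (\<lambda>i. s i + r * t i) v = M s v + r * M t v"
    and K_linear: "K (\<lambda>i. s i + r * t i) v = K s v + r * K t v"
    and M_sym: "M s t = M t s" and K_sym: "K s t = K t s"
    and M_cont: "continuous_on UNIV (\<lambda>s. M s s)" "continuous_on UNIV (\<lambda>s. M s t)"
    and K_cont: "continuous_on UNIV (\<lambda>s. K s s)"
    and m_pos: "0 < m"
    and M_coercive: "i \<le> n \<Longrightarrow> m * (s i)\<^sup>2 \<le> M s s"
    and M_cong: "(\<And>i. i \<le> n \<Longrightarrow> s i = s' i) \<Longrightarrow> M s t = M s' t"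
    and K_cong: "(\<And>i. i \<le> n \<Longrightarrow> s i = s' i) \<Longrightarrow> K s t = K s' t"
begin

lemma M_zero: "M (\<lambda>_. 0) v = 0" and K_zero: "K (\<lambda>_. 0) v = 0"
  using M_linear[of "\<lambda>_. 0" 1 "\<lambda>_. 0" v] K_linear[of "\<lambda>_. 0" 1 "\<lambda>_. 0" v] by simp_all

lemma M_scale: "M (\<lambda>i. r * t i) v = r * M t v" and K_scale: "K (\<lambda>i. r * t i) v = r * K t v"
  using M_linear[of "\<lambda>_. 0" r t v] K_linear[of "\<lambda>_. 0" r t v] M_zero K_zero by simp_all

lemma M_sum: "finite A \<Longrightarrow> M (\<lambda>i. \<Sum>q\<in>A. c q * S q i) v = (\<Sum>q\<in>A. c q * M (S q) v)"
proof (induction A rule: finite_induct)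
  case (insert q A)
  then show ?case using M_linear[of "\<lambda>i. \<Sum>q\<in>A. c q * S q i" "c q" "S q" v]
    by (simp add: add.commute)
qed (simp add: M_zero)

lemma K_sum: "finite A \<Longrightarrow> K (\<lambda>i. \<Sum>q\<in>A. c q * S q i) v = (\<Sum>q\<in>A. c q * K (S q) v)"
proof (induction A rule: finite_induct)
  case (insert q A)
  then show ?case using K_linear[of "\<lambda>i. \<Sum>q\<in>A. c q * S q i" "c q" "S q" v]
    by (simp add: add.commute)
qed (simp add: K_zero)

lemma M_nonneg: "0 \<le> M s s"
  using M_coercive[of 0 s] m_pos by (meson order_trans mult_nonneg_nonneg less_imp_le zero_le_power2 zero_le)

lemma M_eq_0: "M s s = 0 \<Longrightarrow> i \<le> n \<Longrightarrow> s i = 0"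
  using M_coercive[of i s] m_pos
  by (smt (verit) mult_pos_pos zero_less_power2)

text \<open>The \<open>M\<close>-unit sphere in the orthogonal complement of the modes already
  chosen; minimizing \<open>K\<close> over it produces the next mode. Entries beyond
  \<open>n\<close> are pinned to 0: the forms do not see them, and the set would otherwise be
  unbounded.\<close>

definition admissible :: "(nat \<Rightarrow> nat \<Rightarrow> real) \<Rightarrow> nat \<Rightarrow> (nat \<Rightarrow> real) set" where
  "admissible S p = {s. (\<forall>i>n. s i = 0) \<and> (\<forall>q<p. M s (S q) = 0) \<and> M s s = 1}"

lemma compact_admissible: "compact (admissible S p)"
proof -
  \<comment> \<open>Coercivity bounds the squares of the entries by 1/m; this \<open>R\<close>
    satisfies R^2 >= 1/m without a square root.\<close>
  define R where "R = 1 / m + 1"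
  let ?B = "\<lambda>i. if i \<le> n then {-R..R} else {0::real}"
  have "compactin (product_topology (\<lambda>i. euclidean) UNIV) (PiE UNIV ?B)"
    by (subst compactin_PiE) auto
  then have cB: "compact (PiE UNIV ?B)"
    by (simp add: euclidean_product_topology)
  have sub: "admissible S p \<subseteq> PiE UNIV ?B"
  proof (clarsimp simp: admissible_def PiE_def Pi_def)
    fix s i assume "M s s = 1" "i \<le> n"
    then have "m * (s i)\<^sup>2 \<le> 1" using M_coercive[of i s] by simp
    then have "(s i)\<^sup>2 \<le> 1/m" using m_pos by (simp add: field_simps)
    also have "\<dots> \<le> R\<^sup>2"
    proof -
      have "k \<le> (k + 1)\<^sup>2" if "0 < k" for k :: real
        using that by (simp add: power2_sum)
      from this[of "1/m"] m_pos show ?thesis by (simp only: R_def zero_less_divide_1_iff)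
    qed
    finally have "\<bar>s i\<bar> \<le> \<bar>R\<bar>" by (simp add: abs_le_square_iff)
    moreover have "0 < R" using m_pos by (simp add: R_def add_pos_pos)
    ultimately have "\<bar>s i\<bar> \<le> R" by simp
    then show "- R \<le> s i \<and> s i \<le> R" by auto
  qed
  have c0: "closed {s :: nat \<Rightarrow> real. s i = 0}" for i
    by (intro closed_Collect_eq continuous_on_product_coordinates continuous_intros)
  have c1: "closed {s. M s (S q) = 0}" for q
    by (intro closed_Collect_eq M_cont continuous_intros)
  have c2: "closed {s. M s s = 1}"
    by (intro closed_Collect_eq M_cont continuous_intros)
  have "admissible S p = (\<Inter>i\<in>{n<..}. {s. s i = 0}) \<inter> (\<Inter>q\<in>{..<p}. {s. M s (S q) = 0}) \<inter> {s. M s s = 1}"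
    by (auto simp: admissible_def)
  then have "closed (admissible S p)"
    using c0 c1 c2 by (metis (no_types, lifting) closed_INT closed_Int)
  then show ?thesis using cB sub by (metis compact_Int_closed inf.absorb_iff2)
qed

lemma admissible_nonempty:
  assumes "p \<le> n" shows "admissible S p \<noteq> {}"
proof -
  define \<delta> :: "nat \<Rightarrow> nat \<Rightarrow> real" where "\<delta> i = (\<lambda>j. if j = i then 1 else 0)" for i
  obtain c where c: "\<exists>j\<in>{..n}. c j \<noteq> 0" "\<And>q. q < p \<Longrightarrow> (\<Sum>j\<le>n. M (\<delta> j) (S q) * c j) = 0"
    using homogeneous_system[of "{..<p}" "{..n}" "\<lambda>q j. M (\<delta> j) (S q)"] assms by auto
  define s where "s i = (\<Sum>j\<le>n. c j * \<delta> j i)" for i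
  have s_val: "s i = (if i \<le> n then c i else 0)" for i
    by (simp add: s_def \<delta>_def if_distrib[of "\<lambda>z. c _ * z"] cong: if_cong)
  have orth: "M s (S q) = 0" if "q < p" for q
    using c(2)[OF that] M_sum[of "{..n}" c \<delta> "S q"] by (simp add: s_def[abs_def] mult.commute)
  obtain j where "j \<le> n" "s j \<noteq> 0" using c(1) s_val by auto
  then have pos: "0 < M s s" using M_nonneg[of s] M_eq_0[of s j] by force
  have s_0: "s i = 0" if "n < i" for i using s_val[of i] that by simp
  define r where "r = 1 / sqrt (M s s)"
  have r2: "r * (r * M s s) = 1" using pos by (simp add: r_def field_simps flip: power2_eq_square)
  have "M (\<lambda>i. r * s i) (\<lambda>i. r * s i) = 1"
    using r2 by (simp add: M_scale M_sym[of s "\<lambda>i. r * s i"])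
  then have "(\<lambda>i. r * s i) \<in> admissible S p"
    using orth s_0 by (simp add: admissible_def M_scale)
  then show ?thesis by blast
qed

definition next_mode :: "(nat \<Rightarrow> nat \<Rightarrow> real) \<Rightarrow> nat \<Rightarrow> nat \<Rightarrow> real" where
  "next_mode S p = (SOME s. s \<in> admissible S p \<and> (\<forall>t\<in>admissible S p. K s s \<le> K t t))"

lemma next_mode:
  assumes "p \<le> n"
  shows "next_mode S p \<in> admissible S p" "t \<in> admissible S p \<Longrightarrow> K (next_mode S p) (next_mode S p) \<le> K t t"
proof -
  have "\<exists>s\<in>admissible S p. \<forall>t\<in>admissible S p. K s s \<le> K t t"
    by (rule continuous_attains_inf[OF compact_admissible admissible_nonempty[OF assms]])
       (rule continuous_on_subset[OF K_cont], simp)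
  then have "next_mode S p \<in> admissible S p \<and> (\<forall>t\<in>admissible S p. K (next_mode S p) (next_mode S p) \<le> K t t)"
    unfolding next_mode_def Bex_def by (rule someI_ex)
  note A = this
  show "next_mode S p \<in> admissible S p" by (rule conjunct1[OF A])
  show "K (next_mode S p) (next_mode S p) \<le> K t t" if "t \<in> admissible S p"
    by (rule bspec[OF conjunct2[OF A] that])
qed

text \<open>Each mode depends on all earlier ones, hence the well-founded recursion.
  \<open>admissible\<close> reads only the entries of its first argument below \<open>p\<close>, so
  the truncation by \<open>cut\<close> does no harm.\<close>

lemma modes_exist:
  "\<exists>S. \<forall>p\<le>n. S p \<in> admissible S p \<and> (\<forall>t\<in>admissible S p. K (S p) (S p) \<le> K t t)"
proof -
  define S where "S = wfrec less_than next_mode"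
  have adm_cong: "admissible f p = admissible g p" if "\<And>q. q < p \<Longrightarrow> f q = g q" for f g p
    using that by (auto simp: admissible_def)
  have eq: "next_mode S p = S p" for p
  proof -
    have "S p = next_mode (cut S less_than p) p"
      unfolding S_def by (subst wfrec) auto
    also have "admissible (cut S less_than p) p = admissible S p"
      by (rule adm_cong) (simp add: cut_def)
    then have "next_mode (cut S less_than p) p = next_mode S p"
      by (simp add: next_mode_def)
    finally show ?thesis by (rule sym)
  qed
  show ?thesis
  proof (intro exI[of _ S] allI impI conjI ballI)
    fix p assume p: "p \<le> n"
    show "S p \<in> admissible S p" using next_mode(1)[OF p, of S] unfolding eq .
    show "K (S p) (S p) \<le> K t t" if "t \<in> admissible S p" for t
      using next_mode(2)[OF p that] unfolding eq .
  qed
qed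

text \<open>The first variation vanishes at a minimum: for small \<open>r\<close> of the right sign
  a nonzero linear term would dominate the quadratic one. This turns minimality into the Euler
  equation.\<close>

lemma nonneg_quadratic_linear_part:
  fixes \<beta> \<gamma> :: real
  assumes "\<And>r. 0 \<le> 2 * r * \<beta> + r\<^sup>2 * \<gamma>"
  shows "\<beta> = 0"
proof (rule ccontr)
  assume "\<beta> \<noteq> 0"
  define D where "D = \<bar>\<gamma>\<bar> + 1"
  have D: "D > 0" "\<gamma> < D" by (auto simp: D_def)
  have "2 * (-\<beta>/D) * \<beta> + (-\<beta>/D)\<^sup>2 * \<gamma> = (\<beta>\<^sup>2 / D) * (\<gamma>/D - 2)"
    using D by (simp add: power2_eq_square field_simps)
  moreover have "\<gamma>/D - 2 < 0" using D by (simp add: field_simps)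
  moreover have "\<beta>\<^sup>2 / D > 0" using D \<open>\<beta> \<noteq> 0\<close> by simp
  ultimately have "2 * (-\<beta>/D) * \<beta> + (-\<beta>/D)\<^sup>2 * \<gamma> < 0" by (metis mult_pos_neg)
  with assms[of "-\<beta>/D"] show False by simp
qed

text \<open>Successive minimizers of the Rayleigh quotient. The second clause is the generalized
  eigenvalue equation in weak form; the last one says, by duality, that the modes span.\<close>

theorem simultaneous_diagonalization:
  "\<exists>S ev. (\<forall>p\<le>n. \<forall>q\<le>n. M (S p) (S q) = (if p = q then 1 else 0))
      \<and> (\<forall>p\<le>n. \<forall>s. K s (S p) = ev p * M s (S p))
      \<and> (\<forall>p\<le>n. \<forall>q\<le>p. ev q \<le> ev p)
      \<and> (\<forall>s. ev 0 * M s s \<le> K s s)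
      \<and> (\<forall>s. (\<forall>p\<le>n. M s (S p) = 0) \<longrightarrow> (\<forall>i\<le>n. s i = 0))"
proof -
  obtain S where S: "\<And>p. p \<le> n \<Longrightarrow> S p \<in> admissible S p"
    "\<And>p t. p \<le> n \<Longrightarrow> t \<in> admissible S p \<Longrightarrow> K (S p) (S p) \<le> K t t"
    using modes_exist by blast
  define ev where "ev p = K (S p) (S p)" for p
  have orth: "M (S p) (S q) = (if p = q then 1 else 0)" if "p \<le> n" "q \<le> n" for p q
    using S(1)[OF that(1)] S(1)[OF that(2)] M_sym[of "S p" "S q"]
    by (cases p q rule: linorder_cases) (auto simp: admissible_def)
  have rayleigh: "ev p * M t t \<le> K t t" if p: "p \<le> n" and t: "\<And>q. q < p \<Longrightarrow> M t (S q) = 0" for p t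
  proof (cases "M t t = 0")
    case True
    then have "t i = 0" if "i \<le> n" for i using M_eq_0 that by blast
    then have "K t t = K (\<lambda>_. 0) t" by (intro K_cong) auto
    then show ?thesis using True K_zero by simp
  next
    case False
    then have pos: "0 < M t t" using M_nonneg[of t] by simp
    \<comment> \<open>Truncation brings an arbitrary vector into the normal form that
      \<open>admissible\<close> demands and changes neither form.\<close>
    define t' where "t' i = (if i \<le> n then t i else 0)" for i
    have M': "M t' v = M t v" and K': "K t' v = K t v" for v
      by (intro M_cong K_cong; simp add: t'_def)+
    have MM: "M t' t' = M t t" and KK: "K t' t' = K t t"
      using M' K' M_sym K_sym by metis+
    define r where "r = 1 / sqrt (M t t)"
    have r2: "r\<^sup>2 = 1 / M t t" using pos by (simp add: r_def power_divide)
    have Mr: "M (\<lambda>i. r * t' i) (\<lambda>i. r * t' i) = r\<^sup>2 * M t t"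
      by (simp add: M_scale M_sym[of t' "\<lambda>i. r * t' i"] MM power2_eq_square)
    have Kr: "K (\<lambda>i. r * t' i) (\<lambda>i. r * t' i) = r\<^sup>2 * K t t"
      by (simp add: K_scale K_sym[of t' "\<lambda>i. r * t' i"] KK power2_eq_square)
    have "(\<lambda>i. r * t' i) \<in> admissible S p"
      using Mr r2 pos t by (simp add: admissible_def M_scale M') (simp add: t'_def)
    from S(2)[OF p this] Kr r2 pos show ?thesis by (simp add: ev_def field_simps)
  qed
  \<comment> \<open>A direction orthogonal to the earlier modes keeps the perturbed vector
    orthogonal to them, so \<open>rayleigh\<close> holds for every size \<open>r\<close> of the
    perturbation.\<close>
  have euler: "K v (S p) = ev p * M v (S p)" if p: "p \<le> n" and v: "\<And>q. q < p \<Longrightarrow> M v (S q) = 0" for p v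
  proof -
    have "0 \<le> 2 * r * (K v (S p) - ev p * M v (S p)) + r\<^sup>2 * (K v v - ev p * M v v)" for r
    proof -
      let ?t = "\<lambda>i. S p i + r * v i"
      have adm: "M (S p) (S q) = 0" if "q < p" for q using orth[of p q] p that by simp
      have "ev p * M ?t ?t \<le> K ?t ?t"
        by (rule rayleigh[OF p]) (simp add: M_linear v adm)
      moreover have "M ?t ?t = 1 + 2 * r * M v (S p) + r\<^sup>2 * M v v"
        using orth[OF p p] M_sym[of "S p" ?t] M_sym[of v ?t] M_sym[of "S p" v]
        by (simp add: M_linear power2_eq_square algebra_simps)
      moreover have "K ?t ?t = ev p + 2 * r * K v (S p) + r\<^sup>2 * K v v"
        using K_sym[of "S p" ?t] K_sym[of v ?t] K_sym[of "S p" v]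
        by (simp add: K_linear power2_eq_square algebra_simps ev_def)
      ultimately show ?thesis by (simp add: algebra_simps)
    qed
    from nonneg_quadratic_linear_part[OF this] show ?thesis by simp
  qed
  \<comment> \<open>An arbitrary \<open>s\<close> is reduced to such a direction by subtracting its
    projection onto the earlier modes; by the induction hypothesis these are also
    \<open>K\<close>-orthogonal to \<open>S p\<close>.\<close>
  have eig: "K s (S p) = ev p * M s (S p)" if "p \<le> n" for p s
    using that
  proof (induction p arbitrary: s rule: less_induct)
    case (less p)
    define v where "v i = s i + (-1) * (\<Sum>q<p. M s (S q) * S q i)" for i
    have Mv: "M v (S r) = M s (S r) - (\<Sum>q<p. M s (S q) * M (S q) (S r))" for r
      unfolding v_def[abs_def] by (subst M_linear, subst M_sum) auto
    have Kv: "K v (S r) = K s (S r) - (\<Sum>q<p. M s (S q) * K (S q) (S r))" for r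
      unfolding v_def[abs_def] by (subst K_linear, subst K_sum) auto
    have v0: "M v (S r) = 0" if "r < p" for r
    proof -
      have "(\<Sum>q<p. M s (S q) * M (S q) (S r)) = (\<Sum>q<p. if q = r then M s (S r) else 0)"
        by (rule sum.cong) (use orth that less.prems in auto)
      then show ?thesis using that by (simp add: Mv)
    qed
    have "K (S q) (S p) = 0" if "q < p" for q
      using less.IH[OF that, of "S p"] orth[of p q] less.prems that K_sym[of "S p" "S q"] by simp
    then have "K v (S p) = K s (S p)" by (simp add: Kv)
    moreover have "M v (S p) = M s (S p)"
      using orth less.prems by (simp add: Mv)
    ultimately show ?case using euler[OF less.prems v0] by simp
  qed
  have complete: "s i = 0" if s: "\<And>p. p \<le> n \<Longrightarrow> M s (S p) = 0" and i: "i \<le> n" for s i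
  proof (rule ccontr)
    assume "s i \<noteq> 0"
    then have Ms: "M s s \<noteq> 0" using M_eq_0[of s i] i by blast
    \<comment> \<open>The modes together with \<open>s\<close> are n + 2 vectors with n + 1 relevant
      entries, hence dependent. Pairing the relation with \<open>s\<close> and with each mode makes
      all its coefficients vanish.\<close>
    define S' where "S' = S(Suc n := s)"
    obtain c where c: "\<exists>p\<in>{..Suc n}. c p \<noteq> 0" "\<And>j. j \<le> n \<Longrightarrow> (\<Sum>p\<le>Suc n. S' p j * c p) = 0"
      using homogeneous_system[of "{..n}" "{..Suc n}" "\<lambda>j p. S' p j"] by auto
    have 0: "(\<Sum>p\<le>Suc n. c p * M (S' p) v) = 0" for v
    proof -
      have "(\<Sum>p\<le>Suc n. c p * M (S' p) v) = M (\<lambda>i. \<Sum>p\<le>Suc n. c p * S' p i) v"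
        by (rule M_sum[symmetric]) simp
      also have "\<dots> = M (\<lambda>_. 0) v"
        by (rule M_cong) (use c(2) in \<open>simp add: mult.commute\<close>)
      finally show ?thesis by (simp add: M_zero)
    qed
    have "c (Suc n) = 0"
    proof -
      have "(\<Sum>p\<le>n. c p * M (S' p) s) = 0"
        by (rule sum.neutral) (use s M_sym in \<open>auto simp: S'_def\<close>)
      with 0[of s] Ms show ?thesis by (simp add: S'_def)
    qed
    moreover have "c q = 0" if "q \<le> n" for q
    proof -
      have "(\<Sum>p\<le>n. c p * M (S' p) (S q)) = (\<Sum>p\<le>n. if p = q then c q else 0)"
        by (rule sum.cong) (use orth that in \<open>auto simp: S'_def\<close>)
      with 0[of "S q"] s[OF that] that show ?thesis by (simp add: S'_def)
    qed
    ultimately show False using c(1) by (metis atMost_iff le_Suc_eq)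
  qed
  have mono: "ev q \<le> ev p" if "p \<le> n" "q \<le> p" for p q
    using rayleigh[of q "S p"] orth that by (auto simp: ev_def)
  show ?thesis
  proof (intro exI conjI allI impI)
    show "M (S p) (S q) = (if p = q then 1 else 0)" if "p \<le> n" "q \<le> n" for p q
      by (rule orth[OF that])
    show "K s (S p) = ev p * M s (S p)" if "p \<le> n" for p s by (rule eig[OF that])
    show "ev q \<le> ev p" if "p \<le> n" "q \<le> p" for p q by (rule mono[OF that])
    show "ev 0 * M s s \<le> K s s" for s by (rule rayleigh) auto
    show "s i = 0" if "\<forall>p\<le>n. M s (S p) = 0" "i \<le> n" for s i
      by (rule complete[OF _ that(2)]) (use that(1) in blast)
  qed
qed

end

section \<open>Piecewise linear functions in one dimension\<close>

definition slope :: "(nat \<Rightarrow> real) \<Rightarrow> (nat \<Rightarrow> real) \<Rightarrow> nat \<Rightarrow> real" where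
  "slope x t i = (t (Suc i) - t i) / (x (Suc i) - x i)"

text \<open>The exact L^2 product of the continuous piecewise linear functions with nodal values
  \<open>s\<close> and \<open>t\<close>, assembled from the element matrix h/6 ((2, 1), (1, 2)).
  \<open>stiff\<close> is the L^2 product of their derivatives.\<close>

definition mass :: "nat \<Rightarrow> (nat \<Rightarrow> real) \<Rightarrow> (nat \<Rightarrow> real) \<Rightarrow> (nat \<Rightarrow> real) \<Rightarrow> real" where
  "mass n x s t = (\<Sum>i<n. (x (Suc i) - x i) / 6 *
     (2 * s i * t i + s i * t (Suc i) + s (Suc i) * t i + 2 * s (Suc i) * t (Suc i)))"

definition stiff :: "nat \<Rightarrow> (nat \<Rightarrow> real) \<Rightarrow> (nat \<Rightarrow> real) \<Rightarrow> (nat \<Rightarrow> real) \<Rightarrow> real" where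
  "stiff n x s t = (\<Sum>i<n. (s (Suc i) - s i) * (t (Suc i) - t i) / (x (Suc i) - x i))"

text \<open>The continuous piecewise linear interpolant of the nodal values \<open>t\<close>, as a sum of clamped
  ramps so that continuity and the Lipschitz bound are immediate.\<close>

definition interp :: "nat \<Rightarrow> (nat \<Rightarrow> real) \<Rightarrow> (nat \<Rightarrow> real) \<Rightarrow> real \<Rightarrow> real" where
  "interp n x t s = t 0 + (\<Sum>i<n. slope x t i * max 0 (min (s - x i) (x (Suc i) - x i)))"

lemma continuous_on_interp [continuous_intros]:
  "continuous_on A f \<Longrightarrow> continuous_on A (\<lambda>s. interp n x t (f s))"
  unfolding interp_def by (intro continuous_intros)

lemma interp_lipschitz: "\<bar>interp n x t s - interp n x t s'\<bar> \<le> (\<Sum>i<n. \<bar>slope x t i\<bar>) * \<bar>s - s'\<bar>"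
proof -
  have "interp n x t s - interp n x t s' =
    (\<Sum>i<n. slope x t i * (max 0 (min (s - x i) (x (Suc i) - x i)) - max 0 (min (s' - x i) (x (Suc i) - x i))))"
    by (simp add: interp_def sum_subtractf right_diff_distrib)
  also have "\<bar>\<dots>\<bar> \<le> (\<Sum>i<n. \<bar>slope x t i\<bar> * \<bar>s - s'\<bar>)"
  proof (rule order_trans[OF sum_abs], rule sum_mono)
    fix i
    have "\<bar>max 0 (min (s - x i) (x (Suc i) - x i)) - max 0 (min (s' - x i) (x (Suc i) - x i))\<bar> \<le> \<bar>s - s'\<bar>"
      by (auto simp: max_def min_def)
    then show "\<bar>slope x t i * (max 0 (min (s - x i) (x (Suc i) - x i)) - max 0 (min (s' - x i) (x (Suc i) - x i)))\<bar>
        \<le> \<bar>slope x t i\<bar> * \<bar>s - s'\<bar>"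
      by (simp add: abs_mult mult_left_mono)
  qed
  finally show ?thesis by (simp add: sum_distrib_right)
qed

lemma interp_sum:
  "interp n x (\<lambda>i. \<Sum>q\<in>A. c q * S q i) s = (\<Sum>q\<in>A. c q * interp n x (S q) s)"
proof -
  have "slope x (\<lambda>i. \<Sum>q\<in>A. c q * S q i) i = (\<Sum>q\<in>A. c q * slope x (S q) i)" for i
    by (simp add: slope_def sum_divide_distrib right_diff_distrib flip: sum_subtractf)
  then show ?thesis
    unfolding interp_def
    by (simp add: sum_distrib_right sum_distrib_left distrib_left sum.distrib mult.assoc)
       (rule sum.swap)
qed

section \<open>Grids on an interval and their mass and stiffness forms\<close>

locale grid =
  fixes a b :: real and n :: nat and x :: "nat \<Rightarrow> real"
  assumes is_grid: "is_grid a b n x"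
begin

lemma n_pos: "1 \<le> n" and x_first: "x 0 = a" and x_last: "x n = b"
  and x_step: "i < n \<Longrightarrow> x i < x (Suc i)"
  using is_grid by (auto simp: is_grid_def)

lemma x_mono: "i \<le> j \<Longrightarrow> j \<le> n \<Longrightarrow> x i \<le> x j"
proof (induction j rule: dec_induct)
  case (step j)
  then show ?case using x_step[of j] by simp
qed simp

lemma x_less: "i < j \<Longrightarrow> j \<le> n \<Longrightarrow> x i < x j"
  using x_mono[of "Suc i" j] x_step[of i] by simp

lemma x_inj: "i \<le> n \<Longrightarrow> j \<le> n \<Longrightarrow> x i = x j \<longleftrightarrow> i = j"
  using x_less by (metis less_irrefl linorder_neqE_nat)

lemma a_less_b: "a < b"
  using x_less[of 0 n] n_pos by (simp add: x_first x_last)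

lemma cell_subset: "i < n \<Longrightarrow> {x i..x (Suc i)} \<subseteq> {a..b}"
  using x_mono[of 0 i] x_mono[of "Suc i" n] by (auto simp: x_first x_last)

lemma cell_cover:
  assumes "s \<in> {a..b}" shows "\<exists>i<n. s \<in> {x i..x (Suc i)}"
proof -
  have "k \<le> n \<Longrightarrow> s \<le> x k \<Longrightarrow> 1 \<le> k \<Longrightarrow> \<exists>i<k. s \<in> {x i..x (Suc i)}" for k
  proof (induction k)
    case (Suc k)
    show ?case
    proof (cases "s \<le> x k \<and> 1 \<le> k")
      case True
      then show ?thesis using Suc by (meson Suc_leD less_Suc_eq)
    next
      case False
      then have "x k \<le> s" using assms x_first by (cases k) auto
      then show ?thesis using Suc.prems by auto
    qed
  qed simp
  from this[of n] show ?thesis using assms n_pos x_last by auto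
qed

text \<open>Ramps to the left of the cell are saturated and telescope to \<open>t i - t 0\<close>;
  ramps to its right have not started.\<close>

lemma interp_cell:
  assumes i: "i < n" and s: "s \<in> {x i..x (Suc i)}"
  shows "interp n x t s = t i + slope x t i * (s - x i)"
proof -
  let ?f = "\<lambda>j. slope x t j * max 0 (min (s - x j) (x (Suc j) - x j))"
  have "(\<Sum>j<n. ?f j) = (\<Sum>j\<le>i. ?f j)"
  proof (rule sum.mono_neutral_right)
    show "\<forall>j\<in>{..<n} - {..i}. ?f j = 0"
    proof
      fix j assume "j \<in> {..<n} - {..i}"
      then have "s \<le> x j" using s x_mono[of "Suc i" j] by auto
      then show "?f j = 0" by (simp add: max_def min_def)
    qed
  qed (use i in auto)
  also have "\<dots> = (\<Sum>j<i. ?f j) + ?f i"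
    by (simp add: lessThan_Suc_atMost[symmetric])
  also have "(\<Sum>j<i. ?f j) = (\<Sum>j<i. t (Suc j) - t j)"
  proof (rule sum.cong)
    fix j assume "j \<in> {..<i}"
    then have "x (Suc j) \<le> s" "x j < x (Suc j)"
      using s i x_mono[of "Suc j" i] x_step[of j] by auto
    then show "?f j = t (Suc j) - t j" by (simp add: slope_def max_def min_def)
  qed simp
  also have "\<dots> = t i - t 0" by (rule sum_lessThan_telescope)
  also have "?f i = slope x t i * (s - x i)" using s by (simp add: max_def min_def)
  finally show ?thesis by (simp add: interp_def)
qed

lemma interp_deriv:
  assumes i: "i < n" and s: "s \<in> {x i<..<x (Suc i)}"
  shows "(interp n x t has_real_derivative slope x t i) (at s)"
proof (rule has_field_derivative_transform_within_open)
  show "((\<lambda>s. t i + slope x t i * (s - x i)) has_real_derivative slope x t i) (at s)"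
    by (auto intro!: derivative_eq_intros)
  show "t i + slope x t i * (s - x i) = interp n x t s" if "s \<in> {x i<..<x (Suc i)}" for s
    using interp_cell[OF i, of s t] that by simp
qed (use s in auto)

lemma has_integral_cells:
  fixes f :: "real \<Rightarrow> real"
  assumes "\<And>i. i < n \<Longrightarrow> (f has_integral I i) {x i..x (Suc i)}"
  shows "(f has_integral (\<Sum>i<n. I i)) {a..b}"
proof -
  have "k \<le> n \<Longrightarrow> (f has_integral (\<Sum>i<k. I i)) {x 0..x k}" for k
  proof (induction k)
    case 0
    then show ?case using has_integral_refl(1)[of f "x 0"] by simp
  next
    case (Suc k)
    have "(f has_integral (\<Sum>i<k. I i) + I k) {x 0..x (Suc k)}"
      using Suc assms[of k] x_mono[of 0 k] x_step[of k]
      by (intro has_integral_combine[where c = "x k" and a = "x 0" and b = "x (Suc k)"]) auto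
    then show ?case by simp
  qed
  from this[of n] show ?thesis by (simp add: x_first x_last)
qed

text \<open>For end values p, q the element quadratic form is p^2 + q^2 + (p + q)^2 up to the factor
  h/6, so with \<open>h\<close> the smallest cell width the mass form controls every nodal
  value.\<close>

lemma form_pair: "\<exists>m. form_pair n (mass n x) (stiff n x) m"
proof -
  define h where "h = Min ((\<lambda>i. x (Suc i) - x i) ` {..<n})"
  have ne: "(\<lambda>i. x (Suc i) - x i) ` {..<n} \<noteq> {}" using n_pos by (auto simp: lessThan_empty_iff)
  have h: "0 < h" using ne x_step by (simp add: h_def)
  have hi: "h \<le> x (Suc i) - x i" if "i < n" for i using that by (simp add: h_def)
  have coercive: "h / 6 * (s i)\<^sup>2 \<le> mass n x s s" if "i \<le> n" for s i
  proof -
    obtain j where j: "j < n" "i = j \<or> i = Suc j" using \<open>i \<le> n\<close> n_pos by (cases "i < n") (auto, cases i, auto)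
    let ?f = "\<lambda>i. (x (Suc i) - x i) / 6 *
     (2 * s i * s i + s i * s (Suc i) + s (Suc i) * s i + 2 * s (Suc i) * s (Suc i))"
    have sq: "2 * s i * s i + s i * s (Suc i) + s (Suc i) * s i + 2 * s (Suc i) * s (Suc i)
        = (s i)\<^sup>2 + (s (Suc i))\<^sup>2 + (s i + s (Suc i))\<^sup>2" for i
      by (simp add: power2_eq_square algebra_simps)
    have "h / 6 * (s i)\<^sup>2 \<le> (x (Suc j) - x j) / 6 * ((s j)\<^sup>2 + (s (Suc j))\<^sup>2 + (s j + s (Suc j))\<^sup>2)"
      by (rule mult_mono) (use h hi[OF j(1)] j(2) in auto)
    also have "\<dots> = ?f j" by (simp only: sq)
    also have "\<dots> \<le> (\<Sum>i<n. ?f i)"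
    proof (rule member_le_sum)
      show "0 \<le> ?f i" if "i \<in> {..<n} - {j}" for i
        unfolding sq using x_step[of i] that by auto
    qed (use j in auto)
    finally show ?thesis by (simp add: mass_def)
  qed
  have cont: "continuous_on UNIV (\<lambda>s::nat \<Rightarrow> real. s i)" for i
    by (rule continuous_on_product_coordinates)
  have "form_pair n (mass n x) (stiff n x) (h / 6)"
  proof
    fix s t v :: "nat \<Rightarrow> real" and r :: real
    show "mass n x (\<lambda>i. s i + r * t i) v = mass n x s v + r * mass n x t v"
      unfolding mass_def sum_distrib_left sum.distrib[symmetric]
      by (rule sum.cong) (auto simp: algebra_simps)
    show "stiff n x (\<lambda>i. s i + r * t i) v = stiff n x s v + r * stiff n x t v"
      unfolding stiff_def sum_distrib_left sum.distrib[symmetric]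
      by (rule sum.cong) (auto simp: algebra_simps add_divide_distrib diff_divide_distrib)
    show "mass n x s t = mass n x t s" unfolding mass_def by (simp add: algebra_simps)
    show "stiff n x s t = stiff n x t s" unfolding stiff_def by (simp add: algebra_simps)
    show "continuous_on UNIV (\<lambda>s. mass n x s s)" "continuous_on UNIV (\<lambda>s. mass n x s t)"
      unfolding mass_def by (intro continuous_intros cont)+
    show "continuous_on UNIV (\<lambda>s. stiff n x s s)"
      unfolding stiff_def divide_inverse by (intro continuous_intros cont)
    show "0 < h / 6" using h by simp
    show "h / 6 * (s i)\<^sup>2 \<le> mass n x s s" if "i \<le> n" for i by (rule coercive[OF that])
    fix s' :: "nat \<Rightarrow> real" assume "\<And>i. i \<le> n \<Longrightarrow> s i = s' i"
    then show "mass n x s t = mass n x s' t" "stiff n x s t = stiff n x s' t"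
      unfolding mass_def stiff_def by (auto intro!: sum.cong)
  qed
  then show ?thesis by blast
qed

text \<open>Picone's identity for \<open>w = cos (\<omega> (s - a))\<close>: with \<open>G = \<sigma>\<^sup>2 w' / w = - \<omega> \<sigma>\<^sup>2 tan (\<omega> (s - a))\<close>
  one has \<open>\<sigma>'\<^sup>2 - \<omega>\<^sup>2 \<sigma>\<^sup>2 - G' = (\<sigma>' + \<omega> \<sigma> tan (\<omega> (s - a)))\<^sup>2\<close>, and \<open>G\<close> extends continuously by \<open>0\<close>
  (the value of \<open>tan\<close> at its poles in HOL) because \<open>\<sigma>\<close> vanishes at the zeros of \<open>w\<close>.\<close>

lemma picone:
  fixes p :: nat
  assumes p: "1 \<le> p"
    and zeros: "\<And>k. k < p \<Longrightarrow> interp n x t (a + (2 * real k + 1) * (b - a) / (2 * p)) = 0"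
  shows "(p * pi / (b - a))\<^sup>2 * mass n x t t \<le> stiff n x t t"
proof -
  define \<omega> where "\<omega> = p * pi / (b - a)"
  define \<sigma> where "\<sigma> = interp n x t"
  define \<theta> where "\<theta> s = \<omega> * (s - a)" for s
  define D where "D = deriv \<sigma>"
  define Z where "Z = (\<lambda>k::nat. a + (2 * real k + 1) * (b - a) / (2 * p)) ` {..<p}"
  have \<omega>: "0 < \<omega>" using p a_less_b by (simp add: \<omega>_def)
  \<comment> \<open>Every zero of \<open>w\<close> in the interval is one of the \<open>p\<close>
    points where \<open>\<sigma>\<close> vanishes by assumption; the bound s <= b limits the number
    of the zero.\<close>
  have zero: "s \<in> Z" if s: "s \<in> {a..b}" "cos (\<theta> s) = 0" for s
  proof -
    have "0 \<le> \<theta> s" using s \<omega> by (simp add: \<theta>_def)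
    with s(2) obtain k :: nat where k: "odd k" "\<theta> s = k * (pi/2)" using cos_zero_lemma by blast
    then obtain j where j: "k = 2 * j + 1" by (elim oddE)
    have "\<theta> s = p * pi * ((s - a) / (b - a))" by (simp add: \<theta>_def \<omega>_def)
    with k j have "p * ((s - a) / (b - a)) * pi = (2 * real j + 1) / 2 * pi" by (simp add: algebra_simps)
    then have e: "p * ((s - a) / (b - a)) = (2 * real j + 1) / 2"
      using mult_right_cancel[OF pi_neq_zero] by blast
    have "(s - a) / (b - a) \<le> 1" using s a_less_b by (simp add: divide_le_eq)
    then have "p * ((s - a) / (b - a)) \<le> p"
      by (metis mult.right_neutral mult_left_mono of_nat_0_le_iff)
    then have "(2 * real j + 1) / 2 \<le> p" unfolding e .
    then have "j < p" by simp
    moreover have "s = a + (2 * real j + 1) * (b - a) / (2 * p)"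
      using e p a_less_b by (simp add: field_simps)
    ultimately show ?thesis by (auto simp: Z_def)
  qed
  have \<sigma>Z: "\<sigma> s = 0" if "s \<in> Z" for s
    using that zeros by (auto simp: Z_def \<sigma>_def)
  define G where "G s = - \<omega> * (\<sigma> s)\<^sup>2 * tan (\<theta> s)" for s
  define G' where "G' s = - \<omega> * (2 * \<sigma> s * D s * tan (\<theta> s)) - \<omega>\<^sup>2 * (\<sigma> s)\<^sup>2 * (1 + (tan (\<theta> s))\<^sup>2)" for s
  have \<sigma>_cont: "isCont \<sigma> s" for s
    using continuous_on_interp[of UNIV "\<lambda>s. s" n x t] unfolding \<sigma>_def
    by (simp add: continuous_on_eq_continuous_at)
  have G_cont: "isCont G s" if s: "s \<in> {a..b}" for s
  proof (cases "cos (\<theta> s) = 0")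
    case False
    have "isCont \<theta> s" unfolding \<theta>_def by (intro continuous_intros)
    then show ?thesis unfolding G_def
      by (intro continuous_intros \<sigma>_cont False)
  next
    case True
    then have \<sigma>0: "\<sigma> s = 0" using zero s \<sigma>Z by blast
    \<comment> \<open>At a pole of \<open>tan\<close> one factor \<open>\<sigma>\<close> is at most
      \<open>C * \<bar>r - s\<bar>\<close> and absorbs the simple zero of the cosine; the other
      factor \<open>\<sigma>\<close> still tends to 0, and so does \<open>G\<close>.\<close>
    define C where "C = (\<Sum>i<n. \<bar>slope x t i\<bar>)"
    have C: "\<bar>\<sigma> r\<bar> \<le> C * \<bar>r - s\<bar>" for r
      using interp_lipschitz[of n x t r s] \<sigma>0 by (simp add: \<sigma>_def C_def)
    have sin0: "sin (\<theta> s) \<noteq> 0" using True sin_cos_squared_add[of "\<theta> s"] by auto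
    have "((\<lambda>r. cos (\<theta> r)) has_real_derivative - \<omega> * sin (\<theta> s)) (at s)"
      unfolding \<theta>_def by (auto intro!: derivative_eq_intros)
    then have "((\<lambda>r. cos (\<theta> r) / (r - s)) \<longlongrightarrow> - \<omega> * sin (\<theta> s)) (at s)"
      using True by (simp add: has_field_derivative_iff)
    then have "((\<lambda>r. inverse (cos (\<theta> r) / (r - s))) \<longlongrightarrow> inverse (- \<omega> * sin (\<theta> s))) (at s)"
      by (rule tendsto_inverse) (use \<omega> sin0 in auto)
    moreover have "(\<sigma> \<longlongrightarrow> 0) (at s)" using \<sigma>_cont[of s] \<sigma>0 by (simp add: isCont_def)
    ultimately have "((\<lambda>r. \<omega> * C * (\<bar>\<sigma> r\<bar> * \<bar>inverse (cos (\<theta> r) / (r - s))\<bar>)) \<longlongrightarrow>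
        \<omega> * C * (\<bar>0\<bar> * \<bar>inverse (- \<omega> * sin (\<theta> s))\<bar>)) (at s)"
      by (intro tendsto_mult_left tendsto_mult tendsto_rabs)
    then have lim: "((\<lambda>r. \<omega> * C * (\<bar>\<sigma> r\<bar> * \<bar>inverse (cos (\<theta> r) / (r - s))\<bar>)) \<longlongrightarrow> 0) (at s)"
      by simp
    have "(G \<longlongrightarrow> 0) (at s)"
    proof (rule Lim_null_comparison[OF _ lim], rule always_eventually, rule allI)
      fix r
      have "norm (G r) = \<omega> * (\<bar>\<sigma> r\<bar> * (\<bar>\<sigma> r\<bar> * (\<bar>sin (\<theta> r)\<bar> * \<bar>inverse (cos (\<theta> r))\<bar>)))"
        using \<omega> by (simp add: G_def abs_mult tan_def divide_inverse power2_eq_square)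
      also have "\<dots> \<le> \<omega> * (\<bar>\<sigma> r\<bar> * ((C * \<bar>r - s\<bar>) * (1 * \<bar>inverse (cos (\<theta> r))\<bar>)))"
        using \<omega> C[of r] by (intro mult_left_mono mult_mono) auto
      also have "\<dots> = \<omega> * C * (\<bar>\<sigma> r\<bar> * \<bar>inverse (cos (\<theta> r) / (r - s))\<bar>)"
        by (simp add: abs_mult divide_inverse)
      finally show "norm (G r) \<le> \<omega> * C * (\<bar>\<sigma> r\<bar> * \<bar>inverse (cos (\<theta> r) / (r - s))\<bar>)" .
    qed
    moreover have "G s = 0" by (simp add: G_def \<sigma>0)
    ultimately show ?thesis by (simp add: isCont_def)
  qed
  have \<sigma>_deriv: "(\<sigma> has_real_derivative slope x t i) (at s)" "D s = slope x t i"
    if "i < n" "s \<in> {x i<..<x (Suc i)}" for i s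
    using interp_deriv[OF that, of t] by (auto simp: \<sigma>_def D_def intro: DERIV_imp_deriv)
  have "(G' has_integral (G b - G a)) {a..b}"
  proof (rule fundamental_theorem_of_calculus_interior_strong)
    \<comment> \<open>The derivative of \<open>G\<close> may fail to exist at the nodes, where
      \<open>\<sigma>\<close> has kinks, and at the zeros of \<open>w\<close>; continuity of
      \<open>G\<close> carries the fundamental theorem across these finitely many points.\<close>
    show "finite (x ` {..n} \<union> Z)" by (simp add: Z_def)
    fix s assume s: "s \<in> {a<..<b} - (x ` {..n} \<union> Z)"
    then obtain i where i: "i < n" "s \<in> {x i..x (Suc i)}" using cell_cover[of s] by auto
    have "s \<noteq> x i" "s \<noteq> x (Suc i)" using s i(1) by auto
    then have i': "s \<in> {x i<..<x (Suc i)}" using i by auto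
    have "cos (\<theta> s) \<noteq> 0" using zero[of s] s by auto
    moreover have "(\<theta> has_real_derivative \<omega>) (at s)"
      unfolding \<theta>_def by (auto intro!: derivative_eq_intros)
    moreover have "(\<sigma> has_real_derivative D s) (at s)"
      using \<sigma>_deriv[OF i(1) i'] by simp
    ultimately have "(G has_real_derivative G' s) (at s)"
      unfolding G_def G'_def
      by (auto intro!: derivative_eq_intros simp: tan_def power2_eq_square field_simps)
         (simp add: sin_squared_eq algebra_simps flip: power2_eq_square)
    then show "(G has_vector_derivative G' s) (at s)"
      by (simp add: has_real_derivative_iff_has_vector_derivative)
  qed (use a_less_b G_cont in \<open>auto intro!: continuous_at_imp_continuous_on\<close>)
  \<comment> \<open>This is where the Neumann condition enters: w' vanishes at both ends,
    \<open>tan\<close> being 0 at 0 and at p pi, so the boundary terms disappear whatever the end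
    values of \<open>\<sigma>\<close>.\<close>
  moreover have "G a = 0" "G b = 0"
    using a_less_b by (simp_all add: G_def \<theta>_def \<omega>_def tan_def)
  ultimately have int0: "(G' has_integral 0) {a..b}" by simp
  define I where "I i = (t (Suc i) - t i) * (t (Suc i) - t i) / (x (Suc i) - x i) - \<omega>\<^sup>2 * ((x (Suc i) - x i) / 6 *
     (2 * t i * t i + t i * t (Suc i) + t (Suc i) * t i + 2 * t (Suc i) * t (Suc i)))" for i
  have "((\<lambda>s. (D s)\<^sup>2 - \<omega>\<^sup>2 * (\<sigma> s)\<^sup>2) has_integral (\<Sum>i<n. I i)) {a..b}"
  proof (rule has_integral_cells)
    fix i assume i: "i < n"
    define m where "m = slope x t i"
    define h where "h = x (Suc i) - x i"
    define F where "F s = m\<^sup>2 * s - \<omega>\<^sup>2 * ((t i)\<^sup>2 * s + t i * m * (s - x i)\<^sup>2 + m\<^sup>2 * (s - x i)^3 / 3)" for s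
    have h: "0 < h" using x_step[OF i] by (simp add: h_def)
    have "((\<lambda>s. m\<^sup>2 - \<omega>\<^sup>2 * (t i + m * (s - x i))\<^sup>2) has_integral (F (x (Suc i)) - F (x i))) {x i..x (Suc i)}"
    proof (rule fundamental_theorem_of_calculus)
      fix s assume "s \<in> {x i..x (Suc i)}"
      show "(F has_vector_derivative m\<^sup>2 - \<omega>\<^sup>2 * (t i + m * (s - x i))\<^sup>2) (at s within {x i..x (Suc i)})"
        unfolding F_def has_real_derivative_iff_has_vector_derivative[symmetric]
        by (auto intro!: derivative_eq_intros simp: power2_eq_square field_simps)
    qed (use x_step[OF i] in simp)
    moreover have "F (x (Suc i)) - F (x i) = I i"
    proof -
      have mh: "m * h = t (Suc i) - t i" using h by (simp add: m_def h_def slope_def)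
      have "F (x (Suc i)) - F (x i) = m\<^sup>2 * h - \<omega>\<^sup>2 * ((t i)\<^sup>2 * h + t i * m * h\<^sup>2 + m\<^sup>2 * h^3 / 3)"
        by (simp add: F_def h_def algebra_simps)
      also have "\<dots> = (m * h) * (m * h) / h - \<omega>\<^sup>2 * (h * ((t i)\<^sup>2 + t i * (m * h) + (m * h)\<^sup>2 / 3))"
        using h by (simp add: power2_eq_square power3_eq_cube field_simps)
      also have "\<dots> = I i"
        unfolding I_def mh h_def[symmetric]
        by (intro arg_cong2[where f = "(-)"] arg_cong[where f = "\<lambda>z. \<omega>\<^sup>2 * z"] refl)
           (simp add: power2_eq_square algebra_simps diff_divide_distrib)
      finally show ?thesis .
    qed
    ultimately have "((\<lambda>s. m\<^sup>2 - \<omega>\<^sup>2 * (t i + m * (s - x i))\<^sup>2) has_integral I i) {x i..x (Suc i)}" by simp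
    then show "((\<lambda>s. (D s)\<^sup>2 - \<omega>\<^sup>2 * (\<sigma> s)\<^sup>2) has_integral I i) {x i..x (Suc i)}"
    proof (rule has_integral_spike_finite[rotated 2])
      show "finite {x i, x (Suc i)}" by simp
      fix s assume "s \<in> {x i..x (Suc i)} - {x i, x (Suc i)}"
      then have "s \<in> {x i<..<x (Suc i)}" by auto
      then show "(D s)\<^sup>2 - \<omega>\<^sup>2 * (\<sigma> s)\<^sup>2 = m\<^sup>2 - \<omega>\<^sup>2 * (t i + m * (s - x i))\<^sup>2"
        using \<sigma>_deriv(2)[OF i] interp_cell[OF i, of s t] by (simp add: \<sigma>_def m_def)
    qed
  qed
  then have "0 \<le> (\<Sum>i<n. I i)"
  proof (rule has_integral_le[OF int0])
    fix s
    have "(D s)\<^sup>2 - \<omega>\<^sup>2 * (\<sigma> s)\<^sup>2 - G' s = (D s + \<omega> * \<sigma> s * tan (\<theta> s))\<^sup>2"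
      by (simp add: G'_def power2_eq_square algebra_simps)
    then show "G' s \<le> (D s)\<^sup>2 - \<omega>\<^sup>2 * (\<sigma> s)\<^sup>2"
      by (metis diff_ge_0_iff_ge zero_le_power2)
  qed
  also have "(\<Sum>i<n. I i) = stiff n x t t - \<omega>\<^sup>2 * mass n x t t"
    by (simp add: I_def stiff_def mass_def sum_subtractf sum_distrib_left)
  finally show ?thesis by (simp add: \<omega>_def)
qed

text \<open>The constant mode 0 is left out. The last clause is the dual form of the statement that
  the increments of the other \<open>n\<close> modes span the space of cell values; piecewise
  constants are later tested in exactly this way.\<close>

theorem discrete_modes:
  "\<exists>(S :: nat \<Rightarrow> nat \<Rightarrow> real) (ev :: nat \<Rightarrow> real). (\<forall>p\<in>{1..n}. (p * pi / (b - a))\<^sup>2 \<le> ev p \<and> (\<forall>s. stiff n x s (S p) = ev p * mass n x s (S p)))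
     \<and> (\<forall>v. (\<forall>p\<in>{1..n}. (\<Sum>i<n. v i * (S p (Suc i) - S p i)) = 0) \<longrightarrow> (\<forall>i<n. v i = 0))"
proof -
  from form_pair obtain m where fp: "form_pair n (mass n x) (stiff n x) m" ..
  interpret form_pair n "mass n x" "stiff n x" m by (rule fp)
  obtain S ev where diag:
    "(\<forall>p\<le>n. \<forall>q\<le>n. mass n x (S p) (S q) = (if p = q then 1 else 0))
      \<and> (\<forall>p\<le>n. \<forall>s. stiff n x s (S p) = ev p * mass n x s (S p))
      \<and> (\<forall>p\<le>n. \<forall>q\<le>p. ev q \<le> ev p)
      \<and> (\<forall>s. ev 0 * mass n x s s \<le> stiff n x s s)
      \<and> (\<forall>s. (\<forall>p\<le>n. mass n x s (S p) = 0) \<longrightarrow> (\<forall>i\<le>n. s i = 0))"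
    using simultaneous_diagonalization by (elim exE)
  have orth: "mass n x (S p) (S q) = (if p = q then 1 else 0)" if "p \<le> n" "q \<le> n" for p q
    using conjunct1[OF diag] that by blast
  have eig: "stiff n x s (S p) = ev p * mass n x s (S p)" if "p \<le> n" for p s
    using diag that by blast
  have mono: "ev q \<le> ev p" if "p \<le> n" "q \<le> p" for p q
    using diag that by blast
  have ev0: "ev 0 * mass n x s s \<le> stiff n x s s" for s
    using diag by blast
  have complete: "s i = 0" if "\<forall>p\<le>n. mass n x s (S p) = 0" "i \<le> n" for s i
    using conjunct2[OF conjunct2[OF conjunct2[OF conjunct2[OF diag]]]] that by blast
  have stiff_nonneg: "0 \<le> stiff n x s s" for s
    unfolding stiff_def using x_step by (intro sum_nonneg divide_nonneg_nonneg) (auto intro: less_imp_le)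
  have stiff_0: "s (Suc i) - s i = 0" if "stiff n x s s = 0" "i < n" for s i
  proof -
    have "(s (Suc i) - s i) * (s (Suc i) - s i) / (x (Suc i) - x i) = 0"
      using that(1) unfolding stiff_def
      by (rule sum_nonneg_0[rotated 2]) (use x_step that(2) in \<open>auto simp: less_imp_le\<close>)
    then show ?thesis using x_step[OF that(2)] by simp
  qed
  \<comment> \<open>Constants have positive mass and zero stiffness, which forces the lowest mode to
    have zero stiffness as well, hence to be constant.\<close>
  have "ev 0 \<le> 0"
  proof -
    have "mass n x (\<lambda>_. 1) (\<lambda>_. 1) > 0"
      using M_eq_0[of "\<lambda>_. 1" 0] M_nonneg[of "\<lambda>_. 1"] by fastforce
    moreover have "stiff n x (\<lambda>_. 1) (\<lambda>_. 1) = 0" by (simp add: stiff_def)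
    ultimately show ?thesis using ev0[of "\<lambda>_. 1"] by (simp add: mult_le_0_iff)
  qed
  then have "stiff n x (S 0) (S 0) = 0"
    using eig[of 0 "S 0"] orth[of 0 0] stiff_nonneg[of "S 0"] by simp
  then have const: "S 0 (Suc i) - S 0 i = 0" if "i < n" for i using stiff_0 that by blast
  have lower: "(p * pi / (b - a))\<^sup>2 \<le> ev p" if p: "p \<in> {1..n}" for p
  proof -
    define z where "z k = a + (2 * real k + 1) * (b - a) / (2 * p)" for k :: nat
    obtain c where c: "\<exists>q\<in>{..p}. c q \<noteq> 0" "\<And>k. k < p \<Longrightarrow> (\<Sum>q\<le>p. interp n x (S q) (z k) * c q) = 0"
      using homogeneous_system[of "{..<p}" "{..p}" "\<lambda>k q. interp n x (S q) (z k)"] by auto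
    define s where "s i = (\<Sum>q\<le>p. c q * S q i)" for i
    have le1: "(p * pi / (b - a))\<^sup>2 * mass n x s s \<le> stiff n x s s"
    proof (rule picone)
      fix k assume "k < p"
      then have "interp n x s (z k) = 0"
        using c(2)[of k] interp_sum[of n x c S "{..p}" "z k"]
        by (simp add: s_def[abs_def] mult.commute)
      then show "interp n x s (a + (2 * real k + 1) * (b - a) / (2 * p)) = 0"
        unfolding z_def .
    qed (use p in simp)
    have Ms: "mass n x s (S q) = c q" if "q \<le> p" for q
    proof -
      have "mass n x s (S q) = (\<Sum>r\<le>p. c r * mass n x (S r) (S q))"
        unfolding s_def[abs_def] by (rule M_sum) simp
      also have "\<dots> = (\<Sum>r\<le>p. if r = q then c q else 0)"
        by (rule sum.cong) (use orth p that in auto)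
      finally show ?thesis using that by simp
    qed
    have "mass n x s s = (\<Sum>q\<le>p. c q * mass n x (S q) s)"
      unfolding s_def[abs_def] by (rule M_sum) simp
    also have "\<dots> = (\<Sum>q\<le>p. (c q)\<^sup>2)"
      by (rule sum.cong) (simp_all add: M_sym[of _ s] Ms power2_eq_square)
    finally have mss: "mass n x s s = (\<Sum>q\<le>p. (c q)\<^sup>2)" .
    have "stiff n x s s = (\<Sum>q\<le>p. c q * stiff n x (S q) s)"
      unfolding s_def[abs_def] by (rule K_sum) simp
    also have "\<dots> = (\<Sum>q\<le>p. ev q * (c q)\<^sup>2)"
      by (rule sum.cong) (use p eig in \<open>simp_all add: K_sym[of _ s] Ms power2_eq_square\<close>)
    also have "\<dots> \<le> (\<Sum>q\<le>p. ev p * (c q)\<^sup>2)"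
      by (intro sum_mono mult_right_mono mono) (use p in auto)
    also have "\<dots> = ev p * mass n x s s" by (simp add: mss sum_distrib_left)
    finally have le2: "stiff n x s s \<le> ev p * mass n x s s" .
    have "0 < mass n x s s"
      unfolding mss using c(1) by (intro sum_pos2[of _ "SOME q. q \<in> {..p} \<and> c q \<noteq> 0"])
        (use someI_ex[of "\<lambda>q. q \<in> {..p} \<and> c q \<noteq> 0"] in auto)
    then show ?thesis using order_trans[OF le1 le2] by (simp only: mult_le_cancel_right_pos)
  qed
  have "v i = 0" if v: "\<forall>p\<in>{1..n}. (\<Sum>i<n. v i * (S p (Suc i) - S p i)) = 0" and i: "i < n" for v i
  proof -
    \<comment> \<open>A nodal primitive of the cell values: its stiffness product with
      \<open>t\<close> is the pairing of \<open>v\<close> with the increments of \<open>t\<close>.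
      As \<open>ev p\<close> is positive for p >= 1, \<open>s\<close> has mass product 0 with every
      nonconstant mode, so \<open>s\<close> is constant and \<open>v\<close> vanishes.\<close>
    define s where "s i = (\<Sum>j<i. (x (Suc j) - x j) * v j)" for i
    have ds: "s (Suc i) - s i = (x (Suc i) - x i) * v i" for i by (simp add: s_def)
    have st: "stiff n x s t = (\<Sum>i<n. v i * (t (Suc i) - t i))" for t
      unfolding stiff_def by (rule sum.cong) (use x_step in \<open>force simp: ds\<close>)+
    have s0: "stiff n x s (S p) = 0" if "p \<le> n" for p
      using v const that by (cases "p = 0") (auto simp: st)
    define r where "r i = s i + (- mass n x s (S 0)) * S 0 i" for i
    have "mass n x s (S p) = 0" if "1 \<le> p" "p \<le> n" for p
    proof -
      have "0 < (p * pi / (b - a))\<^sup>2" using that a_less_b by simp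
      also have "\<dots> \<le> ev p" using lower[of p] that by simp
      finally have "0 < ev p" .
      then show ?thesis using eig[of p s] s0[of p] that by simp
    qed
    then have "mass n x r (S p) = 0" if "p \<le> n" for p
      using orth[of 0 p] that unfolding r_def[abs_def] M_linear by (cases "p = 0") auto
    then have "r j = 0" if "j \<le> n" for j using complete that by blast
    then have "r (Suc i) - r i = 0" using i by simp
    moreover have "r (Suc i) - r i = (s (Suc i) - s i) + (- mass n x s (S 0)) * (S 0 (Suc i) - S 0 i)"
      unfolding r_def by (simp only: right_diff_distrib)
    ultimately have "(x (Suc i) - x i) * v i = 0"
      using const[OF i] ds[of i] by simp
    then show ?thesis using x_step[OF i] by simp
  qed
  note span = this
  show ?thesis
  proof (intro exI conjI ballI allI impI)
    show "(p * pi / (b - a))\<^sup>2 \<le> ev p" if "p \<in> {1..n}" for p by (rule lower[OF that])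
    show "stiff n x s (S p) = ev p * mass n x s (S p)" if "p \<in> {1..n}" for p s
      using eig that by simp
    show "v i = 0" if "\<forall>p\<in>{1..n}. (\<Sum>i<n. v i * (S p (Suc i) - S p i)) = 0" "i < n" for v i
      by (rule span[OF that])
  qed
qed

end

section \<open>Smooth test functions\<close>

text \<open>Infinite differentiability encoded coinductively, as membership in some family closed
  under differentiation. A proof of smoothness exhibits such a family and needs no induction on the
  order of derivatives.\<close>

definition smooth :: "(real \<Rightarrow> real) \<Rightarrow> bool" where
  "smooth f \<longleftrightarrow> (\<exists>X. f \<in> X \<and> (\<forall>h\<in>X. \<exists>h'\<in>X. \<forall>s. (h has_real_derivative h' s) (at s)))"

lemma smoothI:
  assumes "f \<in> X" "\<And>h. h \<in> X \<Longrightarrow> \<exists>h'\<in>X. \<forall>s. (h has_real_derivative h' s) (at s)"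
  shows "smooth f"
  using assms unfolding smooth_def by blast

lemma smooth_deriv:
  assumes "smooth f"
  obtains f' where "smooth f'" "\<And>s. (f has_real_derivative f' s) (at s)"
proof -
  obtain X where X: "f \<in> X" "\<forall>h\<in>X. \<exists>h'\<in>X. \<forall>s. (h has_real_derivative h' s) (at s)"
    using assms unfolding smooth_def by blast
  then obtain f' where "f' \<in> X" "\<forall>s. (f has_real_derivative f' s) (at s)" by blast
  then show ?thesis using that[of f'] X(2) smoothI[of f' X] by blast
qed

lemma smooth_continuous: "smooth f \<Longrightarrow> continuous_on A f"
  by (meson DERIV_isCont continuous_at_imp_continuous_on smooth_deriv)

lemma smooth_affine:
  assumes "smooth f" shows "smooth (\<lambda>s. f (r * s + q))"
proof (rule smoothI)
  let ?X = "{\<lambda>s. k * g (r * s + q) | k g. smooth g}"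
  show "(\<lambda>s. f (r * s + q)) \<in> ?X" using assms by (auto intro!: exI[of _ 1] exI[of _ f])
  fix h assume "h \<in> ?X"
  then obtain k g where h: "h = (\<lambda>s. k * g (r * s + q))" "smooth g" by blast
  obtain g' where g': "smooth g'" "\<And>s. (g has_real_derivative g' s) (at s)" using smooth_deriv[OF h(2)] by metis
  have "(h has_real_derivative (k * r) * g' (r * s + q)) (at s)" for s
    unfolding h(1) by (auto intro!: derivative_eq_intros DERIV_chain'[OF _ g'(2)])
  then show "\<exists>h'\<in>?X. \<forall>s. (h has_real_derivative h' s) (at s)"
    using g'(1) by (intro bexI[of _ "\<lambda>s. (k * r) * g' (r * s + q)"]) blast+
qed

text \<open>By Leibniz's rule the derivative of a product is a sum of products, so this is the
  closed family for \<open>smooth_mult\<close>.\<close>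

inductive_set product_sums :: "(real \<Rightarrow> real) set" where
  product: "smooth f \<Longrightarrow> smooth g \<Longrightarrow> (\<lambda>s. f s * g s) \<in> product_sums"
| sum: "f \<in> product_sums \<Longrightarrow> g \<in> product_sums \<Longrightarrow> (\<lambda>s. f s + g s) \<in> product_sums"

lemma smooth_mult:
  assumes "smooth f" "smooth g" shows "smooth (\<lambda>s. f s * g s)"
proof (rule smoothI[of _ product_sums])
  show "(\<lambda>s. f s * g s) \<in> product_sums" by (rule product[OF assms])
  fix h assume "h \<in> product_sums"
  then show "\<exists>h'\<in>product_sums. \<forall>s. (h has_real_derivative h' s) (at s)"
  proof induction
    case (product f g)
    obtain f' g' where f': "smooth f'" "\<And>s. (f has_real_derivative f' s) (at s)"
      and g': "smooth g'" "\<And>s. (g has_real_derivative g' s) (at s)"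
      using smooth_deriv[OF product(1)] smooth_deriv[OF product(2)] by metis
    have "(\<lambda>s. f' s * g s + f s * g' s) \<in> product_sums"
      using product f' g' by (intro product_sums.intros)
    moreover have "((\<lambda>s. f s * g s) has_real_derivative f' s * g s + f s * g' s) (at s)" for s
      using DERIV_mult[OF f'(2) g'(2)] by (simp add: algebra_simps)
    ultimately show ?case by (intro bexI[of _ "\<lambda>s. f' s * g s + f s * g' s"] allI)
  next
    case (sum f g)
    then obtain f' g' where "f' \<in> product_sums" "g' \<in> product_sums"
      "\<And>s. (f has_real_derivative f' s) (at s)" "\<And>s. (g has_real_derivative g' s) (at s)" by blast
    then show ?case
      by (intro bexI[of _ "\<lambda>s. f' s + g' s"] allI DERIV_add product_sums.sum)
  qed
qed

lemma dx_tensor: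
  assumes "\<And>s. (f has_real_derivative f' s) (at s)"
  shows "dx (\<lambda>p. f (fst p) * g (snd p)) = (\<lambda>p. f' (fst p) * g (snd p))"
  unfolding dx_def by (rule ext, rule DERIV_imp_deriv) (auto intro!: derivative_eq_intros assms)

lemma dy_tensor:
  assumes "\<And>s. (g has_real_derivative g' s) (at s)"
  shows "dy (\<lambda>p. f (fst p) * g (snd p)) = (\<lambda>p. f (fst p) * g' (snd p))"
  unfolding dy_def by (rule ext, rule DERIV_imp_deriv) (auto intro!: derivative_eq_intros assms)

lemma C_on_tensor:
  assumes "smooth f" "smooth g"
  shows "C_on m S (\<lambda>p. f (fst p) * g (snd p))"
  using assms
proof (induction m arbitrary: f g)
  case 0
  show ?case
    using smooth_continuous[OF 0(1), of UNIV] smooth_continuous[OF 0(2), of UNIV]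
    by (auto intro!: continuous_intros continuous_on_compose2[of UNIV f] continuous_on_compose2[of UNIV g])
next
  case (Suc m)
  obtain f' where f': "smooth f'" "\<And>s. (f has_real_derivative f' s) (at s)" using smooth_deriv[OF Suc.prems(1)] by metis
  obtain g' where g': "smooth g'" "\<And>s. (g has_real_derivative g' s) (at s)" using smooth_deriv[OF Suc.prems(2)] by metis
  have "continuous_on S (\<lambda>p. f (fst p) * g (snd p))"
    using smooth_continuous[OF Suc.prems(1), of UNIV] smooth_continuous[OF Suc.prems(2), of UNIV]
    by (auto intro!: continuous_intros continuous_on_compose2[of UNIV f] continuous_on_compose2[of UNIV g])
  moreover have "(\<lambda>s. f s * k) differentiable (at s)" "(\<lambda>s. k * g s) differentiable (at s)" for s k
    using f'(2)[of s] g'(2)[of s] by (auto intro!: derivative_intros simp: real_differentiable_def)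
  ultimately show ?case
    using Suc.IH[OF f'(1) Suc.prems(2)] Suc.IH[OF Suc.prems(1) g'(1)]
    by (simp add: dx_tensor[OF f'(2)] dy_tensor[OF g'(2)])
qed

section \<open>A flat smooth step and limits of bump functions\<close>

definition exp_step :: "real \<Rightarrow> real" where
  "exp_step s = (if 0 < s then exp (- (1 / s)) else 0)"

lemma exp_step_bounds: "0 \<le> exp_step s" "exp_step s \<le> 1" and exp_step_0: "s \<le> 0 \<Longrightarrow> exp_step s = 0"
  by (auto simp: exp_step_def)

lemma poly_exp_tendsto_0: "((\<lambda>z. poly r z * exp (- z)) \<longlongrightarrow> 0) at_top" for r :: "real poly"
proof -
  have "((\<lambda>z. \<Sum>i\<le>degree r. coeff r i * (z ^ i / exp z)) \<longlongrightarrow> (\<Sum>i\<le>degree r. coeff r i * 0)) at_top"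
    by (intro tendsto_sum tendsto_mult_left tendsto_power_div_exp_0)
  then show ?thesis
    by (simp add: poly_altdef sum_distrib_right exp_minus divide_inverse mult.assoc)
qed

text \<open>The functions q(1/s) exp(-1/s), extended by 0 and with \<open>q\<close> a polynomial,
  form a family closed under differentiation: with z = 1/s the derivative belongs to the polynomial
  z^2 (q - q').\<close>

lemma smooth_exp_step: "smooth exp_step"
proof (rule smoothI)
  define E :: "real poly \<Rightarrow> real \<Rightarrow> real" where "E q s = (if 0 < s then poly q (1 / s) * exp (- (1 / s)) else 0)" for q s
  show "exp_step \<in> range E"
    by (rule range_eqI[of _ _ 1]) (auto simp: E_def exp_step_def fun_eq_iff)
  fix h assume "h \<in> range E"
  then obtain q where h: "h = E q" by blast
  define q' where "q' = monom 1 2 * (q - pderiv q)"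
  have "(E q has_real_derivative E q' s) (at s)" for s
  proof (cases s "0 :: real" rule: linorder_cases)
    case less
    have "(E q has_real_derivative 0) (at s)"
      by (rule has_field_derivative_transform_within_open[of "\<lambda>_. 0" _ _ "{..<0}"]) (use less in \<open>auto simp: E_def\<close>)
    then show ?thesis using less by (simp add: E_def)
  next
    case greater
    have "((\<lambda>s. poly q (1 / s) * exp (- (1 / s))) has_real_derivative
        poly (pderiv q) (1 / s) * (- (1 / s\<^sup>2)) * exp (- (1 / s)) + poly q (1 / s) * (exp (- (1 / s)) * (1 / s\<^sup>2))) (at s)"
      using greater by (auto intro!: derivative_eq_intros DERIV_chain'[OF _ poly_DERIV] simp: power2_eq_square)
    also have "poly (pderiv q) (1 / s) * (- (1 / s\<^sup>2)) * exp (- (1 / s)) + poly q (1 / s) * (exp (- (1 / s)) * (1 / s\<^sup>2)) = E q' s"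
      using greater by (simp add: E_def q'_def poly_monom power_divide algebra_simps)
    finally have D: "((\<lambda>s. poly q (1 / s) * exp (- (1 / s))) has_real_derivative E q' s) (at s)" .
    show ?thesis
      by (rule has_field_derivative_transform_within_open[OF D, of "{0<..}"]) (use greater in \<open>auto simp: E_def\<close>)
  next
    case equal
    \<comment> \<open>Division by \<open>t\<close> multiplies the polynomial by z = 1/t, which is
      what \<open>pCons 0 q\<close> expresses; the exponential still wins as z tends to
      infinity.\<close>
    have right: "((\<lambda>t. E q t / t) \<longlongrightarrow> 0) (at_right 0)"
    proof (rule tendsto_cong[THEN iffD1, OF eventually_at_rightI[of 0 1]])
      show "((\<lambda>t. poly (pCons 0 q) (inverse t) * exp (- inverse t)) \<longlongrightarrow> 0) (at_right 0)"
        by (rule filterlim_compose[OF poly_exp_tendsto_0 filterlim_inverse_at_top_right])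
    qed (auto simp: E_def field_simps)
    have left: "((\<lambda>t. E q t / t) \<longlongrightarrow> 0) (at_left 0)"
      by (rule tendsto_cong[THEN iffD1, OF eventually_at_leftI[of "-1" 0] tendsto_const]) (auto simp: E_def)
    have "((\<lambda>t. E q t / t) \<longlongrightarrow> 0) (at 0)" using left right by (simp add: filterlim_split_at)
    then show ?thesis using equal by (simp add: has_field_derivative_iff E_def)
  qed
  then show "\<exists>h'\<in>range E. \<forall>s. (h has_real_derivative h' s) (at s)" unfolding h by blast
qed

text \<open>Functions of one variable against which a weak divergence may be tested in the limit.
  Convergence is demanded at every point and not just almost everywhere, since edge integrals read
  the values on grid lines. The bound 1 is for dominated convergence; the compact supports may grow
  with \<open>n\<close>.\<close>

definition test_limit :: "real \<Rightarrow> real \<Rightarrow> (real \<Rightarrow> real) \<Rightarrow> bool" where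
  "test_limit a b P \<longleftrightarrow> (\<exists>p. (\<forall>n::nat. smooth (p n) \<and> (\<forall>s. \<bar>p n s\<bar> \<le> 1) \<and>
     (\<exists>a' b'. a < a' \<and> b' < b \<and> (\<forall>s. s \<notin> {a'..b'} \<longrightarrow> p n s = 0))) \<and>
     (\<forall>s. (\<lambda>n. p n s) \<longlonglongrightarrow> P s))"

lemma exp_step_at_top: "(\<lambda>n. exp_step (real (Suc n) * s - 1)) \<longlonglongrightarrow> 1" if "0 < s"
proof -
  have top: "filterlim (\<lambda>n. real (Suc n) * s - 1) at_top sequentially"
    using that by real_asymp
  then have "(\<lambda>n. exp (- inverse (real (Suc n) * s - 1))) \<longlonglongrightarrow> exp (- 0)"
    by (intro tendsto_intros filterlim_compose[OF tendsto_inverse_0_at_top[OF filterlim_ident]])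
  moreover have "eventually (\<lambda>n. 0 < real (Suc n) * s - 1) sequentially"
    using top by (rule eventually_compose_filterlim[OF eventually_gt_at_top])
  then have "eventually (\<lambda>n. exp (- inverse (real (Suc n) * s - 1)) = exp_step (real (Suc n) * s - 1)) sequentially"
    by eventually_elim (simp add: exp_step_def divide_inverse)
  ultimately show ?thesis by (simp add: tendsto_cong)
qed

text \<open>The shift by 1 in each factor keeps the support at distance 1/(n+1) from the ends, so
  that \<alpha> = a and \<beta> = b are allowed, as cells touching the boundary require.\<close>

lemma test_limit_interval:
  assumes "a \<le> \<alpha>" "\<beta> \<le> b"
  shows "test_limit a b (indicator {\<alpha><..<\<beta>})"
  unfolding test_limit_def
proof (intro exI conjI allI)
  define p where "p n s = exp_step (real (Suc n) * (s - \<alpha>) - 1) * exp_step (real (Suc n) * (\<beta> - s) - 1)" for n s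
  show "smooth (p n)" for n
    using smooth_mult[OF smooth_affine[OF smooth_exp_step, of "real (Suc n)" "- real (Suc n) * \<alpha> - 1"]
        smooth_affine[OF smooth_exp_step, of "- real (Suc n)" "real (Suc n) * \<beta> - 1"]]
    by (simp add: p_def[abs_def] algebra_simps)
  show "\<bar>p n s\<bar> \<le> 1" for n s
    by (simp add: p_def abs_mult exp_step_bounds mult_le_one)
  show "a < \<alpha> + 1 / real (Suc n)" "\<beta> - 1 / real (Suc n) < b" for n
  proof -
    have "0 < 1 / real (Suc n)" by simp
    with assms show "a < \<alpha> + 1 / real (Suc n)" "\<beta> - 1 / real (Suc n) < b" by linarith+
  qed
  show "s \<notin> {\<alpha> + 1 / real (Suc n)..\<beta> - 1 / real (Suc n)} \<longrightarrow> p n s = 0" for n s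
  proof
    assume "s \<notin> {\<alpha> + 1 / real (Suc n)..\<beta> - 1 / real (Suc n)}"
    then have "s - \<alpha> < 1 / real (Suc n) \<or> \<beta> - s < 1 / real (Suc n)" by auto
    then have "real (Suc n) * (s - \<alpha>) - 1 \<le> 0 \<or> real (Suc n) * (\<beta> - s) - 1 \<le> 0"
      by (auto simp: field_simps)
    then show "p n s = 0" by (auto simp: p_def exp_step_0)
  qed
  show "(\<lambda>n. p n s) \<longlonglongrightarrow> indicator {\<alpha><..<\<beta>} s" for s
  proof (cases "s \<in> {\<alpha><..<\<beta>}")
    case True
    then have "(\<lambda>n. p n s) \<longlonglongrightarrow> 1 * 1"
      unfolding p_def by (intro tendsto_mult exp_step_at_top) auto
    with True show ?thesis by simp
  next
    case False
    then have "real (Suc n) * (s - \<alpha>) \<le> 0 \<or> real (Suc n) * (\<beta> - s) \<le> 0" for n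
      by (auto simp: mult_le_0_iff)
    then have "real (Suc n) * (s - \<alpha>) - 1 \<le> 0 \<or> real (Suc n) * (\<beta> - s) - 1 \<le> 0" for n
      by (smt (verit))
    then have "p n s = 0" for n unfolding p_def using exp_step_0 by (metis mult_zero_left mult_zero_right)
    with False show ?thesis by simp
  qed
qed

text \<open>The bumps shrink to the point \<open>z\<close>, where each of the two factors equals
  \<open>exp_step 1\<close> = exp(-1); hence the constant. A limit that vanishes except at
  \<open>z\<close> isolates the flux across a single grid line.\<close>

lemma test_limit_point:
  assumes "a < z" "z < b"
  shows "test_limit a b (\<lambda>s. exp (- 2) * indicator {z} s)"
proof -
  define \<delta> where "\<delta> = min (z - a) (b - z) / 2"
  have \<delta>: "0 < \<delta>" "\<delta> < z - a" "\<delta> < b - z" using assms by (auto simp: \<delta>_def)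
  \<comment> \<open>The offset 1/\<delta> keeps the support within distance \<delta> of
    \<open>z\<close> from the first bump on.\<close>
  define N where "N n = 1 / \<delta> + real n" for n
  have N: "0 < N n" "1 / N n \<le> \<delta>" for n
    using \<delta>(1) by (auto simp: N_def field_simps add_pos_nonneg)
  show ?thesis
    unfolding test_limit_def
  proof (intro exI conjI allI)
    define p where "p n s = exp_step (1 + N n * (s - z)) * exp_step (1 - N n * (s - z))" for n s
    show "smooth (p n)" for n
      using smooth_mult[OF smooth_affine[OF smooth_exp_step, of "N n" "1 - N n * z"]
          smooth_affine[OF smooth_exp_step, of "- N n" "1 + N n * z"]]
      by (simp add: p_def[abs_def] algebra_simps)
    show "\<bar>p n s\<bar> \<le> 1" for n s
      by (simp add: p_def abs_mult exp_step_bounds mult_le_one)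
    show "a < z - \<delta>" "z + \<delta> < b" using \<delta> by auto
    have outside: "p n s = 0" if "1 \<le> N n * \<bar>s - z\<bar>" for n s
    proof -
      have "1 + N n * (s - z) \<le> 0 \<or> 1 - N n * (s - z) \<le> 0"
        using that by (auto simp: abs_if algebra_simps split: if_splits)
      then show ?thesis by (auto simp: p_def exp_step_0)
    qed
    show "s \<notin> {z - \<delta>..z + \<delta>} \<longrightarrow> p n s = 0" for n s
    proof
      assume "s \<notin> {z - \<delta>..z + \<delta>}"
      then have "1 / N n \<le> \<bar>s - z\<bar>" using N(2)[of n] by auto
      then show "p n s = 0" using N(1)[of n] by (intro outside) (simp add: field_simps)
    qed
    show "(\<lambda>n. p n s) \<longlonglongrightarrow> exp (- 2) * indicator {z} s" for s
    proof (cases "s = z")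
      case True
      then show ?thesis by (simp add: p_def exp_step_def flip: exp_add)
    next
      case False
      then have "filterlim (\<lambda>n. N n * \<bar>s - z\<bar>) at_top sequentially"
        unfolding N_def by real_asymp
      then have "eventually (\<lambda>n. 1 \<le> N n * \<bar>s - z\<bar>) sequentially"
        by (rule eventually_compose_filterlim[OF eventually_ge_at_top])
      then have "eventually (\<lambda>n. p n s = 0) sequentially"
        by eventually_elim (rule outside)
      with False show ?thesis by (simp add: tendsto_eventually)
    qed
  qed
qed

section \<open>Integration by parts on the mesh\<close>

lemma box_Pair_real: "box (a, c) (b, d) = {a<..<b} \<times> {c<..<d :: real}" for a b :: real
  by (auto simp: box_def Basis_prod_def)

lemma AE_lebesgue_not_line:
  fixes k :: real
  shows "AE p :: real \<times> real in lebesgue. fst p \<noteq> k" "AE p :: real \<times> real in lebesgue. snd p \<noteq> k"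
proof -
  have "negligible {p :: real \<times> real. p \<bullet> (1, 0) = k}" "negligible {p :: real \<times> real. p \<bullet> (0, 1) = k}"
    by (rule negligible_standard_hyperplane, simp add: Basis_prod_def)+
  then have "{p :: real \<times> real. p \<bullet> (1, 0) = k} \<in> null_sets lebesgue" "{p :: real \<times> real. p \<bullet> (0, 1) = k} \<in> null_sets lebesgue"
    by (simp_all add: negligible_iff_null_sets)
  from this[THEN AE_not_in]
  show "AE p :: real \<times> real in lebesgue. fst p \<noteq> k" "AE p :: real \<times> real in lebesgue. snd p \<noteq> k"
    by (auto simp: inner_prod_def)
qed

lemma set_integral_cong_AE_integrable:
  fixes f g :: "_ \<Rightarrow> real"
  assumes "set_integrable M A f" "set_integrable M A g" "AE x in M. x \<in> A \<longrightarrow> f x = g x"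
  shows "(LINT x:A|M. f x) = (LINT x:A|M. g x)"
  unfolding set_lebesgue_integral_def
  by (rule integral_cong_AE) (use assms in \<open>auto simp: set_integrable_def indicator_def\<close>)

text \<open>The bridge from Lebesgue integrals over open rectangles to iterated one-dimensional
  integrals over closed intervals, where the fundamental theorem of calculus is applied; the
  boundary is null.\<close>

lemma set_integral_rectangle:
  fixes F :: "real \<times> real \<Rightarrow> real"
  assumes "continuous_on ({a..b} \<times> {c..d}) F"
  shows "set_integrable lebesgue ({a<..<b} \<times> {c<..<d}) F"
    and "(LINT p:{a<..<b} \<times> {c<..<d}|lebesgue. F p) = integral {a..b} (\<lambda>s. integral {c..d} (\<lambda>t. F (s, t)))"
    and "(LINT p:{a<..<b} \<times> {c<..<d}|lebesgue. F p) = integral {c..d} (\<lambda>t. integral {a..b} (\<lambda>s. F (s, t)))"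
proof -
  have cont: "continuous_on (cbox (a, c) (b, d)) F"
    using assms by (simp add: cbox_Pair_eq)
  have "set_integrable lebesgue (cbox (a, c) (b, d)) F"
    by (rule absolutely_integrable_continuous[OF cont])
  then show int: "set_integrable lebesgue ({a<..<b} \<times> {c<..<d}) F"
    by (rule set_integrable_subset) (simp flip: box_Pair_real, auto simp: cbox_Pair_eq)
  have "(LINT p:{a<..<b} \<times> {c<..<d}|lebesgue. F p) = integral (box (a, c) (b, d)) F"
    unfolding box_Pair_real by (rule set_lebesgue_integral_eq_integral(2)[OF int])
  also have "\<dots> = integral (cbox (a, c) (b, d)) F" by (rule integral_open_interval)
  also have "\<dots> = integral {a..b} (\<lambda>s. integral {c..d} (\<lambda>t. F (s, t)))"
    using integral_prod_continuous[OF cont] by simp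
  finally show *: "(LINT p:{a<..<b} \<times> {c<..<d}|lebesgue. F p) = integral {a..b} (\<lambda>s. integral {c..d} (\<lambda>t. F (s, t)))" .
  show "(LINT p:{a<..<b} \<times> {c<..<d}|lebesgue. F p) = integral {c..d} (\<lambda>t. integral {a..b} (\<lambda>s. F (s, t)))"
    unfolding * using integral_swap_continuous[of a c b d "\<lambda>s t. F (s, t)"] cont by simp
qed

section \<open>Square-integrable functions on a rectangle\<close>

lemma lmeasurable_rectangle: "rectangle a b c d \<in> lmeasurable"
  by (simp add: rectangle_def flip: box_Pair_real)

lemma sets_rectangle [simp]: "rectangle a b c d \<in> sets lebesgue"
  using lmeasurable_rectangle by (rule fmeasurableD)

lemma integral_lebesgue_on_rectangle:
  "integral\<^sup>L (lebesgue_on (rectangle a b c d)) f = (LINT p:rectangle a b c d|lebesgue. f p)" for f :: "_ \<Rightarrow> real"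
  unfolding set_lebesgue_integral_def by (rule integral_restrict_space) simp

lemma integrable_lebesgue_on_rectangle:
  "integrable (lebesgue_on (rectangle a b c d)) f \<longleftrightarrow> set_integrable lebesgue (rectangle a b c d) f" for f :: "_ \<Rightarrow> real"
  unfolding set_integrable_def by (rule integrable_restrict_space) simp

lemma finite_measure_rectangle: "finite_measure (lebesgue_on (rectangle a b c d))"
  by (rule finite_measure_lebesgue_on[OF lmeasurable_rectangle])

lemma L2_on_mult:
  assumes "f \<in> L2_on \<Omega>" "g \<in> L2_on \<Omega>"
  shows "integrable (lebesgue_on \<Omega>) (\<lambda>p. f p * g p)"
proof (rule Bochner_Integration.integrable_bound)
  show "integrable (lebesgue_on \<Omega>) (\<lambda>p. (f p)\<^sup>2 + (g p)\<^sup>2)" using assms by (auto simp: L2_on_def)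
  show "(\<lambda>p. f p * g p) \<in> borel_measurable (lebesgue_on \<Omega>)" using assms by (auto simp: L2_on_def)
  have "\<bar>r * s\<bar> \<le> r\<^sup>2 + s\<^sup>2" for r s :: real
  proof -
    have "2 * \<bar>r * s\<bar> \<le> r\<^sup>2 + s\<^sup>2"
      using sum_squares_bound[of "\<bar>r\<bar>" "\<bar>s\<bar>"] by (simp add: abs_mult)
    then show ?thesis by (smt (verit) abs_ge_zero)
  qed
  then show "AE p in lebesgue_on \<Omega>. norm (f p * g p) \<le> norm ((f p)\<^sup>2 + (g p)\<^sup>2)" by simp
qed

lemma L2_on_bounded:
  assumes "f \<in> borel_measurable (lebesgue_on (rectangle a b c d))"
    and "\<And>p. p \<in> rectangle a b c d \<Longrightarrow> \<bar>f p\<bar> \<le> B"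
  shows "f \<in> L2_on (rectangle a b c d)"
proof -
  interpret finite_measure "lebesgue_on (rectangle a b c d)" by (rule finite_measure_rectangle)
  have "integrable (lebesgue_on (rectangle a b c d)) (\<lambda>p. (f p)\<^sup>2)"
  proof (rule integrable_const_bound[of _ "B\<^sup>2"])
    show "AE p in lebesgue_on (rectangle a b c d). norm ((f p)\<^sup>2) \<le> B\<^sup>2"
      using assms(2) by (auto intro!: AE_I2 power_mono simp: abs_le_square_iff[symmetric])
         (smt (verit))
  qed (use assms in measurable)
  then show ?thesis using assms(1) by (simp add: L2_on_def)
qed

lemma measurable_tensor:
  fixes F G :: "real \<Rightarrow> real"
  assumes [measurable]: "F \<in> borel_measurable borel" "G \<in> borel_measurable borel"
  shows "(\<lambda>z. F (fst z) * G (snd z)) \<in> borel_measurable (lebesgue_on S)"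
proof -
  have "(\<lambda>z. F (fst z) * G (snd z)) \<in> borel_measurable (borel \<Otimes>\<^sub>M borel)" by measurable
  then have "(\<lambda>z. F (fst z) * G (snd z)) \<in> borel_measurable borel" by (simp add: borel_prod)
  then show ?thesis by (intro measurable_restrict_space1 measurable_completion) simp
qed

lemma L2_on_const: "(\<lambda>_. k) \<in> L2_on (rectangle a b c d)"
  by (rule L2_on_bounded[of _ _ _ _ _ "\<bar>k\<bar>"]) auto

lemma L2_on_continuous:
  assumes "continuous_on UNIV f"
  shows "f \<in> L2_on (rectangle a b c d)"
proof -
  have "compact (f ` cbox (a, c) (b, d))"
    by (intro compact_continuous_image continuous_on_subset[OF assms]) auto
  then obtain B where B: "\<And>p. p \<in> cbox (a, c) (b, d) \<Longrightarrow> \<bar>f p\<bar> \<le> B"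
    by (metis bounded_iff compact_imp_bounded image_eqI real_norm_def)
  show ?thesis
  proof (rule L2_on_bounded)
    show "f \<in> borel_measurable (lebesgue_on (rectangle a b c d))"
      by (intro continuous_imp_measurable_on_sets_lebesgue continuous_on_subset[OF assms]) auto
    show "\<bar>f p\<bar> \<le> B" if "p \<in> rectangle a b c d" for p
      using that B[of p] by (cases p) (auto simp: rectangle_def cbox_Pair_eq)
  qed
qed

lemma C_on_1D:
  assumes "C_on (Suc 0) UNIV \<phi>"
  shows "continuous_on UNIV \<phi>" "continuous_on UNIV (dx \<phi>)" "continuous_on UNIV (dy \<phi>)"
    and "((\<lambda>s. \<phi> (s, t)) has_real_derivative dx \<phi> (s, t)) (at s)"
    and "((\<lambda>t. \<phi> (s, t)) has_real_derivative dy \<phi> (s, t)) (at t)"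
proof -
  show "continuous_on UNIV \<phi>" "continuous_on UNIV (dx \<phi>)" "continuous_on UNIV (dy \<phi>)"
    using assms by auto
  have D: "(\<lambda>s. \<phi> (s, t)) differentiable (at s)" "(\<lambda>t. \<phi> (s, t)) differentiable (at t)"
    using assms by auto
  then show "((\<lambda>s. \<phi> (s, t)) has_real_derivative dx \<phi> (s, t)) (at s)"
    "((\<lambda>t. \<phi> (s, t)) has_real_derivative dy \<phi> (s, t)) (at t)"
    by (simp_all add: dx_def dy_def DERIV_deriv_iff_real_differentiable)
qed

lemma continuous_on_slices:
  assumes "continuous_on UNIV (f :: real \<times> real \<Rightarrow> real)"
  shows "continuous_on A (\<lambda>s. f (s, t))" "continuous_on A (\<lambda>t. f (s, t))"
  by (rule continuous_on_compose2[OF assms]; force intro: continuous_intros)+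

lemma integrable_slices:
  assumes "continuous_on UNIV (f :: real \<times> real \<Rightarrow> real)"
  shows "(\<lambda>s. f (s, t)) integrable_on {l..r}" "(\<lambda>t. f (s, t)) integrable_on {l..r}"
  by (intro integrable_continuous_real continuous_on_slices[OF assms])+

text \<open>On each horizontal line \<open>?F + ?G\<close> is the derivative of (A + B (s - x0))
  \<phi>, so only the two vertical edges contribute. \<open>A\<close> and A + B (x1 - x0) are the
  normal components there.\<close>

lemma green_x:
  fixes A B :: real
  assumes \<phi>: "C_on (Suc 0) UNIV \<phi>" and le: "x0 \<le> x1"
  shows "(LINT p:{x0<..<x1} \<times> {y0<..<y1}|lebesgue. (A + B * (fst p - x0)) * dx \<phi> p) =
    (A + B * (x1 - x0)) * integral {y0..y1} (\<lambda>t. \<phi> (x1, t)) - A * integral {y0..y1} (\<lambda>t. \<phi> (x0, t))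
    - B * (LINT p:{x0<..<x1} \<times> {y0<..<y1}|lebesgue. \<phi> p)"
proof -
  note C = C_on_1D[OF \<phi>]
  let ?R = "{x0<..<x1} \<times> {y0<..<y1}"
  let ?F = "\<lambda>p. (A + B * (fst p - x0)) * dx \<phi> p" and ?G = "\<lambda>p. B * \<phi> p"
  have c: "continuous_on UNIV ?F" "continuous_on UNIV ?G"
    by (intro continuous_intros C)+
  have i: "set_integrable lebesgue ?R ?F" "set_integrable lebesgue ?R ?G"
    by (rule set_integral_rectangle(1), rule continuous_on_subset[OF c(1)], simp)
       (rule set_integral_rectangle(1), rule continuous_on_subset[OF c(2)], simp)
  have "(LINT p:?R|lebesgue. ?F p) + (LINT p:?R|lebesgue. ?G p) = (LINT p:?R|lebesgue. ?F p + ?G p)"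
    by (rule set_integral_add(2)[OF i, symmetric])
  also have "\<dots> = integral {y0..y1} (\<lambda>t. integral {x0..x1} (\<lambda>s. ?F (s, t) + ?G (s, t)))"
    by (rule set_integral_rectangle(3)) (rule continuous_on_subset[OF continuous_on_add[OF c]], simp)
  also have "\<dots> = integral {y0..y1} (\<lambda>t. (A + B * (x1 - x0)) * \<phi> (x1, t) - A * \<phi> (x0, t))"
  proof (rule integral_cong)
    fix t
    have "((\<lambda>s. ?F (s, t) + ?G (s, t)) has_integral
        (A + B * (x1 - x0)) * \<phi> (x1, t) - (A + B * (x0 - x0)) * \<phi> (x0, t)) {x0..x1}"
    proof (rule fundamental_theorem_of_calculus[OF le])
      fix s
      have "((\<lambda>s. (A + B * (s - x0)) * \<phi> (s, t)) has_real_derivative ?F (s, t) + ?G (s, t)) (at s within {x0..x1})"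
        by (rule has_field_derivative_at_within) (auto intro!: derivative_eq_intros C(4))
      then show "((\<lambda>s. (A + B * (s - x0)) * \<phi> (s, t)) has_vector_derivative ?F (s, t) + ?G (s, t)) (at s within {x0..x1})"
        by (simp add: has_real_derivative_iff_has_vector_derivative)
    qed
    then show "integral {x0..x1} (\<lambda>s. ?F (s, t) + ?G (s, t)) = (A + B * (x1 - x0)) * \<phi> (x1, t) - A * \<phi> (x0, t)"
      by (simp add: integral_unique)
  qed
  also have "\<dots> = (A + B * (x1 - x0)) * integral {y0..y1} (\<lambda>t. \<phi> (x1, t)) - A * integral {y0..y1} (\<lambda>t. \<phi> (x0, t))"
    by (subst integral_diff) (auto intro!: integrable_on_cmult_left integrable_slices continuous_intros C(1))
  also have "(LINT p:?R|lebesgue. ?G p) = B * (LINT p:?R|lebesgue. \<phi> p)"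
    by (simp add: set_integral_mult_right)
  finally show ?thesis by simp
qed

lemma green_y:
  fixes A B :: real
  assumes \<phi>: "C_on (Suc 0) UNIV \<phi>" and le: "y0 \<le> y1"
  shows "(LINT p:{x0<..<x1} \<times> {y0<..<y1}|lebesgue. (A + B * (snd p - y0)) * dy \<phi> p) =
    (A + B * (y1 - y0)) * integral {x0..x1} (\<lambda>s. \<phi> (s, y1)) - A * integral {x0..x1} (\<lambda>s. \<phi> (s, y0))
    - B * (LINT p:{x0<..<x1} \<times> {y0<..<y1}|lebesgue. \<phi> p)"
proof -
  note C = C_on_1D[OF \<phi>]
  let ?R = "{x0<..<x1} \<times> {y0<..<y1}"
  let ?F = "\<lambda>p. (A + B * (snd p - y0)) * dy \<phi> p" and ?G = "\<lambda>p. B * \<phi> p"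
  have c: "continuous_on UNIV ?F" "continuous_on UNIV ?G"
    by (intro continuous_intros C)+
  have i: "set_integrable lebesgue ?R ?F" "set_integrable lebesgue ?R ?G"
    by (rule set_integral_rectangle(1), rule continuous_on_subset[OF c(1)], simp)
       (rule set_integral_rectangle(1), rule continuous_on_subset[OF c(2)], simp)
  have "(LINT p:?R|lebesgue. ?F p) + (LINT p:?R|lebesgue. ?G p) = (LINT p:?R|lebesgue. ?F p + ?G p)"
    by (rule set_integral_add(2)[OF i, symmetric])
  also have "\<dots> = integral {x0..x1} (\<lambda>s. integral {y0..y1} (\<lambda>t. ?F (s, t) + ?G (s, t)))"
    by (rule set_integral_rectangle(2)) (rule continuous_on_subset[OF continuous_on_add[OF c]], simp)
  also have "\<dots> = integral {x0..x1} (\<lambda>s. (A + B * (y1 - y0)) * \<phi> (s, y1) - A * \<phi> (s, y0))"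
  proof (rule integral_cong)
    fix s
    have "((\<lambda>t. ?F (s, t) + ?G (s, t)) has_integral
        (A + B * (y1 - y0)) * \<phi> (s, y1) - (A + B * (y0 - y0)) * \<phi> (s, y0)) {y0..y1}"
    proof (rule fundamental_theorem_of_calculus[OF le])
      fix t
      have "((\<lambda>t. (A + B * (t - y0)) * \<phi> (s, t)) has_real_derivative ?F (s, t) + ?G (s, t)) (at t within {y0..y1})"
        by (rule has_field_derivative_at_within) (auto intro!: derivative_eq_intros C(5))
      then show "((\<lambda>t. (A + B * (t - y0)) * \<phi> (s, t)) has_vector_derivative ?F (s, t) + ?G (s, t)) (at t within {y0..y1})"
        by (simp add: has_real_derivative_iff_has_vector_derivative)
    qed
    then show "integral {y0..y1} (\<lambda>t. ?F (s, t) + ?G (s, t)) = (A + B * (y1 - y0)) * \<phi> (s, y1) - A * \<phi> (s, y0)"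
      by (simp add: integral_unique)
  qed
  also have "\<dots> = (A + B * (y1 - y0)) * integral {x0..x1} (\<lambda>s. \<phi> (s, y1)) - A * integral {x0..x1} (\<lambda>s. \<phi> (s, y0))"
    by (subst integral_diff) (auto intro!: integrable_on_cmult_left integrable_slices continuous_intros C(1))
  also have "(LINT p:?R|lebesgue. ?G p) = B * (LINT p:?R|lebesgue. \<phi> p)"
    by (simp add: set_integral_mult_right)
  finally show ?thesis by simp
qed

section \<open>Tensor-product meshes\<close>

locale mesh = gx: grid a b n1 x + gy: grid c d n2 y
  for a b c d :: real and n1 n2 :: nat and x y :: "nat \<Rightarrow> real"
begin

abbreviation "\<Omega> \<equiv> rectangle a b c d"
abbreviation "cells \<equiv> mesh_cells n1 x n2 y"
abbreviation "hx i \<equiv> x (Suc i) - x i"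
abbreviation "hy j \<equiv> y (Suc j) - y j"

text \<open>Open and indexed from 0, so that distinct cells are disjoint; they differ from the
  closed cells of \<open>mesh_cells\<close>, indexed from 1, by null parts of grid lines.\<close>

definition cell :: "nat \<Rightarrow> nat \<Rightarrow> (real \<times> real) set" where
  "cell i j = {x i<..<x (Suc i)} \<times> {y j<..<y (Suc j)}"

lemma sets_cell [simp]: "cell i j \<in> sets lebesgue"
  by (simp add: cell_def flip: box_Pair_real)

lemma cell_subset: "i < n1 \<Longrightarrow> j < n2 \<Longrightarrow> cell i j \<subseteq> \<Omega>"
  using gx.x_mono[of 0 i] gx.x_mono[of "Suc i" n1] gy.x_mono[of 0 j] gy.x_mono[of "Suc j" n2]
  by (auto simp: cell_def rectangle_def gx.x_first gx.x_last gy.x_first gy.x_last)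

lemma cell_disjoint:
  assumes "p \<in> cell i j" "p \<in> cell i' j'" "i < n1" "i' < n1" "j < n2" "j' < n2"
  shows "i = i'" "j = j'"
proof -
  show "i = i'"
    using assms gx.x_mono[of "Suc i" i'] gx.x_mono[of "Suc i'" i]
    by (cases i i' rule: linorder_cases) (auto simp: cell_def)
  show "j = j'"
    using assms gy.x_mono[of "Suc j" j'] gy.x_mono[of "Suc j'" j]
    by (cases j j' rule: linorder_cases) (auto simp: cell_def)
qed

lemma AE_off_grid: "AE p :: real \<times> real in lebesgue. (\<forall>i\<le>n1. fst p \<noteq> x i) \<and> (\<forall>j\<le>n2. snd p \<noteq> y j)"
proof -
  have "AE p :: real \<times> real in lebesgue. \<forall>i\<in>{..n1}. fst p \<noteq> x i"
    by (rule AE_finite_allI) (auto intro: AE_lebesgue_not_line)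
  moreover have "AE p :: real \<times> real in lebesgue. \<forall>j\<in>{..n2}. snd p \<noteq> y j"
    by (rule AE_finite_allI) (auto intro: AE_lebesgue_not_line)
  ultimately show ?thesis by eventually_elim auto
qed

lemma off_grid_cell:
  assumes "p \<in> \<Omega>" "\<forall>i\<le>n1. fst p \<noteq> x i" "\<forall>j\<le>n2. snd p \<noteq> y j"
  obtains i j where "i < n1" "j < n2" "p \<in> cell i j"
proof -
  obtain s t where p: "p = (s, t)" by (cases p)
  obtain i where i: "i < n1" "s \<in> {x i..x (Suc i)}"
    using gx.cell_cover[of s] assms(1) p by (auto simp: rectangle_def)
  obtain j where j: "j < n2" "t \<in> {y j..y (Suc j)}"
    using gy.cell_cover[of t] assms(1) p by (auto simp: rectangle_def)
  have "s \<noteq> x i" "s \<noteq> x (Suc i)" "t \<noteq> y j" "t \<noteq> y (Suc j)"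
    using assms p i(1) j(1) by auto
  then have "p \<in> cell i j" using i j p by (auto simp: cell_def)
  then show ?thesis using that i j by blast
qed

lemma AE_cells:
  assumes "\<And>i j. i < n1 \<Longrightarrow> j < n2 \<Longrightarrow> AE p in lebesgue. p \<in> cell i j \<longrightarrow> P p"
  shows "AE p in lebesgue_on \<Omega>. P p"
proof -
  have "AE p in lebesgue. \<forall>i\<in>{..<n1}. \<forall>j\<in>{..<n2}. p \<in> cell i j \<longrightarrow> P p"
    by (intro AE_finite_allI) (use assms in auto)
  with AE_off_grid have "AE p in lebesgue. p \<in> \<Omega> \<longrightarrow> P p"
  proof eventually_elim
    case (elim p)
    then show ?case by (metis lessThan_iff off_grid_cell)
  qed
  then show ?thesis by (simp add: AE_restrict_space_iff)
qed

lemma set_integral_cells: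
  fixes f :: "_ \<Rightarrow> real"
  assumes f: "set_integrable lebesgue \<Omega> f"
  shows "(LINT p:\<Omega>|lebesgue. f p) = (\<Sum>i<n1. \<Sum>j<n2. LINT p:cell i j|lebesgue. f p)"
proof -
  let ?I = "{..<n1} \<times> {..<n2}"
  let ?U = "\<Union>(i, j)\<in>?I. cell i j"
  have sub: "?U \<subseteq> \<Omega>" using cell_subset by fastforce
  have U: "?U \<in> sets lebesgue" by (intro sets.finite_UN) auto
  have "(LINT p:\<Omega>|lebesgue. f p) = (LINT p:?U|lebesgue. f p)"
    unfolding set_lebesgue_integral_def
  proof (rule integral_cong_AE)
    show "(\<lambda>p. indicat_real \<Omega> p *\<^sub>R f p) \<in> borel_measurable lebesgue"
      using f by (auto simp: set_integrable_def)
    show "(\<lambda>p. indicat_real ?U p *\<^sub>R f p) \<in> borel_measurable lebesgue"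
      using set_integrable_subset[OF f U sub] by (auto simp: set_integrable_def)
    show "AE p in lebesgue. indicat_real \<Omega> p *\<^sub>R f p = indicat_real ?U p *\<^sub>R f p"
      using AE_off_grid
    proof eventually_elim
      case (elim p)
      have "p \<in> \<Omega> \<longleftrightarrow> p \<in> ?U"
      proof
        assume "p \<in> \<Omega>"
        then obtain i j where "i < n1" "j < n2" "p \<in> cell i j" using elim off_grid_cell by blast
        then show "p \<in> ?U" by auto
      qed (use sub in blast)
      then show ?case by (simp add: indicator_def)
    qed
  qed
  also have "\<dots> = (\<Sum>ij\<in>?I. LINT p:(case ij of (i, j) \<Rightarrow> cell i j)|lebesgue. f p)"
  proof (rule set_integral_finite_UN_AE)
    show "AE p in lebesgue. p \<in> (case ij of (i, j) \<Rightarrow> cell i j) \<and> p \<in> (case kl of (i, j) \<Rightarrow> cell i j) \<longrightarrow> ij = kl"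
      if "ij \<in> ?I" "kl \<in> ?I" for ij kl
      using that cell_disjoint by (intro AE_I2) (auto split: prod.splits)
    show "set_integrable lebesgue (case ij of (i, j) \<Rightarrow> cell i j) f" if "ij \<in> ?I" for ij
      using that by (intro set_integrable_subset[OF f]) (use cell_subset in \<open>auto split: prod.splits\<close>)
  qed auto
  also have "\<dots> = (\<Sum>i<n1. \<Sum>j<n2. LINT p:cell i j|lebesgue. f p)"
    by (simp add: sum.cartesian_product case_prod_unfold)
  finally show ?thesis .
qed

end

section \<open>Cellwise affine fluxes and their weak divergence\<close>

context mesh begin

text \<open>Expansion about the lower left corner makes \<open>A i j\<close> and
  \<open>A i j + B i j * hx i\<close> the normal components on the left and right edges,
  \<open>C i j\<close> and \<open>C i j + D i j * hy j\<close> those on the bottom and top, and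
  \<open>B i j + D i j\<close> the divergence in the cell. Neighbouring cells are not yet
  linked.\<close>

definition represents ::
  "(real \<times> real \<Rightarrow> real \<times> real) \<Rightarrow> (nat \<Rightarrow> nat \<Rightarrow> real) \<Rightarrow> (nat \<Rightarrow> nat \<Rightarrow> real) \<Rightarrow>
   (nat \<Rightarrow> nat \<Rightarrow> real) \<Rightarrow> (nat \<Rightarrow> nat \<Rightarrow> real) \<Rightarrow> bool" where
  "represents \<tau> A B C D \<longleftrightarrow>
     (\<lambda>p. fst (\<tau> p)) \<in> L2_on \<Omega> \<and> (\<lambda>p. snd (\<tau> p)) \<in> L2_on \<Omega> \<and>
     (\<forall>i<n1. \<forall>j<n2. AE p in lebesgue. p \<in> cell i j \<longrightarrow>
        \<tau> p = (A i j + B i j * (fst p - x i), C i j + D i j * (snd p - y j)))"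

text \<open>The outcome of integrating \<open>\<tau> \<bullet> grad \<phi>\<close> by parts on each cell: \<open>X\<close>, \<open>Y\<close>, \<open>Z\<close> stand for the
  integrals of \<open>\<phi>\<close> over vertical edges, horizontal edges and cells.\<close>

definition broken_flux ::
  "(nat \<Rightarrow> nat \<Rightarrow> real) \<Rightarrow> (nat \<Rightarrow> nat \<Rightarrow> real) \<Rightarrow> (nat \<Rightarrow> nat \<Rightarrow> real) \<Rightarrow> (nat \<Rightarrow> nat \<Rightarrow> real) \<Rightarrow>
   (nat \<Rightarrow> nat \<Rightarrow> real) \<Rightarrow> (nat \<Rightarrow> nat \<Rightarrow> real) \<Rightarrow> (nat \<Rightarrow> nat \<Rightarrow> real) \<Rightarrow> real" where
  "broken_flux A B C D X Y Z = (\<Sum>i<n1. \<Sum>j<n2.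
     ((A i j + B i j * hx i) * X (Suc i) j - A i j * X i j) +
     ((C i j + D i j * hy j) * Y i (Suc j) - C i j * Y i j) - (B i j + D i j) * Z i j)"

lemma set_integrable_cell:
  "continuous_on UNIV F \<Longrightarrow> set_integrable lebesgue (cell i j) F" for F :: "_ \<Rightarrow> real"
  unfolding cell_def by (rule set_integral_rectangle(1)) (rule continuous_on_subset, auto)

lemma set_integrable_cell_L2:
  assumes "f \<in> L2_on \<Omega>" "g \<in> L2_on \<Omega>" "i < n1" "j < n2"
  shows "set_integrable lebesgue (cell i j) (\<lambda>p. f p * g p)"
  by (rule set_integrable_subset[OF _ sets_cell cell_subset[OF assms(3,4)]])
     (use L2_on_mult[OF assms(1,2)] in \<open>simp add: integrable_lebesgue_on_rectangle\<close>)

lemma broken_green: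
  assumes \<tau>: "represents \<tau> A B C D" and \<phi>: "C_on (Suc 0) UNIV \<phi>"
  shows "L2_inner_vec \<Omega> \<tau> (\<lambda>p. (dx \<phi> p, dy \<phi> p)) = broken_flux A B C D
    (\<lambda>i j. integral {y j..y (Suc j)} (\<lambda>t. \<phi> (x i, t)))
    (\<lambda>i j. integral {x i..x (Suc i)} (\<lambda>s. \<phi> (s, y j)))
    (\<lambda>i j. LINT p:cell i j|lebesgue. \<phi> p)"
proof -
  note C = C_on_1D[OF \<phi>]
  have L2: "(\<lambda>p. fst (\<tau> p)) \<in> L2_on \<Omega>" "(\<lambda>p. snd (\<tau> p)) \<in> L2_on \<Omega>" "dx \<phi> \<in> L2_on \<Omega>" "dy \<phi> \<in> L2_on \<Omega>"
    using \<tau> C by (auto simp: represents_def intro: L2_on_continuous)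
  have dot: "\<tau> p \<bullet> (dx \<phi> p, dy \<phi> p) = fst (\<tau> p) * dx \<phi> p + snd (\<tau> p) * dy \<phi> p" for p
    by (simp add: inner_prod_def)
  have "set_integrable lebesgue \<Omega> (\<lambda>p. \<tau> p \<bullet> (dx \<phi> p, dy \<phi> p))"
    unfolding dot integrable_lebesgue_on_rectangle[symmetric]
    by (intro Bochner_Integration.integrable_add L2_on_mult L2)
  then have "L2_inner_vec \<Omega> \<tau> (\<lambda>p. (dx \<phi> p, dy \<phi> p)) =
      (\<Sum>i<n1. \<Sum>j<n2. LINT p:cell i j|lebesgue. fst (\<tau> p) * dx \<phi> p + snd (\<tau> p) * dy \<phi> p)"
    unfolding L2_inner_vec_def integral_lebesgue_on_rectangle by (simp add: set_integral_cells dot)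
  also have "\<dots> = (\<Sum>i<n1. \<Sum>j<n2.
      (LINT p:cell i j|lebesgue. (A i j + B i j * (fst p - x i)) * dx \<phi> p) +
      (LINT p:cell i j|lebesgue. (C i j + D i j * (snd p - y j)) * dy \<phi> p))"
  proof (intro sum.cong refl)
    fix i j assume "i \<in> {..<n1}" "j \<in> {..<n2}"
    then have ij: "i < n1" "j < n2" by auto
    have AE: "AE p in lebesgue. p \<in> cell i j \<longrightarrow>
        \<tau> p = (A i j + B i j * (fst p - x i), C i j + D i j * (snd p - y j))"
      using \<tau> ij by (simp add: represents_def)
    have "(LINT p:cell i j|lebesgue. fst (\<tau> p) * dx \<phi> p) = (LINT p:cell i j|lebesgue. (A i j + B i j * (fst p - x i)) * dx \<phi> p)"
      by (rule set_integral_cong_AE_integrable)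
         (use AE in \<open>auto intro!: set_integrable_cell_L2[OF L2(1,3) ij] set_integrable_cell continuous_intros C elim!: AE_mp\<close>)
    moreover have "(LINT p:cell i j|lebesgue. snd (\<tau> p) * dy \<phi> p) = (LINT p:cell i j|lebesgue. (C i j + D i j * (snd p - y j)) * dy \<phi> p)"
      by (rule set_integral_cong_AE_integrable)
         (use AE in \<open>auto intro!: set_integrable_cell_L2[OF L2(2,4) ij] set_integrable_cell continuous_intros C elim!: AE_mp\<close>)
    ultimately show "(LINT p:cell i j|lebesgue. fst (\<tau> p) * dx \<phi> p + snd (\<tau> p) * dy \<phi> p) =
      (LINT p:cell i j|lebesgue. (A i j + B i j * (fst p - x i)) * dx \<phi> p) +
      (LINT p:cell i j|lebesgue. (C i j + D i j * (snd p - y j)) * dy \<phi> p)"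
      by (subst set_integral_add(2)) (auto intro: set_integrable_cell_L2 L2 ij)
  qed
  also have "\<dots> = broken_flux A B C D
    (\<lambda>i j. integral {y j..y (Suc j)} (\<lambda>t. \<phi> (x i, t)))
    (\<lambda>i j. integral {x i..x (Suc i)} (\<lambda>s. \<phi> (s, y j)))
    (\<lambda>i j. LINT p:cell i j|lebesgue. \<phi> p)"
    unfolding broken_flux_def cell_def
    by (intro sum.cong refl, subst green_x[OF \<phi>], simp add: less_imp_le gx.x_step,
        subst green_y[OF \<phi>], simp add: less_imp_le gy.x_step, simp add: algebra_simps)
  finally show ?thesis .
qed

lemma closed_cell: "i < n1 \<Longrightarrow> j < n2 \<Longrightarrow> {x i..x (Suc i)} \<times> {y j..y (Suc j)} \<in> cells"
  unfolding mesh_cells_def by (rule CollectI, intro exI[of _ "Suc i"] exI[of _ "Suc j"]) auto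

lemma cells_cases:
  assumes "K \<in> cells" obtains i j where "i < n1" "j < n2" "K = {x i..x (Suc i)} \<times> {y j..y (Suc j)}"
proof -
  from assms obtain i j where ij: "i \<in> {1..n1}" "j \<in> {1..n2}" "K = {x (i - 1)..x i} \<times> {y (j - 1)..y j}"
    unfolding mesh_cells_def by blast
  show ?thesis by (rule that[of "i - 1" "j - 1"]) (use ij in auto)
qed

lemma AE_closed_cell:
  assumes "i < n1" "j < n2"
  shows "(AE p in lebesgue_on ({x i..x (Suc i)} \<times> {y j..y (Suc j)}). P p) \<longleftrightarrow> (AE p in lebesgue. p \<in> cell i j \<longrightarrow> P p)"
proof -
  have "cbox (x i, y j) (x (Suc i), y (Suc j)) \<in> sets lebesgue" by simp
  then have "{x i..x (Suc i)} \<times> {y j..y (Suc j)} \<in> sets lebesgue"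
    by (simp add: cbox_Pair_eq)
  then have "(AE p in lebesgue_on ({x i..x (Suc i)} \<times> {y j..y (Suc j)}). P p) \<longleftrightarrow>
      (AE p in lebesgue. p \<in> {x i..x (Suc i)} \<times> {y j..y (Suc j)} \<longrightarrow> P p)"
    by (simp add: AE_restrict_space_iff)
  also have "\<dots> \<longleftrightarrow> (AE p in lebesgue. p \<in> cell i j \<longrightarrow> P p)"
  proof
    assume "AE p in lebesgue. p \<in> {x i..x (Suc i)} \<times> {y j..y (Suc j)} \<longrightarrow> P p"
    then show "AE p in lebesgue. p \<in> cell i j \<longrightarrow> P p" by eventually_elim (auto simp: cell_def)
  next
    assume "AE p in lebesgue. p \<in> cell i j \<longrightarrow> P p"
    with AE_off_grid show "AE p in lebesgue. p \<in> {x i..x (Suc i)} \<times> {y j..y (Suc j)} \<longrightarrow> P p"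
    proof eventually_elim
      case (elim p)
      then have "fst p \<noteq> x i" "fst p \<noteq> x (Suc i)" "snd p \<noteq> y j" "snd p \<noteq> y (Suc j)" using assms by auto
      with elim show ?case by (cases p) (auto simp: cell_def)
    qed
  qed
  finally show ?thesis .
qed

lemma Q_poly_1_0: "q \<in> Q_poly 1 0 \<longleftrightarrow> (\<exists>k l. \<forall>p. q p = k + l * fst p)"
proof
  assume "q \<in> Q_poly 1 0"
  then obtain c where "\<And>s t. q (s, t) = (\<Sum>i\<le>1. \<Sum>j\<le>0. c i j * s ^ i * t ^ j)"
    unfolding Q_poly_def by blast
  then have "q p = c 0 0 + c 1 0 * fst p" for p by (cases p) (simp add: atMost_Suc)
  then show "\<exists>k l. \<forall>p. q p = k + l * fst p" by blast
next
  assume "\<exists>k l. \<forall>p. q p = k + l * fst p"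
  then obtain k l where "\<And>p. q p = k + l * fst p" by blast
  then have "\<forall>s t. q (s, t) = (\<Sum>i\<le>1. \<Sum>j\<le>0. (if i = 0 then k else l) * s ^ i * t ^ j)"
    by (simp add: atMost_Suc)
  then show "q \<in> Q_poly 1 0" unfolding Q_poly_def
    by (intro CollectI exI[of _ "\<lambda>i j. if i = 0 then k else l"])
qed

lemma Q_poly_0_1: "q \<in> Q_poly 0 1 \<longleftrightarrow> (\<exists>k l. \<forall>p. q p = k + l * snd p)"
proof
  assume "q \<in> Q_poly 0 1"
  then obtain c where "\<And>s t. q (s, t) = (\<Sum>i\<le>0. \<Sum>j\<le>1. c i j * s ^ i * t ^ j)"
    unfolding Q_poly_def by blast
  then have "q p = c 0 0 + c 0 1 * snd p" for p by (cases p) (simp add: atMost_Suc)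
  then show "\<exists>k l. \<forall>p. q p = k + l * snd p" by blast
next
  assume "\<exists>k l. \<forall>p. q p = k + l * snd p"
  then obtain k l where "\<And>p. q p = k + l * snd p" by blast
  then have "\<forall>s t. q (s, t) = (\<Sum>i\<le>0. \<Sum>j\<le>1. (if j = 0 then k else l) * s ^ i * t ^ j)"
    by (simp add: atMost_Suc)
  then show "q \<in> Q_poly 0 1" unfolding Q_poly_def
    by (intro CollectI exI[of _ "\<lambda>i j. if j = 0 then k else l"])
qed

lemma RT_flux_iff:
  "\<tau> \<in> RT_flux \<Omega> cells \<longleftrightarrow> \<tau> \<in> Hdiv \<Omega> \<and> (\<exists>A B C D. represents \<tau> A B C D)"
proof
  assume \<tau>: "\<tau> \<in> RT_flux \<Omega> cells"
  \<comment> \<open>The four coefficients of a cell are packed into one tuple, so that a single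
    choice per cell fixes them all.\<close>
  define R where "R i j z \<longleftrightarrow> (AE p in lebesgue. p \<in> cell i j \<longrightarrow>
      \<tau> p = (fst z + fst (snd z) * (fst p - x i), fst (snd (snd z)) + snd (snd (snd z)) * (snd p - y j)))"
    for i j z
  have ex: "\<exists>z. R i j z"
    if ij: "i < n1" "j < n2" for i j
  proof -
    obtain q1 q2 where q: "q1 \<in> Q_poly 1 0" "q2 \<in> Q_poly 0 1"
      "AE p in lebesgue_on ({x i..x (Suc i)} \<times> {y j..y (Suc j)}). \<tau> p = (q1 p, q2 p)"
      using \<tau> closed_cell[OF ij] by (auto simp: RT_flux_def)
    obtain k l where kl: "\<And>p. q1 p = k + l * fst p" using q(1) unfolding Q_poly_1_0 by blast
    obtain k' l' where kl': "\<And>p. q2 p = k' + l' * snd p" using q(2) unfolding Q_poly_0_1 by blast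
    have "AE p in lebesgue. p \<in> cell i j \<longrightarrow>
        \<tau> p = ((k + l * x i) + l * (fst p - x i), (k' + l' * y j) + l' * (snd p - y j))"
      using q(3) unfolding AE_closed_cell[OF ij] by eventually_elim (auto simp: kl kl' algebra_simps)
    then show ?thesis
      by (intro exI[of _ "(k + l * x i, l, k' + l' * y j, l')"]) (simp add: R_def)
  qed
  define Z where "Z i j = (SOME z. R i j z)" for i j
  have "R i j (Z i j)" if "i < n1" "j < n2" for i j
    unfolding Z_def by (rule someI_ex[OF ex[OF that]])
  then have "represents \<tau> (\<lambda>i j. fst (Z i j)) (\<lambda>i j. fst (snd (Z i j))) (\<lambda>i j. fst (snd (snd (Z i j)))) (\<lambda>i j. snd (snd (snd (Z i j))))"
    using \<tau> by (auto simp: R_def represents_def RT_flux_def Hdiv_def)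
  then show "\<tau> \<in> Hdiv \<Omega> \<and> (\<exists>A B C D. represents \<tau> A B C D)" using \<tau> by (auto simp: RT_flux_def)
next
  assume "\<tau> \<in> Hdiv \<Omega> \<and> (\<exists>A B C D. represents \<tau> A B C D)"
  then obtain A B C D where \<tau>: "\<tau> \<in> Hdiv \<Omega>" "represents \<tau> A B C D" by blast
  show "\<tau> \<in> RT_flux \<Omega> cells"
    unfolding RT_flux_def
  proof (intro CollectI conjI \<tau>(1) ballI)
    fix K assume "K \<in> cells"
    then obtain i j where ij: "i < n1" "j < n2" and K: "K = {x i..x (Suc i)} \<times> {y j..y (Suc j)}"
      by (rule cells_cases)
    show "\<exists>q1\<in>Q_poly 1 0. \<exists>q2\<in>Q_poly 0 1. AE p in lebesgue_on K. \<tau> p = (q1 p, q2 p)"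
    proof (intro bexI)
      show "(\<lambda>p. (A i j - B i j * x i) + B i j * fst p) \<in> Q_poly 1 0"
        unfolding Q_poly_1_0 by blast
      show "(\<lambda>p. (C i j - D i j * y j) + D i j * snd p) \<in> Q_poly 0 1"
        unfolding Q_poly_0_1 by blast
      show "AE p in lebesgue_on K. \<tau> p = ((A i j - B i j * x i) + B i j * fst p, (C i j - D i j * y j) + D i j * snd p)"
        unfolding K AE_closed_cell[OF ij]
        using \<tau>(2) ij unfolding represents_def by (auto simp: algebra_simps)
    qed
  qed
qed

text \<open>Extends the identity defining the weak divergence to discontinuous limits of
  tensor-product test functions. Integration by parts has removed all derivatives of the test
  function, so dominated convergence applies to the edge and cell integrals with majorant 1 and to
  the right-hand side with majorant \<open>\<bar>g z\<bar>\<close>.\<close>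

lemma weak_div_tensor_limit:
  assumes \<tau>: "represents \<tau> A B C D" and g: "is_weak_div \<Omega> \<tau> g"
    and P: "test_limit a b P" and Q: "test_limit c d Q"
  shows "broken_flux A B C D
     (\<lambda>i j. P (x i) * integral {y j..y (Suc j)} Q)
     (\<lambda>i j. integral {x i..x (Suc i)} P * Q (y j))
     (\<lambda>i j. integral {x i..x (Suc i)} P * integral {y j..y (Suc j)} Q)
   = - L2_inner \<Omega> g (\<lambda>p. P (fst p) * Q (snd p))"
proof -
  obtain p where p: "\<And>n. smooth (p n)" "\<And>n s. \<bar>p n s\<bar> \<le> 1"
    "\<And>n. \<exists>a' b'. a < a' \<and> b' < b \<and> (\<forall>s. s \<notin> {a'..b'} \<longrightarrow> p n s = 0)" "\<And>s. (\<lambda>n::nat. p n s) \<longlonglongrightarrow> P s"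
    using P unfolding test_limit_def by blast
  obtain q where q: "\<And>n. smooth (q n)" "\<And>n s. \<bar>q n s\<bar> \<le> 1"
    "\<And>n. \<exists>a' b'. c < a' \<and> b' < d \<and> (\<forall>s. s \<notin> {a'..b'} \<longrightarrow> q n s = 0)" "\<And>s. (\<lambda>n::nat. q n s) \<longlonglongrightarrow> Q s"
    using Q unfolding test_limit_def by blast
  define \<phi> where "\<phi> n z = p n (fst z) * q n (snd z)" for n and z :: "real \<times> real"
  have test: "\<phi> n \<in> test_functions \<Omega>" for n
  proof -
    obtain a' b' where ab: "a < a'" "b' < b" "\<And>s. s \<notin> {a'..b'} \<Longrightarrow> p n s = 0" using p(3) by blast
    obtain c' d' where cd: "c < c'" "d' < d" "\<And>s. s \<notin> {c'..d'} \<Longrightarrow> q n s = 0" using q(3) by blast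
    have "C_on m UNIV (\<phi> n)" for m
      unfolding \<phi>_def[abs_def] by (rule C_on_tensor[OF p(1) q(1)])
    moreover have "cbox (a', c') (b', d') \<subseteq> \<Omega>" using ab cd by (auto simp: cbox_Pair_eq rectangle_def)
    moreover have "\<phi> n z = 0" if "z \<notin> cbox (a', c') (b', d')" for z
      using that ab(3)[of "fst z"] cd(3)[of "snd z"] by (cases z) (auto simp: \<phi>_def cbox_Pair_eq)
    ultimately show ?thesis
      unfolding test_functions_def using compact_cbox[of "(a', c')" "(b', d')"] by blast
  qed
  have conv1: "P integrable_on {l..r}" "(\<lambda>n. integral {l..r} (p n)) \<longlonglongrightarrow> integral {l..r} P" for l r
    by (rule dominated_convergence[of p "{l..r}" "\<lambda>_. 1"]; use p in \<open>auto intro: integrable_continuous_real smooth_continuous\<close>)+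
  have conv2: "(\<lambda>n. integral {l..r} (q n)) \<longlonglongrightarrow> integral {l..r} Q" for l r
    by (rule dominated_convergence[of q "{l..r}" "\<lambda>_. 1"]; use q in \<open>auto intro: integrable_continuous_real smooth_continuous\<close>)
  have eq: "broken_flux A B C D
     (\<lambda>i j. p n (x i) * integral {y j..y (Suc j)} (q n))
     (\<lambda>i j. integral {x i..x (Suc i)} (p n) * q n (y j))
     (\<lambda>i j. integral {x i..x (Suc i)} (p n) * integral {y j..y (Suc j)} (q n)) = - L2_inner \<Omega> g (\<phi> n)" for n
  proof -
    have C1: "C_on (Suc 0) UNIV (\<phi> n)"
      unfolding \<phi>_def[abs_def] by (rule C_on_tensor[OF p(1) q(1)])
    have "(LINT z:cell i j|lebesgue. \<phi> n z) = integral {x i..x (Suc i)} (p n) * integral {y j..y (Suc j)} (q n)" for i j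
      unfolding cell_def
      by (subst set_integral_rectangle(2))
         (use C_on_1D(1)[OF C1] in \<open>auto intro: continuous_on_subset simp: \<phi>_def\<close>)
    moreover have "integral {y j..y (Suc j)} (\<lambda>t. \<phi> n (s, t)) = p n s * integral {y j..y (Suc j)} (q n)" for j s
      by (simp add: \<phi>_def)
    moreover have "integral {x i..x (Suc i)} (\<lambda>s. \<phi> n (s, t)) = integral {x i..x (Suc i)} (p n) * q n t" for i t
      by (simp add: \<phi>_def)
    moreover have "L2_inner_vec \<Omega> \<tau> (\<lambda>z. (dx (\<phi> n) z, dy (\<phi> n) z)) = - L2_inner \<Omega> g (\<phi> n)"
      using g test by (auto simp: is_weak_div_def)
    ultimately show ?thesis using broken_green[OF \<tau> C1] by simp
  qed
  have "(\<lambda>n. L2_inner \<Omega> g (\<phi> n)) \<longlonglongrightarrow> L2_inner \<Omega> g (\<lambda>z. P (fst z) * Q (snd z))"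
    unfolding L2_inner_def
  proof (rule integral_dominated_convergence[where w = "\<lambda>z. \<bar>g z\<bar>"])
    have gL2: "g \<in> L2_on \<Omega>" using g by (simp add: is_weak_div_def)
    then have [measurable]: "g \<in> borel_measurable (lebesgue_on \<Omega>)" by (simp add: L2_on_def)
    have pm: "p n \<in> borel_measurable borel" and qm: "q n \<in> borel_measurable borel" for n
      by (intro borel_measurable_continuous_onI smooth_continuous p q)+
    have Pm: "P \<in> borel_measurable borel" and Qm: "Q \<in> borel_measurable borel"
      by (rule borel_measurable_LIMSEQ_real[OF p(4) pm], rule borel_measurable_LIMSEQ_real[OF q(4) qm])
    show "(\<lambda>z. g z * (P (fst z) * Q (snd z))) \<in> borel_measurable (lebesgue_on \<Omega>)"
      "(\<lambda>z. g z * \<phi> n z) \<in> borel_measurable (lebesgue_on \<Omega>)" for n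
      unfolding \<phi>_def by (intro borel_measurable_times measurable_tensor Pm Qm pm qm; measurable)+
    show "integrable (lebesgue_on \<Omega>) (\<lambda>z. \<bar>g z\<bar>)"
      using L2_on_mult[OF gL2 L2_on_const[of 1]] by (intro integrable_abs) simp
    show "AE z in lebesgue_on \<Omega>. (\<lambda>n. g z * \<phi> n z) \<longlonglongrightarrow> g z * (P (fst z) * Q (snd z))"
      unfolding \<phi>_def by (intro AE_I2 tendsto_intros p q)
    show "AE z in lebesgue_on \<Omega>. norm (g z * \<phi> n z) \<le> \<bar>g z\<bar>" for n
    proof (rule AE_I2)
      fix z
      have "\<bar>p n (fst z)\<bar> * \<bar>q n (snd z)\<bar> \<le> 1" by (intro mult_le_one p q) auto
      then show "norm (g z * \<phi> n z) \<le> \<bar>g z\<bar>"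
        by (simp add: \<phi>_def abs_mult mult_left_le)
    qed
  qed
  then have "(\<lambda>n. - L2_inner \<Omega> g (\<phi> n)) \<longlonglongrightarrow> - L2_inner \<Omega> g (\<lambda>z. P (fst z) * Q (snd z))"
    by (rule tendsto_minus)
  moreover have "(\<lambda>n. - L2_inner \<Omega> g (\<phi> n)) \<longlonglongrightarrow> broken_flux A B C D
     (\<lambda>i j. P (x i) * integral {y j..y (Suc j)} Q)
     (\<lambda>i j. integral {x i..x (Suc i)} P * Q (y j))
     (\<lambda>i j. integral {x i..x (Suc i)} P * integral {y j..y (Suc j)} Q)"
    unfolding eq[symmetric] broken_flux_def
    by (intro tendsto_intros p q conv1 conv2)
  ultimately show ?thesis using LIMSEQ_unique by blast
qed

end

section \<open>Discrete fluxes\<close>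

lemma integral_linear_product:
  fixes x0 x1 s0 s1 t0 t1 :: real
  assumes "x0 < x1"
  shows "integral {x0..x1} (\<lambda>s. (s0 + (s1 - s0) / (x1 - x0) * (s - x0)) * (t0 + (t1 - t0) / (x1 - x0) * (s - x0)))
    = (x1 - x0) / 6 * (2 * s0 * t0 + s0 * t1 + s1 * t0 + 2 * s1 * t1)"
proof -
  define h where "h = x1 - x0"
  define \<beta> \<delta> where "\<beta> = (s1 - s0) / h" and "\<delta> = (t1 - t0) / h"
  have h: "0 < h" using assms by (simp add: h_def)
  define F where "F s = s0 * t0 * (s - x0) + (s0 * \<delta> + \<beta> * t0) * (s - x0)\<^sup>2 / 2 + \<beta> * \<delta> * (s - x0)^3 / 3" for s
  have "((\<lambda>s. (s0 + \<beta> * (s - x0)) * (t0 + \<delta> * (s - x0))) has_integral F x1 - F x0) {x0..x1}"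
  proof (rule fundamental_theorem_of_calculus)
    fix s
    show "(F has_vector_derivative (s0 + \<beta> * (s - x0)) * (t0 + \<delta> * (s - x0))) (at s within {x0..x1})"
      unfolding F_def has_real_derivative_iff_has_vector_derivative[symmetric]
      by (auto intro!: derivative_eq_intros simp: power2_eq_square field_simps)
  qed (use assms in simp)
  moreover have "F x1 - F x0 = h / 6 * (2 * s0 * t0 + s0 * t1 + s1 * t0 + 2 * s1 * t1)"
  proof -
    have e: "s1 = s0 + \<beta> * h" "t1 = t0 + \<delta> * h" using h by (simp_all add: \<beta>_def \<delta>_def)
    show ?thesis unfolding e
      by (simp add: F_def h_def[symmetric] power2_eq_square power3_eq_cube algebra_simps add_divide_distrib)
  qed
  ultimately show ?thesis by (simp add: integral_unique \<beta>_def \<delta>_def h_def)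
qed

lemma integral_point: "integral {l..r} (\<lambda>s::real. k * indicator {z} s) = (0 :: real)"
  by (rule integral_unique, rule has_integral_spike_finite[of "{z}" _ _ "\<lambda>_. 0"]) auto

lemma (in grid) node_indicator: "i < n \<Longrightarrow> k \<le> n \<Longrightarrow> indicat_real {x i<..<x (Suc i)} (x k) = 0"
  using x_mono[of k i] x_mono[of "Suc i" k] by (cases "k \<le> i") auto

lemma (in grid) integral_cell_indicator:
  assumes "i < n" "k < n"
  shows "integral {x k..x (Suc k)} (indicat_real {x i<..<x (Suc i)}) = (if k = i then x (Suc i) - x i else 0)"
proof (rule integral_unique)
  have "((\<lambda>s. if k = i then 1 else 0 :: real) has_integral (if k = i then x (Suc i) - x i else 0)) {x k..x (Suc k)}"
    using has_integral_const_real[of "1::real" "x k" "x (Suc k)"] x_step[OF assms(2)] by auto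
  then show "(indicat_real {x i<..<x (Suc i)} has_integral (if k = i then x (Suc i) - x i else 0)) {x k..x (Suc k)}"
  proof (rule has_integral_spike_finite[rotated 2])
    show "finite {x k, x (Suc k)}" by simp
    fix s assume "s \<in> {x k..x (Suc k)} - {x k, x (Suc k)}"
    then show "indicat_real {x i<..<x (Suc i)} s = (if k = i then 1 else 0)"
      using assms x_mono[of "Suc k" i] x_mono[of "Suc i" k]
      by (cases k i rule: linorder_cases) (auto simp: indicator_def)
  qed
qed

lemma L2_on_tensor:
  fixes F G :: "real \<Rightarrow> real"
  assumes "F \<in> borel_measurable borel" "G \<in> borel_measurable borel"
    and "\<And>s. s \<in> {a..b} \<Longrightarrow> \<bar>F s\<bar> \<le> B" and "\<And>t. t \<in> {c..d} \<Longrightarrow> \<bar>G t\<bar> \<le> B'"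
  shows "(\<lambda>z. F (fst z) * G (snd z)) \<in> L2_on (rectangle a b c d)"
proof (rule L2_on_bounded[OF measurable_tensor[OF assms(1,2)]])
  fix z assume "z \<in> rectangle a b c d"
  then have "\<bar>F (fst z)\<bar> \<le> B" "\<bar>G (snd z)\<bar> \<le> B'" using assms(3,4) by (auto simp: rectangle_def)
  then show "\<bar>F (fst z) * G (snd z)\<bar> \<le> B * B'" unfolding abs_mult by (intro mult_mono) auto
qed

lemma continuous_bounded_interval:
  fixes F :: "real \<Rightarrow> real"
  assumes "continuous_on {a..b} F"
  obtains B where "\<And>s. s \<in> {a..b} \<Longrightarrow> \<bar>F s\<bar> \<le> B"
proof -
  have "compact (F ` {a..b})" by (intro compact_continuous_image assms) auto
  then show ?thesis using that by (metis bounded_iff compact_imp_bounded image_eqI real_norm_def)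
qed

lemma is_weak_div_weak_div: "\<tau> \<in> Hdiv \<Omega> \<Longrightarrow> is_weak_div \<Omega> \<tau> (weak_div \<Omega> \<tau>)"
  unfolding weak_div_def by (rule someI_ex[of "is_weak_div \<Omega> \<tau>"]) (simp add: Hdiv_def)

section \<open>Divergence and normal continuity of discrete fluxes\<close>

context mesh begin

lemma indicator_cell: "indicator (cell i j) p = indicat_real {x i<..<x (Suc i)} (fst p) * indicator {y j<..<y (Suc j)} (snd p)"
  by (cases p) (auto simp: cell_def indicator_def)

text \<open>The test function is the indicator of the open cell, which vanishes on all grid lines:
  the edge terms drop out. This gives the mean of \<open>g\<close> on the cell, which is what
  pairings with piecewise constants see.\<close>

lemma div_cell:
  assumes \<tau>: "represents \<tau> A B C D" and g: "is_weak_div \<Omega> \<tau> g" and ij: "i < n1" "j < n2"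
  shows "(LINT p:cell i j|lebesgue. g p) = (B i j + D i j) * hx i * hy j"
proof -
  let ?P = "indicat_real {x i<..<x (Suc i)}" and ?Q = "indicat_real {y j<..<y (Suc j)}"
  have P: "test_limit a b ?P" and Q: "test_limit c d ?Q"
    using ij gx.cell_subset[of i] gy.cell_subset[of j] gx.x_step[of i] gy.x_step[of j]
    by (auto intro!: test_limit_interval)
  have "L2_inner \<Omega> g (\<lambda>p. ?P (fst p) * ?Q (snd p)) = (LINT p:cell i j|lebesgue. g p)"
    unfolding L2_inner_def integral_lebesgue_on_rectangle indicator_cell[symmetric]
    unfolding set_lebesgue_integral_def
    by (rule Bochner_Integration.integral_cong) (use cell_subset[OF ij] in \<open>auto simp: indicator_def\<close>)
  then have "(LINT p:cell i j|lebesgue. g p) = - broken_flux A B C D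
     (\<lambda>i j. ?P (x i) * integral {y j..y (Suc j)} ?Q)
     (\<lambda>i j. integral {x i..x (Suc i)} ?P * ?Q (y j))
     (\<lambda>i j. integral {x i..x (Suc i)} ?P * integral {y j..y (Suc j)} ?Q)"
    using weak_div_tensor_limit[OF \<tau> g P Q] by simp
  also have "\<dots> = (\<Sum>k<n1. \<Sum>l<n2. (B k l + D k l) * ((if k = i then hx i else 0) * (if l = j then hy j else 0)))"
    unfolding broken_flux_def sum_negf[symmetric]
    by (intro sum.cong refl)
       (use ij in \<open>simp add: gx.node_indicator gy.node_indicator gx.integral_cell_indicator gy.integral_cell_indicator\<close>)
  also have "\<dots> = (B i j + D i j) * hx i * hy j"
    using ij by (simp add: mult_delta_left mult_delta_right)
  finally show ?thesis .
qed

text \<open>The test function lives on one interior grid line, which is null, so the right-hand side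
  and the cell terms vanish. What is left are the edge terms of the two neighbouring cells, that is,
  the jump of the normal component times \<open>exp (-2) * hy j\<close>.\<close>

lemma normal_continuity_x:
  assumes \<tau>: "represents \<tau> A B C D" and g: "is_weak_div \<Omega> \<tau> g" and ij: "Suc i < n1" "j < n2"
  shows "A (Suc i) j = A i j + B i j * hx i"
proof -
  let ?P = "\<lambda>s. exp (-2) * indicat_real {x (Suc i)} s" and ?Q = "indicat_real {y j<..<y (Suc j)}"
  have P: "test_limit a b ?P" and Q: "test_limit c d ?Q"
    using ij gy.cell_subset[of j] gx.x_less[of 0 "Suc i"] gx.x_less[of "Suc i" n1] gy.x_step[of j]
    by (auto intro!: test_limit_interval test_limit_point simp: gx.x_first gx.x_last)
  have "L2_inner \<Omega> g (\<lambda>p. ?P (fst p) * ?Q (snd p)) = 0"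
    unfolding L2_inner_def
  proof (rule integral_eq_zero_AE)
    show "AE p in lebesgue_on \<Omega>. g p * (?P (fst p) * ?Q (snd p)) = 0"
      using AE_lebesgue_not_line(1)[of "x (Suc i)"] by (auto simp: AE_restrict_space_iff elim!: AE_mp)
  qed
  then have "0 = broken_flux A B C D
     (\<lambda>i j. ?P (x i) * integral {y j..y (Suc j)} ?Q)
     (\<lambda>i j. integral {x i..x (Suc i)} ?P * ?Q (y j))
     (\<lambda>i j. integral {x i..x (Suc i)} ?P * integral {y j..y (Suc j)} ?Q)"
    using weak_div_tensor_limit[OF \<tau> g P Q] by simp
  also have "\<dots> = (\<Sum>k<n1. \<Sum>l<n2. if l = j then
     ((if k = i then A i j + B i j * hx i else 0) - (if k = Suc i then A (Suc i) j else 0)) * (exp (-2) * hy j) else 0)"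
    unfolding broken_flux_def integral_point
    by (intro sum.cong refl)
       (use ij in \<open>auto simp: gy.integral_cell_indicator gx.x_inj indicator_def algebra_simps\<close>)
  also have "\<dots> = (A i j + B i j * hx i - A (Suc i) j) * (exp (-2) * hy j)"
    using ij by (simp add: left_diff_distrib sum_subtractf flip: sum_distrib_right)
  finally show ?thesis using gy.x_step[OF ij(2)] by simp
qed

lemma normal_continuity_y:
  assumes \<tau>: "represents \<tau> A B C D" and g: "is_weak_div \<Omega> \<tau> g" and ij: "i < n1" "Suc j < n2"
  shows "C i (Suc j) = C i j + D i j * hy j"
proof -
  let ?P = "indicat_real {x i<..<x (Suc i)}" and ?Q = "\<lambda>s. exp (-2) * indicat_real {y (Suc j)} s"
  have P: "test_limit a b ?P" and Q: "test_limit c d ?Q"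
    using ij gx.cell_subset[of i] gy.x_less[of 0 "Suc j"] gy.x_less[of "Suc j" n2] gx.x_step[of i]
    by (auto intro!: test_limit_interval test_limit_point simp: gy.x_first gy.x_last)
  have "L2_inner \<Omega> g (\<lambda>p. ?P (fst p) * ?Q (snd p)) = 0"
    unfolding L2_inner_def
  proof (rule integral_eq_zero_AE)
    show "AE p in lebesgue_on \<Omega>. g p * (?P (fst p) * ?Q (snd p)) = 0"
      using AE_lebesgue_not_line(2)[of "y (Suc j)"] by (auto simp: AE_restrict_space_iff elim!: AE_mp)
  qed
  then have "0 = broken_flux A B C D
     (\<lambda>i j. ?P (x i) * integral {y j..y (Suc j)} ?Q)
     (\<lambda>i j. integral {x i..x (Suc i)} ?P * ?Q (y j))
     (\<lambda>i j. integral {x i..x (Suc i)} ?P * integral {y j..y (Suc j)} ?Q)"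
    using weak_div_tensor_limit[OF \<tau> g P Q] by simp
  also have "\<dots> = (\<Sum>k<n1. if k = i then \<Sum>l<n2.
     ((if l = j then C i j + D i j * hy j else 0) - (if l = Suc j then C i (Suc j) else 0)) * (exp (-2) * hx i) else 0)"
    unfolding broken_flux_def integral_point
    by (intro sum.cong refl)
       (use ij in \<open>auto simp: gx.integral_cell_indicator gy.x_inj indicator_def algebra_simps intro!: sum.cong\<close>)
  also have "\<dots> = (C i j + D i j * hy j - C i (Suc j)) * (exp (-2) * hx i)"
    using ij by (simp add: left_diff_distrib sum_subtractf flip: sum_distrib_right)
  finally show ?thesis using gx.x_step[OF ij(1)] by simp
qed

lemma represents_cong:
  assumes "represents \<tau> A B C D"
    and "\<And>i j. i < n1 \<Longrightarrow> j < n2 \<Longrightarrow> A i j = A' i j \<and> B i j = B' i j \<and> C i j = C' i j \<and> D i j = D' i j"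
  shows "represents \<tau> A' B' C' D'"
  using assms by (simp add: represents_def)

text \<open>By normal continuity one number per edge suffices: \<open>S i j\<close> on the vertical
  line \<open>i\<close> in row \<open>j\<close>, and \<open>T i j\<close> on the horizontal line
  \<open>j\<close> in column \<open>i\<close>. The cellwise slopes are then difference
  quotients.\<close>

lemma RT_flux_nodal:
  assumes "\<tau> \<in> RT_flux \<Omega> cells"
  obtains S T where "represents \<tau> S (\<lambda>i j. slope x (\<lambda>i. S i j) i) T (\<lambda>i j. slope y (T i) j)"
proof -
  obtain A B C D where r: "represents \<tau> A B C D" and H: "\<tau> \<in> Hdiv \<Omega>"
    using assms unfolding RT_flux_iff by blast
  note wd = is_weak_div_weak_div[OF H]
  \<comment> \<open>The last grid line has no cell on its right, so its value is the flux through
    the right edge of the last cell.\<close>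
  define S where "S i j = (if i < n1 then A i j else A (n1 - 1) j + B (n1 - 1) j * hx (n1 - 1))" for i j
  define T where "T i j = (if j < n2 then C i j else C i (n2 - 1) + D i (n2 - 1) * hy (n2 - 1))" for i j
  have S: "S (Suc i) j = A i j + B i j * hx i" if "i < n1" "j < n2" for i j
  proof (cases "Suc i < n1")
    case True
    then show ?thesis using normal_continuity_x[OF r wd True that(2)] by (simp add: S_def)
  next
    case False
    then have "n1 - 1 = i" using that by simp
    then show ?thesis using False by (simp add: S_def)
  qed
  have T: "T i (Suc j) = C i j + D i j * hy j" if "i < n1" "j < n2" for i j
  proof (cases "Suc j < n2")
    case True
    then show ?thesis using normal_continuity_y[OF r wd that(1) True] by (simp add: T_def)
  next
    case False
    then have "n2 - 1 = j" using that by simp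
    then show ?thesis using False by (simp add: T_def)
  qed
  have "represents \<tau> S (\<lambda>i j. slope x (\<lambda>i. S i j) i) T (\<lambda>i j. slope y (T i) j)"
  proof (rule represents_cong[OF r])
    fix i j assume ij: "i < n1" "j < n2"
    have S0: "S i j = A i j" and T0: "T i j = C i j" using ij by (simp_all add: S_def T_def)
    show "A i j = S i j \<and> B i j = slope x (\<lambda>i. S i j) i \<and> C i j = T i j \<and> D i j = slope y (T i) j"
      using gx.x_step[OF ij(1)] gy.x_step[OF ij(2)]
      by (simp add: slope_def S[OF ij] T[OF ij] S0 T0)
  qed
  then show ?thesis by (rule that)
qed

section \<open>Inner products in terms of cell and edge values\<close>

lemma L2_inner_cells:
  assumes "f \<in> L2_on \<Omega>" "g \<in> L2_on \<Omega>"
  shows "L2_inner \<Omega> f g = (\<Sum>i<n1. \<Sum>j<n2. LINT p:cell i j|lebesgue. f p * g p)"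
  unfolding L2_inner_def integral_lebesgue_on_rectangle
  by (rule set_integral_cells) (use L2_on_mult[OF assms] in \<open>simp add: integrable_lebesgue_on_rectangle\<close>)

lemma set_integral_const_AE:
  assumes u: "u \<in> L2_on \<Omega>" and f: "f \<in> L2_on \<Omega>" and ij: "i < n1" "j < n2"
    and U: "AE p in lebesgue. p \<in> cell i j \<longrightarrow> u p = U"
  shows "(LINT p:cell i j|lebesgue. f p * u p) = U * (LINT p:cell i j|lebesgue. f p)"
proof -
  have fU: "set_integrable lebesgue (cell i j) (\<lambda>p. f p * U)"
    by (rule set_integrable_cell_L2[OF f L2_on_const ij])
  have "(LINT p:cell i j|lebesgue. f p * u p) = (LINT p:cell i j|lebesgue. f p * U)"
    by (rule set_integral_cong_AE_integrable[OF set_integrable_cell_L2[OF f u ij] fU])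
       (use U in \<open>eventually_elim\<close>, auto)
  then show ?thesis by (simp add: mult.commute set_integral_mult_right)
qed

lemma measure_cell: "i < n1 \<Longrightarrow> j < n2 \<Longrightarrow> (LINT p:cell i j|lebesgue. 1) = hx i * hy j"
  unfolding cell_def by (subst set_integral_rectangle(2)) (auto simp: less_imp_le gx.x_step gy.x_step)

lemma L2_inner_weak_div:
  assumes \<tau>: "represents \<tau> A B C D" and g: "is_weak_div \<Omega> \<tau> g" and u: "u \<in> L2_on \<Omega>"
    and U: "\<And>i j. i < n1 \<Longrightarrow> j < n2 \<Longrightarrow> AE p in lebesgue. p \<in> cell i j \<longrightarrow> u p = U i j"
  shows "L2_inner \<Omega> g u = (\<Sum>i<n1. \<Sum>j<n2. U i j * ((B i j + D i j) * hx i * hy j))"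
proof -
  have gL2: "g \<in> L2_on \<Omega>" using g by (simp add: is_weak_div_def)
  show ?thesis
    unfolding L2_inner_cells[OF gL2 u]
    by (intro sum.cong refl)
       (use set_integral_const_AE[OF u gL2] U div_cell[OF \<tau> g] in auto)
qed

lemma L2_inner_piecewise_const:
  assumes u: "u \<in> L2_on \<Omega>" and v: "v \<in> L2_on \<Omega>"
    and U: "\<And>i j. i < n1 \<Longrightarrow> j < n2 \<Longrightarrow> AE p in lebesgue. p \<in> cell i j \<longrightarrow> u p = U i j"
    and V: "\<And>i j. i < n1 \<Longrightarrow> j < n2 \<Longrightarrow> AE p in lebesgue. p \<in> cell i j \<longrightarrow> v p = V i j"
  shows "L2_inner \<Omega> u v = (\<Sum>i<n1. \<Sum>j<n2. V i j * (U i j * (hx i * hy j)))"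
  unfolding L2_inner_cells[OF u v]
proof (intro sum.cong refl)
  fix i j assume "i \<in> {..<n1}" "j \<in> {..<n2}"
  then have ij: "i < n1" "j < n2" by auto
  have "(LINT p:cell i j|lebesgue. u p) = (LINT p:cell i j|lebesgue. 1 * u p)" by simp
  also have "\<dots> = U i j * (hx i * hy j)"
    using set_integral_const_AE[OF u L2_on_const[of 1] ij U[OF ij]] measure_cell[OF ij] by simp
  finally show "(LINT p:cell i j|lebesgue. u p * v p) = V i j * (U i j * (hx i * hy j))"
    using set_integral_const_AE[OF v u ij V[OF ij]] by simp
qed

text \<open>Each component of a flux depends on one variable within a cell, so the cell integral is
  a sum of one-dimensional integrals weighted by the opposite side lengths. The two directions
  therefore do not interact in this form.\<close>

lemma L2_inner_vec_represents:
  assumes \<sigma>: "represents \<sigma> A B C D" and \<tau>: "represents \<tau> A' B' C' D'"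
  shows "L2_inner_vec \<Omega> \<sigma> \<tau> = (\<Sum>i<n1. \<Sum>j<n2.
     hy j * integral {x i..x (Suc i)} (\<lambda>s. (A i j + B i j * (s - x i)) * (A' i j + B' i j * (s - x i))) +
     hx i * integral {y j..y (Suc j)} (\<lambda>t. (C i j + D i j * (t - y j)) * (C' i j + D' i j * (t - y j))))"
proof -
  have L2: "(\<lambda>p. fst (\<sigma> p)) \<in> L2_on \<Omega>" "(\<lambda>p. snd (\<sigma> p)) \<in> L2_on \<Omega>"
    "(\<lambda>p. fst (\<tau> p)) \<in> L2_on \<Omega>" "(\<lambda>p. snd (\<tau> p)) \<in> L2_on \<Omega>"
    using \<sigma> \<tau> by (auto simp: represents_def)
  have dot: "\<sigma> p \<bullet> \<tau> p = fst (\<sigma> p) * fst (\<tau> p) + snd (\<sigma> p) * snd (\<tau> p)" for p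
    by (simp add: inner_prod_def)
  have "set_integrable lebesgue \<Omega> (\<lambda>p. \<sigma> p \<bullet> \<tau> p)"
    unfolding dot integrable_lebesgue_on_rectangle[symmetric]
    by (intro Bochner_Integration.integrable_add L2_on_mult L2)
  then have "L2_inner_vec \<Omega> \<sigma> \<tau> =
      (\<Sum>i<n1. \<Sum>j<n2. LINT p:cell i j|lebesgue. fst (\<sigma> p) * fst (\<tau> p) + snd (\<sigma> p) * snd (\<tau> p))"
    unfolding L2_inner_vec_def integral_lebesgue_on_rectangle by (simp add: set_integral_cells dot)
  also have "\<dots> = (\<Sum>i<n1. \<Sum>j<n2.
     hy j * integral {x i..x (Suc i)} (\<lambda>s. (A i j + B i j * (s - x i)) * (A' i j + B' i j * (s - x i))) +
     hx i * integral {y j..y (Suc j)} (\<lambda>t. (C i j + D i j * (t - y j)) * (C' i j + D' i j * (t - y j))))"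
  proof (intro sum.cong refl)
    fix i j assume "i \<in> {..<n1}" "j \<in> {..<n2}"
    then have ij: "i < n1" "j < n2" by auto
    let ?f = "\<lambda>s. (A i j + B i j * (s - x i)) * (A' i j + B' i j * (s - x i))"
    let ?g = "\<lambda>t. (C i j + D i j * (t - y j)) * (C' i j + D' i j * (t - y j))"
    have AE: "AE p in lebesgue. p \<in> cell i j \<longrightarrow> \<sigma> p = (A i j + B i j * (fst p - x i), C i j + D i j * (snd p - y j))"
      "AE p in lebesgue. p \<in> cell i j \<longrightarrow> \<tau> p = (A' i j + B' i j * (fst p - x i), C' i j + D' i j * (snd p - y j))"
      using \<sigma> \<tau> ij by (simp_all add: represents_def)
    have "(LINT p:cell i j|lebesgue. fst (\<sigma> p) * fst (\<tau> p) + snd (\<sigma> p) * snd (\<tau> p)) =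
        (LINT p:cell i j|lebesgue. ?f (fst p) + ?g (snd p))"
    proof (rule set_integral_cong_AE_integrable)
      show "set_integrable lebesgue (cell i j) (\<lambda>p. fst (\<sigma> p) * fst (\<tau> p) + snd (\<sigma> p) * snd (\<tau> p))"
        by (intro set_integral_add(1) set_integrable_cell_L2 L2 ij)
      show "set_integrable lebesgue (cell i j) (\<lambda>p. ?f (fst p) + ?g (snd p))"
        by (intro set_integrable_cell continuous_intros)
      show "AE p in lebesgue. p \<in> cell i j \<longrightarrow> fst (\<sigma> p) * fst (\<tau> p) + snd (\<sigma> p) * snd (\<tau> p) = ?f (fst p) + ?g (snd p)"
        using AE by eventually_elim auto
    qed
    also have "\<dots> = (LINT p:cell i j|lebesgue. ?f (fst p)) + (LINT p:cell i j|lebesgue. ?g (snd p))"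
      by (intro set_integral_add(2) set_integrable_cell continuous_intros)
    also have "(LINT p:cell i j|lebesgue. ?f (fst p)) = hy j * integral {x i..x (Suc i)} ?f"
      unfolding cell_def by (subst set_integral_rectangle(3))
        (use gy.x_step[OF ij(2)] in \<open>auto intro!: continuous_intros\<close>)
    also have "(LINT p:cell i j|lebesgue. ?g (snd p)) = hx i * integral {y j..y (Suc j)} ?g"
      unfolding cell_def by (subst set_integral_rectangle(2))
        (use gx.x_step[OF ij(1)] in \<open>auto intro!: continuous_intros\<close>)
    finally show "(LINT p:cell i j|lebesgue. fst (\<sigma> p) * fst (\<tau> p) + snd (\<sigma> p) * snd (\<tau> p)) =
      hy j * integral {x i..x (Suc i)} ?f + hx i * integral {y j..y (Suc j)} ?g" .
  qed
  finally show ?thesis .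
qed

end

lemma sum_delta_delta:
  fixes F :: "nat \<Rightarrow> nat \<Rightarrow> real"
  assumes "i < m" "j < n"
  shows "(\<Sum>k<m. \<Sum>l<n. (if k = i then if l = j then 1 else 0 else 0) * F k l) = F i j"
proof -
  have "(\<Sum>l<n. (if k = i then if l = j then 1 else 0 else 0) * F k l) = (if k = i then F i j else 0)" for k
    using assms(2) by (cases "k = i") (simp_all add: mult_delta_left)
  then show ?thesis using assms(1) by simp
qed

lemma (in grid) integral_nodal:
  assumes "i < n"
  shows "integral {x i..x (Suc i)} (\<lambda>r. (s i + slope x s i * (r - x i)) * (t i + slope x t i * (r - x i)))
    = (x (Suc i) - x i) / 6 * (2 * s i * t i + s i * t (Suc i) + s (Suc i) * t i + 2 * s (Suc i) * t (Suc i))"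
  unfolding slope_def by (rule integral_linear_product) (rule x_step[OF assms])

section \<open>Test fluxes in single rows and columns\<close>

context mesh begin

text \<open>A horizontal flux confined to row \<open>j\<close>, with arbitrary nodal values along
  it. The cut-off in the second variable creates only tangential jumps, which \<open>Hdiv\<close>
  permits. Testing with these fluxes detaches row \<open>j\<close> from the other rows.\<close>

definition strip_x :: "(nat \<Rightarrow> real) \<Rightarrow> nat \<Rightarrow> real \<times> real \<Rightarrow> real \<times> real" where
  "strip_x s j p = (interp n1 x s (fst p) * indicator {y j<..<y (Suc j)} (snd p), 0)"

definition strip_y :: "(nat \<Rightarrow> real) \<Rightarrow> nat \<Rightarrow> real \<times> real \<Rightarrow> real \<times> real" where
  "strip_y t i p = (0, indicator {x i<..<x (Suc i)} (fst p) * interp n2 y t (snd p))"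

lemma strip_x_represents:
  assumes j: "j < n2"
  shows "represents (strip_x s j) (\<lambda>k l. if l = j then s k else 0) (\<lambda>k l. if l = j then slope x s k else 0) (\<lambda>_ _. 0) (\<lambda>_ _. 0)"
  unfolding represents_def
proof (intro conjI allI impI)
  have "continuous_on {a..b} (interp n1 x s)"
    using continuous_on_interp[OF continuous_on_id] by simp
  then obtain B where B: "\<And>r. r \<in> {a..b} \<Longrightarrow> \<bar>interp n1 x s r\<bar> \<le> B"
    using continuous_bounded_interval by blast
  show "(\<lambda>p. fst (strip_x s j p)) \<in> L2_on \<Omega>"
    unfolding strip_x_def fst_conv
    by (rule L2_on_tensor[where B' = 1, OF _ _ B])
       (auto intro!: borel_measurable_continuous_onI continuous_intros simp: indicator_def)
  show "(\<lambda>p. snd (strip_x s j p)) \<in> L2_on \<Omega>" by (simp add: strip_x_def L2_on_const)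
  fix k l assume kl: "k < n1" "l < n2"
  show "AE p in lebesgue. p \<in> cell k l \<longrightarrow> strip_x s j p =
      ((if l = j then s k else 0) + (if l = j then slope x s k else 0) * (fst p - x k), 0 + 0 * (snd p - y l))"
  proof (rule AE_I2, rule impI)
    fix p assume p: "p \<in> cell k l"
    then have "indicator {y j<..<y (Suc j)} (snd p) = (if l = j then 1 else 0 :: real)"
      using gy.x_mono[of "Suc l" j] gy.x_mono[of "Suc j" l] j kl
      by (cases l j rule: linorder_cases) (auto simp: cell_def indicator_def)
    moreover have "interp n1 x s (fst p) = s k + slope x s k * (fst p - x k)"
      using p by (intro gx.interp_cell kl) (auto simp: cell_def)
    ultimately show "strip_x s j p =
      ((if l = j then s k else 0) + (if l = j then slope x s k else 0) * (fst p - x k), 0 + 0 * (snd p - y l))"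
      by (simp add: strip_x_def)
  qed
qed

lemma strip_y_represents:
  assumes i: "i < n1"
  shows "represents (strip_y t i) (\<lambda>_ _. 0) (\<lambda>_ _. 0) (\<lambda>k l. if k = i then t l else 0) (\<lambda>k l. if k = i then slope y t l else 0)"
  unfolding represents_def
proof (intro conjI allI impI)
  have "continuous_on {c..d} (interp n2 y t)"
    using continuous_on_interp[OF continuous_on_id] by simp
  then obtain B where B: "\<And>r. r \<in> {c..d} \<Longrightarrow> \<bar>interp n2 y t r\<bar> \<le> B"
    using continuous_bounded_interval by blast
  show "(\<lambda>p. snd (strip_y t i p)) \<in> L2_on \<Omega>"
    unfolding strip_y_def snd_conv
    by (rule L2_on_tensor[where B = 1, OF _ _ _ B])
       (auto intro!: borel_measurable_continuous_onI continuous_intros simp: indicator_def)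
  show "(\<lambda>p. fst (strip_y t i p)) \<in> L2_on \<Omega>" by (simp add: strip_y_def L2_on_const)
  fix k l assume kl: "k < n1" "l < n2"
  show "AE p in lebesgue. p \<in> cell k l \<longrightarrow> strip_y t i p =
      (0 + 0 * (fst p - x k), (if k = i then t l else 0) + (if k = i then slope y t l else 0) * (snd p - y l))"
  proof (rule AE_I2, rule impI)
    fix p assume p: "p \<in> cell k l"
    then have "indicator {x i<..<x (Suc i)} (fst p) = (if k = i then 1 else 0 :: real)"
      using gx.x_mono[of "Suc k" i] gx.x_mono[of "Suc i" k] i kl
      by (cases k i rule: linorder_cases) (auto simp: cell_def indicator_def)
    moreover have "interp n2 y t (snd p) = t l + slope y t l * (snd p - y l)"
      using p by (intro gy.interp_cell kl) (auto simp: cell_def)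
    ultimately show "strip_y t i p =
      (0 + 0 * (fst p - x k), (if k = i then t l else 0) + (if k = i then slope y t l else 0) * (snd p - y l))"
      by (simp add: strip_y_def)
  qed
qed

lemma test_functions_boundary:
  assumes "\<phi> \<in> test_functions \<Omega>" "p \<notin> \<Omega>" shows "\<phi> p = 0"
  using assms unfolding test_functions_def by blast

lemma slope_step_x: "k < n1 \<Longrightarrow> s k + slope x s k * hx k = s (Suc k)"
  and slope_step_y: "l < n2 \<Longrightarrow> t l + slope y t l * hy l = t (Suc l)"
  using gx.x_step[of k] gy.x_step[of l] by (simp_all add: slope_def)

text \<open>The hypothesis \<open>cancel\<close> says that the edge terms sum to zero for every \<open>\<phi>\<close> vanishing on the
  boundary.\<close>

lemma is_weak_divI:
  assumes \<tau>: "represents \<tau> A B C D"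
    and g: "g \<in> L2_on \<Omega>" "\<And>i j p. i < n1 \<Longrightarrow> j < n2 \<Longrightarrow> p \<in> cell i j \<Longrightarrow> g p = B i j + D i j"
    and cancel: "\<And>X Y. (\<And>j. X 0 j = 0 \<and> X n1 j = 0) \<Longrightarrow> (\<And>i. Y i 0 = 0 \<and> Y i n2 = 0) \<Longrightarrow>
      broken_flux A B C D X Y (\<lambda>_ _. 0) = 0"
  shows "is_weak_div \<Omega> \<tau> g"
  unfolding is_weak_div_def
proof (intro conjI ballI g(1))
  fix \<phi> assume \<phi>: "\<phi> \<in> test_functions \<Omega>"
  then have C1: "C_on (Suc 0) UNIV \<phi>" unfolding test_functions_def by blast
  have L2: "\<phi> \<in> L2_on \<Omega>" by (rule L2_on_continuous[OF C_on_1D(1)[OF C1]])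
  define X where "X i j = integral {y j..y (Suc j)} (\<lambda>t. \<phi> (x i, t))" for i j
  define Y where "Y i j = integral {x i..x (Suc i)} (\<lambda>s. \<phi> (s, y j))" for i j
  define Z where "Z i j = (LINT p:cell i j|lebesgue. \<phi> p)" for i j
  have zero: "\<phi> (a, t) = 0" "\<phi> (b, t) = 0" "\<phi> (s, c) = 0" "\<phi> (s, d) = 0" for s t
    using test_functions_boundary[OF \<phi>] by (auto simp: rectangle_def)
  have "L2_inner_vec \<Omega> \<tau> (\<lambda>p. (dx \<phi> p, dy \<phi> p)) = broken_flux A B C D X Y Z"
    using broken_green[OF \<tau> C1] unfolding X_def Y_def Z_def .
  also have "\<dots> = broken_flux A B C D X Y (\<lambda>_ _. 0) - (\<Sum>i<n1. \<Sum>j<n2. (B i j + D i j) * Z i j)"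
    by (simp add: broken_flux_def sum_subtractf)
  also have "broken_flux A B C D X Y (\<lambda>_ _. 0) = 0"
    by (rule cancel) (simp_all add: X_def Y_def zero gx.x_first gx.x_last gy.x_first gy.x_last)
  also have "(\<Sum>i<n1. \<Sum>j<n2. (B i j + D i j) * Z i j) = L2_inner \<Omega> g \<phi>"
    unfolding L2_inner_cells[OF g(1) L2]
  proof (intro sum.cong refl)
    fix i j assume "i \<in> {..<n1}" "j \<in> {..<n2}"
    then have ij: "i < n1" "j < n2" by auto
    have "(LINT p:cell i j|lebesgue. g p * \<phi> p) = (LINT p:cell i j|lebesgue. (B i j + D i j) * \<phi> p)"
      unfolding set_lebesgue_integral_def
      by (rule Bochner_Integration.integral_cong) (use g(2)[OF ij] in \<open>auto simp: indicator_def\<close>)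
    then show "(B i j + D i j) * Z i j = (LINT p:cell i j|lebesgue. g p * \<phi> p)"
      by (simp add: Z_def set_integral_mult_right)
  qed
  finally show "L2_inner_vec \<Omega> \<tau> (\<lambda>p. (dx \<phi> p, dy \<phi> p)) = - L2_inner \<Omega> g \<phi>" by simp
qed

text \<open>Neighbouring cells share the nodal value on their common edge, so the edge terms
  telescope along the row, and the two end terms vanish because the test function is 0 on the
  boundary.\<close>

lemma strip_x_RT_flux:
  assumes j: "j < n2"
  shows "strip_x s j \<in> RT_flux \<Omega> cells"
proof -
  define g where "g p = (\<Sum>i<n1. slope x s i * indicator {x i<..<x (Suc i)} (fst p)) * indicator {y j<..<y (Suc j)} (snd p)"
    for p :: "real \<times> real"
  note r = strip_x_represents[OF j, of s]
  have "is_weak_div \<Omega> (strip_x s j) g"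
  proof (rule is_weak_divI[OF r])
    show "g \<in> L2_on \<Omega>"
      unfolding g_def[abs_def]
    proof (rule L2_on_tensor)
      show "(\<lambda>r. \<Sum>i<n1. slope x s i * indicator {x i<..<x (Suc i)} r) \<in> borel_measurable borel"
        "indicat_real {y j<..<y (Suc j)} \<in> borel_measurable borel" by measurable
      show "\<bar>\<Sum>i<n1. slope x s i * indicator {x i<..<x (Suc i)} r\<bar> \<le> (\<Sum>i<n1. \<bar>slope x s i\<bar>)" for r
        by (rule order_trans[OF sum_abs]) (auto intro!: sum_mono simp: indicator_def)
      show "\<bar>indicator {y j<..<y (Suc j)} t :: real\<bar> \<le> 1" for t by (simp add: indicator_def)
    qed
    fix k l p assume kl: "k < n1" "l < n2" and p: "p \<in> cell k l"
    have "(\<Sum>i<n1. slope x s i * indicator {x i<..<x (Suc i)} (fst p)) = (\<Sum>i<n1. if i = k then slope x s i else 0)"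
    proof (intro sum.cong refl)
      fix i assume "i \<in> {..<n1}"
      then show "slope x s i * indicator {x i<..<x (Suc i)} (fst p) = (if i = k then slope x s i else 0)"
        using gx.x_mono[of "Suc k" i] gx.x_mono[of "Suc i" k] kl p
        by (cases i k rule: linorder_cases) (auto simp: cell_def indicator_def)
    qed
    moreover have "indicator {y j<..<y (Suc j)} (snd p) = (if l = j then 1 else 0 :: real)"
      using gy.x_mono[of "Suc l" j] gy.x_mono[of "Suc j" l] j kl p
      by (cases l j rule: linorder_cases) (auto simp: cell_def indicator_def)
    ultimately show "g p = (if l = j then slope x s k else 0) + 0" using kl by (simp add: g_def)
  next
    fix X Y :: "nat \<Rightarrow> nat \<Rightarrow> real"
    assume X: "\<And>j. X 0 j = 0 \<and> X n1 j = 0"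
    have "broken_flux (\<lambda>k l. if l = j then s k else 0) (\<lambda>k l. if l = j then slope x s k else 0) (\<lambda>_ _. 0) (\<lambda>_ _. 0) X Y (\<lambda>_ _. 0)
        = (\<Sum>k<n1. \<Sum>l<n2. if l = j then s (Suc k) * X (Suc k) j - s k * X k j else 0)"
      unfolding broken_flux_def by (intro sum.cong refl) (auto simp: slope_step_x)
    also have "\<dots> = (\<Sum>k<n1. s (Suc k) * X (Suc k) j - s k * X k j)" using j by simp
    also have "\<dots> = 0" using sum_lessThan_telescope[of "\<lambda>k. s k * X k j" n1] X by simp
    finally show "broken_flux (\<lambda>k l. if l = j then s k else 0) (\<lambda>k l. if l = j then slope x s k else 0) (\<lambda>_ _. 0) (\<lambda>_ _. 0) X Y (\<lambda>_ _. 0) = 0" .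
  qed
  then have "strip_x s j \<in> Hdiv \<Omega>" using r by (auto simp: Hdiv_def represents_def)
  then show ?thesis using r RT_flux_iff by blast
qed

lemma strip_y_RT_flux:
  assumes i: "i < n1"
  shows "strip_y t i \<in> RT_flux \<Omega> cells"
proof -
  define g where "g p = indicator {x i<..<x (Suc i)} (fst p) * (\<Sum>j<n2. slope y t j * indicator {y j<..<y (Suc j)} (snd p))"
    for p :: "real \<times> real"
  note r = strip_y_represents[OF i, of t]
  have "is_weak_div \<Omega> (strip_y t i) g"
  proof (rule is_weak_divI[OF r])
    show "g \<in> L2_on \<Omega>"
      unfolding g_def[abs_def]
    proof (rule L2_on_tensor)
      show "(\<lambda>r. \<Sum>j<n2. slope y t j * indicator {y j<..<y (Suc j)} r) \<in> borel_measurable borel"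
        "indicat_real {x i<..<x (Suc i)} \<in> borel_measurable borel" by measurable
      show "\<bar>\<Sum>j<n2. slope y t j * indicator {y j<..<y (Suc j)} r\<bar> \<le> (\<Sum>j<n2. \<bar>slope y t j\<bar>)" for r
        by (rule order_trans[OF sum_abs]) (auto intro!: sum_mono simp: indicator_def)
      show "\<bar>indicator {x i<..<x (Suc i)} t :: real\<bar> \<le> 1" for t by (simp add: indicator_def)
    qed
    fix k l p assume kl: "k < n1" "l < n2" and p: "p \<in> cell k l"
    have "(\<Sum>j<n2. slope y t j * indicator {y j<..<y (Suc j)} (snd p)) = (\<Sum>j<n2. if j = l then slope y t j else 0)"
    proof (intro sum.cong refl)
      fix j assume "j \<in> {..<n2}"
      then show "slope y t j * indicator {y j<..<y (Suc j)} (snd p) = (if j = l then slope y t j else 0)"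
        using gy.x_mono[of "Suc l" j] gy.x_mono[of "Suc j" l] kl p
        by (cases j l rule: linorder_cases) (auto simp: cell_def indicator_def)
    qed
    moreover have "indicator {x i<..<x (Suc i)} (fst p) = (if k = i then 1 else 0 :: real)"
      using gx.x_mono[of "Suc k" i] gx.x_mono[of "Suc i" k] i kl p
      by (cases k i rule: linorder_cases) (auto simp: cell_def indicator_def)
    ultimately show "g p = 0 + (if k = i then slope y t l else 0)" using kl by (simp add: g_def)
  next
    fix X Y :: "nat \<Rightarrow> nat \<Rightarrow> real"
    assume Y: "\<And>i. Y i 0 = 0 \<and> Y i n2 = 0"
    have "broken_flux (\<lambda>_ _. 0) (\<lambda>_ _. 0) (\<lambda>k l. if k = i then t l else 0) (\<lambda>k l. if k = i then slope y t l else 0) X Y (\<lambda>_ _. 0)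
        = (\<Sum>k<n1. if k = i then \<Sum>l<n2. t (Suc l) * Y i (Suc l) - t l * Y i l else 0)"
      unfolding broken_flux_def by (intro sum.cong refl) (auto simp: slope_step_y intro!: sum.cong)
    also have "\<dots> = (\<Sum>l<n2. t (Suc l) * Y i (Suc l) - t l * Y i l)" using i by simp
    also have "\<dots> = 0" using sum_lessThan_telescope[of "\<lambda>l. t l * Y i l" n2] Y by simp
    finally show "broken_flux (\<lambda>_ _. 0) (\<lambda>_ _. 0) (\<lambda>k l. if k = i then t l else 0) (\<lambda>k l. if k = i then slope y t l else 0) X Y (\<lambda>_ _. 0) = 0" .
  qed
  then have "strip_y t i \<in> Hdiv \<Omega>" using r by (auto simp: Hdiv_def represents_def)
  then show ?thesis using r RT_flux_iff by blast
qed

section \<open>The discrete eigenproblem in coordinates\<close>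

lemma RT_scalar_const:
  assumes "u \<in> RT_scalar \<Omega> cells"
  shows "\<exists>U. \<forall>i<n1. \<forall>j<n2. AE p in lebesgue. p \<in> cell i j \<longrightarrow> u p = U i j"
proof -
  have ex: "\<exists>k. AE p in lebesgue. p \<in> cell i j \<longrightarrow> u p = k" if ij: "i < n1" "j < n2" for i j
    using assms closed_cell[OF ij] unfolding RT_scalar_def by (auto simp: AE_closed_cell[OF ij, symmetric])
  define U where "U i j = (SOME k. AE p in lebesgue. p \<in> cell i j \<longrightarrow> u p = k)" for i j
  have "AE p in lebesgue. p \<in> cell i j \<longrightarrow> u p = U i j" if "i < n1" "j < n2" for i j
    unfolding U_def by (rule someI_ex[OF ex[OF that]])
  then show ?thesis by blast
qed

lemma indicator_cell_eq:
  assumes "p \<in> cell k l" "i < n1" "j < n2" "k < n1" "l < n2"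
  shows "indicat_real (cell i j) p = (if k = i then if l = j then 1 else 0 else 0)"
  using assms cell_disjoint[of p k l i j] by (auto simp: indicator_def)

lemma indicator_cell_L2: "indicat_real (cell i j) \<in> L2_on \<Omega>"
proof -
  have "(\<lambda>p. indicat_real {x i<..<x (Suc i)} (fst p) * indicat_real {y j<..<y (Suc j)} (snd p)) \<in> L2_on \<Omega>"
    by (rule L2_on_tensor[of _ _ _ _ 1 _ _ 1]) (auto simp: indicator_def)
  moreover have "indicat_real (cell i j) = (\<lambda>p. indicat_real {x i<..<x (Suc i)} (fst p) * indicat_real {y j<..<y (Suc j)} (snd p))"
    by (rule ext) (rule indicator_cell)
  ultimately show ?thesis by simp
qed

lemma indicator_cell_RT_scalar:
  assumes "i < n1" "j < n2"
  shows "indicat_real (cell i j) \<in> RT_scalar \<Omega> cells"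
  unfolding RT_scalar_def
proof (intro CollectI conjI indicator_cell_L2 ballI)
  fix K assume "K \<in> cells"
  then obtain k l where kl: "k < n1" "l < n2" and K: "K = {x k..x (Suc k)} \<times> {y l..y (Suc l)}"
    by (rule cells_cases)
  show "\<exists>v. AE p in lebesgue_on K. indicat_real (cell i j) p = v"
    unfolding K AE_closed_cell[OF kl]
    by (rule exI[of _ "if k = i then if l = j then 1 else 0 else 0"], rule AE_I2)
       (use indicator_cell_eq[OF _ assms kl] in auto)
qed

text \<open>The discrete problem in coordinates: cell values \<open>U\<close> of the scalar, and nodal values \<open>S\<close>, \<open>T\<close> of
  the normal fluxes on vertical and horizontal grid lines.\<close>

lemma RT_eigenspace_coordinates:
  assumes u: "u \<in> RT_eigenspace \<Omega> cells \<mu>"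
    and const: "\<forall>i<n1. \<forall>j<n2. AE p in lebesgue. p \<in> cell i j \<longrightarrow> u p = U i j"
  shows "\<exists>S T. (\<forall>s. \<forall>j<n2. mass n1 x (\<lambda>i. S i j) s = (\<Sum>i<n1. U i j * (s (Suc i) - s i))) \<and>
    (\<forall>t. \<forall>i<n1. mass n2 y (T i) t = (\<Sum>j<n2. U i j * (t (Suc j) - t j))) \<and>
    (\<forall>i<n1. \<forall>j<n2. slope x (\<lambda>i. S i j) i + slope y (T i) j = \<mu> * U i j)"
proof -
  have U: "AE p in lebesgue. p \<in> cell i j \<longrightarrow> u p = U i j" if "i < n1" "j < n2" for i j
    using const that by blast
  obtain \<sigma> where \<sigma>: "\<sigma> \<in> RT_flux \<Omega> cells"
    and eq1: "\<And>\<tau>. \<tau> \<in> RT_flux \<Omega> cells \<Longrightarrow> L2_inner_vec \<Omega> \<sigma> \<tau> = L2_inner \<Omega> (weak_div \<Omega> \<tau>) u"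
    and eq2: "\<And>v. v \<in> RT_scalar \<Omega> cells \<Longrightarrow> L2_inner \<Omega> (weak_div \<Omega> \<sigma>) v = \<mu> * L2_inner \<Omega> u v"
    using u unfolding RT_eigenspace_def by (auto simp: algebra_simps)
  have uL2: "u \<in> L2_on \<Omega>" using u by (simp add: RT_eigenspace_def RT_scalar_def)
  obtain S T where ST: "represents \<sigma> S (\<lambda>i j. slope x (\<lambda>i. S i j) i) T (\<lambda>i j. slope y (T i) j)"
    using RT_flux_nodal[OF \<sigma>] .
  have wd: "is_weak_div \<Omega> \<tau> (weak_div \<Omega> \<tau>)" if "\<tau> \<in> RT_flux \<Omega> cells" for \<tau>
    using that by (intro is_weak_div_weak_div) (simp add: RT_flux_def)
  show ?thesis
  proof (rule exI[of _ S], rule exI[of _ T], intro conjI allI impI)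
    \<comment> \<open>With a flux from row \<open>j\<close> as test function in the first discrete
      equation, both sides carry the factor \<open>hy j\<close>; cancelling it leaves a
      one-dimensional mixed equation.\<close>
    fix s j assume j: "j < n2"
    have "L2_inner_vec \<Omega> \<sigma> (strip_x s j) = (\<Sum>k<n1. \<Sum>l<n2. if l = j then
        hy j * (hx k / 6 * (2 * S k j * s k + S k j * s (Suc k) + S (Suc k) j * s k + 2 * S (Suc k) j * s (Suc k))) else 0)"
      unfolding L2_inner_vec_represents[OF ST strip_x_represents[OF j]]
      by (intro sum.cong refl) (auto simp: gx.integral_nodal[of _ "\<lambda>i. S i j", simplified])
    also have "\<dots> = hy j * mass n1 x (\<lambda>i. S i j) s" using j by (simp add: mass_def sum_distrib_left)
    finally have lhs: "L2_inner_vec \<Omega> \<sigma> (strip_x s j) = hy j * mass n1 x (\<lambda>i. S i j) s" .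
    have "L2_inner \<Omega> (weak_div \<Omega> (strip_x s j)) u = (\<Sum>k<n1. \<Sum>l<n2. if l = j then hy j * (U k j * (s (Suc k) - s k)) else 0)"
      by (subst L2_inner_weak_div[OF strip_x_represents[OF j] wd[OF strip_x_RT_flux[OF j]] uL2 U], assumption, assumption, intro sum.cong refl) (auto simp: slope_def dest: gx.x_step)
    also have "\<dots> = hy j * (\<Sum>k<n1. U k j * (s (Suc k) - s k))" using j by (simp add: sum_distrib_left)
    finally show "mass n1 x (\<lambda>i. S i j) s = (\<Sum>i<n1. U i j * (s (Suc i) - s i))"
      using lhs eq1[OF strip_x_RT_flux[OF j]] gy.x_step[OF j] by simp
  next
    fix t i assume i: "i < n1"
    have "L2_inner_vec \<Omega> \<sigma> (strip_y t i) = (\<Sum>k<n1. if k = i then \<Sum>l<n2.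
        hx i * (hy l / 6 * (2 * T i l * t l + T i l * t (Suc l) + T i (Suc l) * t l + 2 * T i (Suc l) * t (Suc l))) else 0)"
      unfolding L2_inner_vec_represents[OF ST strip_y_represents[OF i]]
      by (intro sum.cong refl) (auto simp: gy.integral_nodal intro!: sum.cong)
    also have "\<dots> = hx i * mass n2 y (T i) t" using i by (simp add: mass_def sum_distrib_left)
    finally have lhs: "L2_inner_vec \<Omega> \<sigma> (strip_y t i) = hx i * mass n2 y (T i) t" .
    have "L2_inner \<Omega> (weak_div \<Omega> (strip_y t i)) u = (\<Sum>k<n1. if k = i then \<Sum>l<n2. hx i * (U i l * (t (Suc l) - t l)) else 0)"
      by (subst L2_inner_weak_div[OF strip_y_represents[OF i] wd[OF strip_y_RT_flux[OF i]] uL2 U], assumption, assumption, intro sum.cong refl) (auto simp: slope_def dest: gy.x_step intro!: sum.cong)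
    also have "\<dots> = hx i * (\<Sum>l<n2. U i l * (t (Suc l) - t l))" using i by (simp add: sum_distrib_left)
    finally show "mass n2 y (T i) t = (\<Sum>j<n2. U i j * (t (Suc j) - t j))"
      using lhs eq1[OF strip_y_RT_flux[OF i]] gx.x_step[OF i] by simp
  next
    fix i j assume ij: "i < n1" "j < n2"
    \<comment> \<open>The indicator of one cell as test function in the second discrete equation
      gives the equation on that cell, multiplied by the cell area.\<close>
    let ?\<delta> = "\<lambda>k l. if k = i then if l = j then 1 else 0 else (0 :: real)"
    have ind: "AE p in lebesgue. p \<in> cell k l \<longrightarrow> indicat_real (cell i j) p = ?\<delta> k l" if "k < n1" "l < n2" for k l
      using indicator_cell_eq[OF _ ij that] by auto
    have "L2_inner \<Omega> (weak_div \<Omega> \<sigma>) (indicator (cell i j)) = (\<Sum>k<n1. \<Sum>l<n2. ?\<delta> k l * ((slope x (\<lambda>i. S i l) k + slope y (T k) l) * hx k * hy l))"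
      by (rule L2_inner_weak_div[OF ST wd[OF \<sigma>] indicator_cell_L2]) (rule ind)
    also have "\<dots> = (slope x (\<lambda>i. S i j) i + slope y (T i) j) * hx i * hy j"
      by (rule sum_delta_delta[OF ij])
    finally have l: "L2_inner \<Omega> (weak_div \<Omega> \<sigma>) (indicator (cell i j)) = (slope x (\<lambda>i. S i j) i + slope y (T i) j) * hx i * hy j" .
    have "L2_inner \<Omega> u (indicator (cell i j)) = (\<Sum>k<n1. \<Sum>l<n2. ?\<delta> k l * (U k l * (hx k * hy l)))"
      by (rule L2_inner_piecewise_const[OF uL2 indicator_cell_L2]) (use U ind in auto)
    also have "\<dots> = U i j * (hx i * hy j)" by (rule sum_delta_delta[OF ij])
    finally show "slope x (\<lambda>i. S i j) i + slope y (T i) j = \<mu> * U i j"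
      using l eq2[OF indicator_cell_RT_scalar[OF ij]] gx.x_step[OF ij(1)] gy.x_step[OF ij(2)] by simp
  qed
qed

end

section \<open>Eigenvalue counting and the sine modes\<close>

text \<open>Expanding more than \<open>m\<close> functions in a spanning family of size
  \<open>m\<close> yields a nontrivial combination that vanishes almost everywhere.\<close>

lemma has_dim_ae_lower:
  fixes f :: "'k \<Rightarrow> real \<times> real \<Rightarrow> real"
  assumes dim: "has_dim_ae \<Omega> E m" and J: "finite J" "\<And>j. j \<in> J \<Longrightarrow> f j \<in> E"
    and indep: "\<And>c. (AE p in lebesgue_on \<Omega>. (\<Sum>j\<in>J. c j * f j p) = 0) \<Longrightarrow> \<forall>j\<in>J. c j = 0"
  shows "card J \<le> m"
proof (rule ccontr)
  assume "\<not> card J \<le> m"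
  obtain e :: "nat \<Rightarrow> real \<times> real \<Rightarrow> real" where
    span: "\<forall>u\<in>E. \<exists>c. AE p in lebesgue_on \<Omega>. u p = (\<Sum>i<m. c i * e i p)"
    using dim unfolding has_dim_ae_def by blast
  define C where "C j = (SOME c. AE p in lebesgue_on \<Omega>. f j p = (\<Sum>i<m. c i * e i p))" for j
  have C: "AE p in lebesgue_on \<Omega>. f j p = (\<Sum>i<m. C j i * e i p)" if "j \<in> J" for j
  proof -
    have "\<exists>c. AE p in lebesgue_on \<Omega>. f j p = (\<Sum>i<m. c i * e i p)" using span J(2)[OF that] by blast
    from someI_ex[OF this] show ?thesis unfolding C_def .
  qed
  obtain k where k: "\<exists>j\<in>J. k j \<noteq> 0" "\<And>i. i < m \<Longrightarrow> (\<Sum>j\<in>J. C j i * k j) = 0"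
    using homogeneous_system[of "{..<m}" J "\<lambda>i j. C j i"] J(1) \<open>\<not> card J \<le> m\<close> by auto
  have "AE p in lebesgue_on \<Omega>. \<forall>j\<in>J. f j p = (\<Sum>i<m. C j i * e i p)"
    by (rule AE_finite_allI[OF J(1) C])
  then have "AE p in lebesgue_on \<Omega>. (\<Sum>j\<in>J. k j * f j p) = 0"
  proof eventually_elim
    case (elim p)
    have "(\<Sum>j\<in>J. k j * f j p) = (\<Sum>j\<in>J. \<Sum>i<m. (C j i * k j) * e i p)"
      using elim by (intro sum.cong refl) (simp add: sum_distrib_left mult_ac)
    also have "\<dots> = (\<Sum>i<m. (\<Sum>j\<in>J. C j i * k j) * e i p)"
      by (subst sum.swap) (simp add: sum_distrib_right)
    also have "\<dots> = 0" by (intro sum.neutral ballI) (simp add: k(2))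
    finally show ?case .
  qed
  from indep[OF this] k(1) show False by blast
qed

text \<open>\<open>A k l\<close> plays the part of coordinate \<open>k\<close> of the function
  \<open>u l\<close>: if all coordinates of a combination vanish, so does the combination.
  Coordinates are assigned to a finite family and not by a linear map on \<open>E\<close>, because
  the cell values of each function are only picked by choice.\<close>

lemma has_dim_ae_upper:
  assumes dim: "has_dim_ae \<Omega> E m" and I: "finite I"
    and coord: "\<And>u. (\<forall>l<m. u l \<in> E) \<Longrightarrow> \<exists>A :: 'k \<Rightarrow> nat \<Rightarrow> real. \<forall>c. (\<forall>k\<in>I. (\<Sum>l<m. A k l * c l) = 0) \<longrightarrow>
      (AE p in lebesgue_on \<Omega>. (\<Sum>l<m. c l * u l p) = 0)"
  shows "m \<le> card I"
proof (rule ccontr)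
  assume "\<not> m \<le> card I"
  obtain e :: "nat \<Rightarrow> real \<times> real \<Rightarrow> real" where e: "\<forall>i<m. e i \<in> E"
    and indep: "\<And>c. (AE p in lebesgue_on \<Omega>. (\<Sum>i<m. c i * e i p) = 0) \<Longrightarrow> \<forall>i<m. c i = 0"
    using dim unfolding has_dim_ae_def by blast
  obtain A :: "'k \<Rightarrow> nat \<Rightarrow> real" where A: "\<And>c. \<forall>k\<in>I. (\<Sum>l<m. A k l * c l) = 0 \<Longrightarrow> AE p in lebesgue_on \<Omega>. (\<Sum>l<m. c l * e l p) = 0"
    using coord[OF e] by blast
  obtain c where "\<exists>l\<in>{..<m}. c l \<noteq> 0" "\<forall>k\<in>I. (\<Sum>l<m. A k l * c l) = 0"
    using homogeneous_system[of I "{..<m}" A] I \<open>\<not> m \<le> card I\<close> by auto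
  with indep[OF A] show False by blast
qed

text \<open>Grouping by value shows that at least \<open>k\<close> indices carry an eigenvalue not
  above \<open>t\<close>. Positive indices below \<open>k\<close> number only k - 1, so one of them
  is at least \<open>k\<close>, and monotonicity concludes.\<close>

lemma lists_eigenvalues_le:
  assumes L: "lists_eigenvalues \<Omega> E {1..} ev" and D: "finite D"
    and mult: "\<And>\<mu> m. has_dim_ae \<Omega> (E \<mu>) m \<Longrightarrow> card {z \<in> D. w z = \<mu>} \<le> m"
    and k: "1 \<le> k" "k \<le> card {z \<in> D. w z \<le> t}"
  shows "ev k \<le> t"
proof -
  define W where "W = w ` {z \<in> D. w z \<le> t}"
  have W: "finite W" using D by (simp add: W_def)
  define S where "S \<mu> = {k \<in> {1..}. ev k = \<mu>}" for \<mu>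
  have S: "finite (S \<mu>)" "card {z \<in> D. w z = \<mu>} \<le> card (S \<mu>)" for \<mu>
    using L mult[of \<mu>] unfolding lists_eigenvalues_def S_def by blast+
  have "{z \<in> D. w z \<le> t} = (\<Union>\<mu>\<in>W. {z \<in> D. w z = \<mu>})" by (auto simp: W_def)
  then have "card {z \<in> D. w z \<le> t} = (\<Sum>\<mu>\<in>W. card {z \<in> D. w z = \<mu>})"
    by (simp only:, intro card_UN_disjoint) (use W D in auto)
  also have "\<dots> \<le> (\<Sum>\<mu>\<in>W. card (S \<mu>))" by (intro sum_mono S)
  also have "\<dots> = card (\<Union>\<mu>\<in>W. S \<mu>)"
    by (rule card_UN_disjoint[symmetric]) (use W S in \<open>auto simp: S_def\<close>)
  finally have card: "k \<le> card (\<Union>\<mu>\<in>W. S \<mu>)" using k(2) by simp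
  have "\<not> (\<Union>\<mu>\<in>W. S \<mu>) \<subseteq> {1..<k}"
  proof
    assume "(\<Union>\<mu>\<in>W. S \<mu>) \<subseteq> {1..<k}"
    then have "card (\<Union>\<mu>\<in>W. S \<mu>) \<le> card {1..<k}" by (rule card_mono[rotated]) simp
    then show False using card k(1) by simp
  qed
  then obtain l where l: "l \<in> (\<Union>\<mu>\<in>W. S \<mu>)" "l \<notin> {1..<k}" by blast
  then have "1 \<le> l" "ev l \<le> t" by (auto simp: S_def W_def)
  moreover have "ev k \<le> ev l"
    using L k(1) l(2) \<open>1 \<le> l\<close> unfolding lists_eigenvalues_def by (auto intro: mono_onD)
  ultimately show ?thesis by simp
qed

text \<open>The counterpart under the opposite multiplicity bound: the first \<open>k\<close> listed
  eigenvalues, grouped by value, inject into the pairs of \<open>D\<close> whose value is at most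
  \<open>ev k\<close>.\<close>

lemma lists_eigenvalues_card:
  assumes L: "lists_eigenvalues \<Omega> E {1..N} ev" and D: "finite D"
    and mult: "\<And>\<mu> m. has_dim_ae \<Omega> (E \<mu>) m \<Longrightarrow> m \<le> card {z \<in> D. w z = \<mu>}"
    and k: "1 \<le> k" "k \<le> N"
  shows "k \<le> card {z \<in> D. w z \<le> ev k}"
proof -
  define W where "W = ev ` {1..k}"
  have W: "finite W" by (simp add: W_def)
  define S where "S \<mu> = {k \<in> {1..N}. ev k = \<mu>}" for \<mu>
  have S: "card (S \<mu>) \<le> card {z \<in> D. w z = \<mu>}" for \<mu>
    using L mult[of \<mu>] unfolding lists_eigenvalues_def S_def by blast
  have le: "ev l \<le> ev k" if "l \<in> {1..k}" for l
    using L k that unfolding lists_eigenvalues_def by (auto intro: mono_onD)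
  have "k = card {1..k}" by simp
  also have "\<dots> \<le> card (\<Union>\<mu>\<in>W. S \<mu>)"
    by (rule card_mono) (use W k in \<open>auto simp: S_def W_def\<close>)
  also have "\<dots> = (\<Sum>\<mu>\<in>W. card (S \<mu>))"
    by (rule card_UN_disjoint) (use W in \<open>auto simp: S_def\<close>)
  also have "\<dots> \<le> (\<Sum>\<mu>\<in>W. card {z \<in> D. w z = \<mu>})" by (intro sum_mono S)
  also have "\<dots> = card (\<Union>\<mu>\<in>W. {z \<in> D. w z = \<mu>})"
    by (rule card_UN_disjoint[symmetric]) (use W D in auto)
  also have "\<dots> \<le> card {z \<in> D. w z \<le> ev k}"
    by (rule card_mono) (use D le in \<open>auto simp: W_def\<close>)
  finally show ?thesis .
qed

section \<open>Sine modes of the Dirichlet problem\<close>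

lemma smooth_sin_affine: "smooth (\<lambda>s. sin (r * s + q))"
proof (rule smooth_affine[of sin], rule smoothI[of sin "{sin, cos, \<lambda>s. - sin s, \<lambda>s. - cos s}"])
  fix h :: "real \<Rightarrow> real" assume "h \<in> {sin, cos, \<lambda>s. - sin s, \<lambda>s. - cos s}"
  then consider "h = sin" | "h = cos" | "h = (\<lambda>s. - sin s)" | "h = (\<lambda>s. - cos s)" by blast
  then show "\<exists>h'\<in>{sin, cos, \<lambda>s. - sin s, \<lambda>s. - cos s}. \<forall>s. (h has_real_derivative h' s) (at s)"
  proof cases
    case 1 then show ?thesis by (intro bexI[of _ cos]) (auto intro!: derivative_eq_intros)
  next
    case 2 then show ?thesis by (intro bexI[of _ "\<lambda>s. - sin s"]) (auto intro!: derivative_eq_intros)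
  next
    case 3 then show ?thesis by (intro bexI[of _ "\<lambda>s. - cos s"]) (auto intro!: derivative_eq_intros)
  next
    case 4 then show ?thesis by (intro bexI[of _ sin]) (auto intro!: derivative_eq_intros)
  qed
qed simp

definition sine :: "real \<Rightarrow> real \<Rightarrow> nat \<Rightarrow> real \<Rightarrow> real" where
  "sine a b i s = sin (i * pi / (b - a) * (s - a))"

lemma smooth_sine: "smooth (sine a b i)"
proof -
  have "smooth (\<lambda>s. sin (r * (s - a)))" for r
    using smooth_sin_affine[of r "- r * a"] by (simp add: right_diff_distrib)
  then show ?thesis unfolding sine_def[abs_def] .
qed

lemma sine_boundary: "sine a b i a = 0" "a \<noteq> b \<Longrightarrow> sine a b i b = 0"
  by (simp_all add: sine_def)

definition mode :: "real \<Rightarrow> real \<Rightarrow> real \<Rightarrow> real \<Rightarrow> nat \<times> nat \<Rightarrow> real \<times> real \<Rightarrow> real" where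
  "mode a b c d = (\<lambda>(i, j) p. sine a b i (fst p) * sine c d j (snd p))"

definition mode_eigenvalue :: "real \<Rightarrow> real \<Rightarrow> real \<Rightarrow> real \<Rightarrow> nat \<times> nat \<Rightarrow> real" where
  "mode_eigenvalue a b c d = (\<lambda>(i, j). (i * pi / (b - a))\<^sup>2 + (j * pi / (d - c))\<^sup>2)"

lemma mode_dirichlet:
  assumes "a < b" "c < d"
  shows "mode a b c d ij \<in> dirichlet_eigenspace (rectangle a b c d) (mode_eigenvalue a b c d ij)"
proof (cases ij)
  case (Pair i j)
  let ?\<Omega> = "rectangle a b c d"
  let ?f = "sine a b i" and ?g = "sine c d j"
  define \<omega> \<eta> where "\<omega> = i * pi / (b - a)" and "\<eta> = j * pi / (d - c)"
  have m: "mode a b c d ij = (\<lambda>p. ?f (fst p) * ?g (snd p))" by (simp add: mode_def Pair)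
  have f': "(?f has_real_derivative \<omega> * cos (\<omega> * (s - a))) (at s)"
    and f'': "((\<lambda>s. \<omega> * cos (\<omega> * (s - a))) has_real_derivative - \<omega>\<^sup>2 * ?f s) (at s)" for s
    unfolding sine_def \<omega>_def[symmetric] by (auto intro!: derivative_eq_intros simp: power2_eq_square)
  have g': "(?g has_real_derivative \<eta> * cos (\<eta> * (s - c))) (at s)"
    and g'': "((\<lambda>s. \<eta> * cos (\<eta> * (s - c))) has_real_derivative - \<eta>\<^sup>2 * ?g s) (at s)" for s
    unfolding sine_def \<eta>_def[symmetric] by (auto intro!: derivative_eq_intros simp: power2_eq_square)
  have "continuous_on (closure ?\<Omega>) (mode a b c d ij)"
    using C_on_tensor[OF smooth_sine smooth_sine, of 0 "closure ?\<Omega>"] by (simp add: m)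
  moreover have "C_on 2 ?\<Omega> (mode a b c d ij)" unfolding m by (rule C_on_tensor[OF smooth_sine smooth_sine])
  moreover have "- (dx (dx (mode a b c d ij)) p + dy (dy (mode a b c d ij)) p) = mode_eigenvalue a b c d ij * mode a b c d ij p" for p
    unfolding m dx_tensor[OF f'] dx_tensor[OF f''] dy_tensor[OF g'] dy_tensor[OF g'']
    by (simp add: mode_eigenvalue_def Pair \<omega>_def \<eta>_def algebra_simps)
  moreover have "mode a b c d ij p = 0" if "p \<in> frontier ?\<Omega>" for p
  proof -
    have "open ?\<Omega>" unfolding rectangle_def by (intro open_Times) auto
    then have "p \<in> closure ?\<Omega>" "p \<notin> ?\<Omega>" using that by (auto simp: frontier_def interior_open)
    then have "fst p \<in> {a, b} \<or> snd p \<in> {c, d}"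
      using assms by (cases p) (auto simp: rectangle_def closure_Times)
    then show ?thesis using sine_boundary[of a b i] sine_boundary[of c d j] assms by (auto simp: m)
  qed
  ultimately show ?thesis unfolding dirichlet_eigenspace_def by blast
qed

text \<open>Integer frequencies, because the product formula for sines produces differences of mode
  numbers.\<close>

lemma integral_cos_mode:
  fixes n :: int
  assumes "a < b" "n \<noteq> 0"
  shows "((\<lambda>s. cos (n * pi / (b - a) * (s - a))) has_integral 0) {a..b}"
proof -
  define \<omega> where "\<omega> = n * pi / (b - a)"
  have \<omega>: "\<omega> \<noteq> 0" using assms by (simp add: \<omega>_def)
  have "((\<lambda>s. cos (\<omega> * (s - a))) has_integral sin (\<omega> * (b - a)) / \<omega> - sin (\<omega> * (a - a)) / \<omega>) {a..b}"
  proof (rule fundamental_theorem_of_calculus)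
    fix s
    show "((\<lambda>s. sin (\<omega> * (s - a)) / \<omega>) has_vector_derivative cos (\<omega> * (s - a))) (at s within {a..b})"
      unfolding has_real_derivative_iff_has_vector_derivative[symmetric]
      using \<omega> by (auto intro!: derivative_eq_intros)
  qed (use assms in simp)
  moreover have "sin (\<omega> * (b - a)) = 0"
    using assms sin_npi_int[of n] by (simp add: \<omega>_def mult.commute)
  ultimately show ?thesis by (simp add: \<omega>_def)
qed

lemma sine_orthogonal:
  assumes "a < b" "1 \<le> i" "1 \<le> k"
  shows "integral {a..b} (\<lambda>s. sine a b i s * sine a b k s) = (if i = k then (b - a) / 2 else 0)"
proof (rule integral_unique)
  let ?c = "\<lambda>n::int. \<lambda>s. cos (n * pi / (b - a) * (s - a))"
  have prod: "sine a b i s * sine a b k s = (?c (int i - int k) s - ?c (int i + int k) s) / 2" for s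
  proof -
    have "sine a b i s * sine a b k s =
        (cos (i * pi / (b - a) * (s - a) - k * pi / (b - a) * (s - a)) - cos (i * pi / (b - a) * (s - a) + k * pi / (b - a) * (s - a))) / 2"
      unfolding sine_def by (rule sin_times_sin)
    then show ?thesis by (simp add: left_diff_distrib distrib_right diff_divide_distrib add_divide_distrib)
  qed
  have plus: "(?c (int i + int k) has_integral 0) {a..b}"
    by (rule integral_cos_mode) (use assms in auto)
  have minus: "(?c (int i - int k) has_integral (if i = k then b - a else 0)) {a..b}"
  proof (cases "i = k")
    case True
    then show ?thesis using has_integral_const_real[of "1::real" a b] assms by simp
  next
    case False
    then show ?thesis using integral_cos_mode[OF assms(1), of "int i - int k"] by simp
  qed
  have "((\<lambda>s. (?c (int i - int k) s - ?c (int i + int k) s) / 2) has_integral ((if i = k then b - a else 0) - 0) / 2) {a..b}"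
    by (rule has_integral_divide[OF has_integral_diff[OF minus plus]])
  then show "((\<lambda>s. sine a b i s * sine a b k s) has_integral (if i = k then (b - a) / 2 else 0)) {a..b}"
    unfolding prod by (simp split: if_splits)
qed

lemma mode_orthogonal:
  assumes "a < b" "c < d" "1 \<le> fst ij" "1 \<le> snd ij" "1 \<le> fst kl" "1 \<le> snd kl"
  shows "(LINT p:rectangle a b c d|lebesgue. mode a b c d ij p * mode a b c d kl p) =
    (if ij = kl then (b - a) / 2 * ((d - c) / 2) else 0)"
proof -
  obtain i j k l where ijkl: "ij = (i, j)" "kl = (k, l)" by (cases ij, cases kl)
  have cont: "continuous_on A (\<lambda>p. mode a b c d z p)" for A z
    using C_on_tensor[OF smooth_sine smooth_sine, of 0 A] by (cases z) (simp add: mode_def)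
  have "(LINT p:rectangle a b c d|lebesgue. mode a b c d ij p * mode a b c d kl p) =
      integral {a..b} (\<lambda>s. integral {c..d} (\<lambda>t. mode a b c d ij (s, t) * mode a b c d kl (s, t)))"
    unfolding rectangle_def by (rule set_integral_rectangle(2)) (intro continuous_on_mult cont)
  also have "\<dots> = integral {a..b} (\<lambda>s. sine a b i s * sine a b k s * integral {c..d} (\<lambda>t. sine c d j t * sine c d l t))"
    by (simp add: mode_def ijkl mult_ac flip: integral_mult_right)
  also have "\<dots> = integral {a..b} (\<lambda>s. sine a b i s * sine a b k s) * integral {c..d} (\<lambda>t. sine c d j t * sine c d l t)"
    by (rule integral_mult_left)
  also have "\<dots> = (if ij = kl then (b - a) / 2 * ((d - c) / 2) else 0)"
    using assms by (simp add: ijkl sine_orthogonal)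
  finally show ?thesis .
qed

text \<open>Orthogonality makes the sine modes independent modulo null sets. Indices start at 1,
  since index 0 would give the zero function.\<close>

lemma dirichlet_multiplicity:
  assumes ab: "a < b" "c < d" and D: "finite D" "D \<subseteq> {1..} \<times> {1..}"
    and dim: "has_dim_ae (rectangle a b c d) (dirichlet_eigenspace (rectangle a b c d) \<mu>) m"
  shows "card {z \<in> D. mode_eigenvalue a b c d z = \<mu>} \<le> m"
proof (rule has_dim_ae_lower[OF dim])
  let ?J = "{z \<in> D. mode_eigenvalue a b c d z = \<mu>}" and ?R = "rectangle a b c d"
  show J: "finite ?J" using D by simp
  show "mode a b c d z \<in> dirichlet_eigenspace ?R \<mu>" if "z \<in> ?J" for z
    using mode_dirichlet[OF ab, of z] that by simp
  fix k assume AE: "AE p in lebesgue_on ?R. (\<Sum>z\<in>?J. k z * mode a b c d z p) = 0"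
  have cont: "continuous_on A (\<lambda>p. mode a b c d z p)" for A z
    using C_on_tensor[OF smooth_sine smooth_sine, of 0 A] by (cases z) (simp add: mode_def)
  show "\<forall>z\<in>?J. k z = 0"
  proof
    fix w assume w: "w \<in> ?J"
    have int: "integrable (lebesgue_on ?R) (\<lambda>p. k z * (mode a b c d z p * mode a b c d w p))" for z
      unfolding integrable_lebesgue_on_rectangle unfolding rectangle_def
      by (rule set_integral_rectangle(1)) (intro continuous_intros continuous_on_mult cont)
    have "0 = integral\<^sup>L (lebesgue_on ?R) (\<lambda>p. (\<Sum>z\<in>?J. k z * mode a b c d z p) * mode a b c d w p)"
      by (rule integral_eq_zero_AE[symmetric]) (use AE in \<open>auto elim!: AE_mp\<close>)
    also have "\<dots> = integral\<^sup>L (lebesgue_on ?R) (\<lambda>p. \<Sum>z\<in>?J. k z * (mode a b c d z p * mode a b c d w p))"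
      by (simp add: sum_distrib_right mult.assoc)
    also have "\<dots> = (\<Sum>z\<in>?J. integral\<^sup>L (lebesgue_on ?R) (\<lambda>p. k z * (mode a b c d z p * mode a b c d w p)))"
      by (rule Bochner_Integration.integral_sum) (rule int)
    also have "\<dots> = (\<Sum>z\<in>?J. if z = w then k w * ((b - a) / 2 * ((d - c) / 2)) else 0)"
    proof (intro sum.cong refl)
      fix z assume "z \<in> ?J"
      then have "1 \<le> fst z" "1 \<le> snd z" "1 \<le> fst w" "1 \<le> snd w" using D w by auto
      from mode_orthogonal[OF ab this]
      show "integral\<^sup>L (lebesgue_on ?R) (\<lambda>p. k z * (mode a b c d z p * mode a b c d w p)) =
          (if z = w then k w * ((b - a) / 2 * ((d - c) / 2)) else 0)"
        by (simp add: integral_lebesgue_on_rectangle)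
    qed
    also have "\<dots> = k w * ((b - a) / 2 * ((d - c) / 2))" using J w by simp
    finally show "k w = 0" using ab by simp
  qed
qed

section \<open>Upper bounds for the discrete multiplicities\<close>

context mesh begin

text \<open>Cell values are determined by their pairings with the tensor products of mode
  increments. For an eigenfunction with eigenvalue \<mu> the pairings with
  \<open>w z \<noteq> \<mu>\<close> vanish, so the pairs with \<open>w z = \<mu>\<close> bound the
  dimension of the eigenspace.\<close>

theorem RT_multiplicities:
  defines "D \<equiv> {1..n1} \<times> {1..n2}"
  shows "\<exists>w. (\<forall>z\<in>D. mode_eigenvalue a b c d z \<le> w z) \<and>
    (\<forall>\<mu> m. has_dim_ae \<Omega> (RT_eigenspace \<Omega> cells \<mu>) m \<longrightarrow> m \<le> card {z \<in> D. w z = \<mu>})"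
proof -
  obtain S :: "nat \<Rightarrow> nat \<Rightarrow> real" and ev :: "nat \<Rightarrow> real" where S: "(\<forall>p\<in>{1..n1}. (p * pi / (b - a))\<^sup>2 \<le> ev p \<and> (\<forall>s. stiff n1 x s (S p) = ev p * mass n1 x s (S p)))
     \<and> (\<forall>v. (\<forall>p\<in>{1..n1}. (\<Sum>i<n1. v i * (S p (Suc i) - S p i)) = 0) \<longrightarrow> (\<forall>i<n1. v i = 0))"
    using gx.discrete_modes by (elim exE)
  obtain T :: "nat \<Rightarrow> nat \<Rightarrow> real" and fv :: "nat \<Rightarrow> real" where T: "(\<forall>p\<in>{1..n2}. (p * pi / (d - c))\<^sup>2 \<le> fv p \<and> (\<forall>s. stiff n2 y s (T p) = fv p * mass n2 y s (T p)))
     \<and> (\<forall>v. (\<forall>p\<in>{1..n2}. (\<Sum>i<n2. v i * (T p (Suc i) - T p i)) = 0) \<longrightarrow> (\<forall>i<n2. v i = 0))"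
    using gy.discrete_modes by (elim exE)
  define w where "w = (\<lambda>(p, q). ev p + fv q)"
  define dS dT where "dS p i = S p (Suc i) - S p i" and "dT q j = T q (Suc j) - T q j" for p q i j
  define coef where "coef U = (\<lambda>(p, q). \<Sum>i<n1. \<Sum>j<n2. U i j * dS p i * dT q j)" for U :: "nat \<Rightarrow> nat \<Rightarrow> real"
  have w_ge: "mode_eigenvalue a b c d z \<le> w z" if "z \<in> D" for z
    using that conjunct1[OF S] conjunct1[OF T] by (auto simp: D_def w_def mode_eigenvalue_def intro!: add_mono)
  \<comment> \<open>One-dimensional completeness is applied twice: along rows to the sums obtained
    for a fixed \<open>q\<close>, then along the column \<open>i\<close> to \<open>U i j\<close>
    itself.\<close>
  have complete: "U i j = 0" if U: "\<And>z. z \<in> D \<Longrightarrow> coef U z = 0" and ij: "i < n1" "j < n2" for U i j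
  proof -
    have "(\<Sum>j<n2. U k j * dT q j) = 0" if q: "q \<in> {1..n2}" and k: "k < n1" for q k
    proof -
      have "\<forall>p\<in>{1..n1}. (\<Sum>i<n1. (\<Sum>j<n2. U i j * dT q j) * (S p (Suc i) - S p i)) = 0"
      proof
        fix p assume "p \<in> {1..n1}"
        then have "coef U (p, q) = 0" using U q by (simp add: D_def)
        then show "(\<Sum>i<n1. (\<Sum>j<n2. U i j * dT q j) * (S p (Suc i) - S p i)) = 0"
          by (simp add: coef_def dS_def sum_distrib_right sum_distrib_left mult_ac)
      qed
      then have "\<forall>i<n1. (\<Sum>j<n2. U i j * dT q j) = 0"
        by (rule mp[OF spec[OF conjunct2[OF S]]])
      then show ?thesis using k by blast
    qed
    then have "\<forall>q\<in>{1..n2}. (\<Sum>j<n2. U i j * (T q (Suc j) - T q j)) = 0"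
      using ij(1) by (simp add: dT_def)
    then have "\<forall>j<n2. U i j = 0" by (rule mp[OF spec[OF conjunct2[OF T]]])
    then show ?thesis using ij(2) by blast
  qed
  have relation: "w z * coef U z = \<mu> * coef U z"
    if u: "u \<in> RT_eigenspace \<Omega> cells \<mu>" and U: "\<forall>i<n1. \<forall>j<n2. AE p in lebesgue. p \<in> cell i j \<longrightarrow> u p = U i j"
      and z: "z \<in> D" for u U \<mu> z
  proof -
    obtain p q where pq: "z = (p, q)" "p \<in> {1..n1}" "q \<in> {1..n2}" using z by (auto simp: D_def)
    obtain A C where AC_all: "(\<forall>s. \<forall>j<n2. mass n1 x (\<lambda>i. A i j) s = (\<Sum>i<n1. U i j * (s (Suc i) - s i))) \<and>
        (\<forall>t. \<forall>i<n1. mass n2 y (C i) t = (\<Sum>j<n2. U i j * (t (Suc j) - t j))) \<and>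
        (\<forall>i<n1. \<forall>j<n2. slope x (\<lambda>i. A i j) i + slope y (C i) j = \<mu> * U i j)"
      using RT_eigenspace_coordinates[OF u U] by (elim exE)
    have A: "mass n1 x (\<lambda>i. A i j) s = (\<Sum>i<n1. U i j * (s (Suc i) - s i))" if "j < n2" for s j
      using conjunct1[OF AC_all] that by blast
    have C: "mass n2 y (C i) t = (\<Sum>j<n2. U i j * (t (Suc j) - t j))" if "i < n1" for t i
      using conjunct1[OF conjunct2[OF AC_all]] that by blast
    have AC: "slope x (\<lambda>i. A i j) i + slope y (C i) j = \<mu> * U i j" if "i < n1" "j < n2" for i j
      using conjunct2[OF conjunct2[OF AC_all]] that by blast
    \<comment> \<open>The eigenvalue equation of the mode \<open>S p\<close> takes the unknown flux
      of row \<open>j\<close> as test vector, turning stiffness into \<open>ev p\<close> times mass;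
      the first discrete equation then replaces the mass product by a pairing with the
      scalar.\<close>
    have SA: "(\<Sum>i<n1. slope x (\<lambda>i. A i j) i * dS p i) = ev p * (\<Sum>i<n1. U i j * dS p i)" if "j < n2" for j
    proof -
      have "(\<Sum>i<n1. slope x (\<lambda>i. A i j) i * dS p i) = stiff n1 x (\<lambda>i. A i j) (S p)"
        by (simp add: stiff_def slope_def dS_def)
      also have "\<dots> = ev p * mass n1 x (\<lambda>i. A i j) (S p)" using conjunct1[OF S] pq(2) by blast
      finally show ?thesis using A[OF that] by (simp add: dS_def)
    qed
    have TC: "(\<Sum>j<n2. slope y (C i) j * dT q j) = fv q * (\<Sum>j<n2. U i j * dT q j)" if "i < n1" for i
    proof -
      have "(\<Sum>j<n2. slope y (C i) j * dT q j) = stiff n2 y (C i) (T q)"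
        by (simp add: stiff_def slope_def dT_def)
      also have "\<dots> = fv q * mass n2 y (C i) (T q)" using conjunct1[OF T] pq(3) by blast
      finally show ?thesis using C[OF that] by (simp add: dT_def)
    qed
    have "\<mu> * coef U z = (\<Sum>i<n1. \<Sum>j<n2. (\<mu> * U i j) * dS p i * dT q j)"
      by (simp add: coef_def pq sum_distrib_left mult.assoc)
    also have "\<dots> = (\<Sum>i<n1. \<Sum>j<n2. (slope x (\<lambda>i. A i j) i + slope y (C i) j) * dS p i * dT q j)"
      using AC by (intro sum.cong refl) simp
    also have "\<dots> = (\<Sum>i<n1. \<Sum>j<n2. slope x (\<lambda>i. A i j) i * dS p i * dT q j)
        + (\<Sum>i<n1. dS p i * (\<Sum>j<n2. slope y (C i) j * dT q j))"
      by (simp add: sum.distrib[symmetric] sum_distrib_left algebra_simps)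
    also have "(\<Sum>i<n1. \<Sum>j<n2. slope x (\<lambda>i. A i j) i * dS p i * dT q j)
        = (\<Sum>j<n2. (\<Sum>i<n1. slope x (\<lambda>i. A i j) i * dS p i) * dT q j)"
      by (subst sum.swap) (simp add: sum_distrib_right)
    also have "\<dots> = (\<Sum>j<n2. \<Sum>i<n1. ev p * (U i j * dS p i * dT q j))"
      using SA by (intro sum.cong refl) (simp add: sum_distrib_left sum_distrib_right mult_ac)
    also have "\<dots> = ev p * coef U z"
      by (subst sum.swap) (simp add: coef_def pq sum_distrib_left)
    also have "(\<Sum>i<n1. dS p i * (\<Sum>j<n2. slope y (C i) j * dT q j)) = fv q * coef U z"
      using TC by (simp add: coef_def pq sum_distrib_left mult_ac)
    finally show ?thesis by (simp add: w_def pq distrib_right)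
  qed
  have "m \<le> card {z \<in> D. w z = \<mu>}" if dim: "has_dim_ae \<Omega> (RT_eigenspace \<Omega> cells \<mu>) m" for \<mu> m
  proof (rule has_dim_ae_upper[OF dim])
    show "finite {z \<in> D. w z = \<mu>}" by (simp add: D_def)
    fix u assume u: "\<forall>l<m. u l \<in> RT_eigenspace \<Omega> cells \<mu>"
    define V where "V l = (SOME U. \<forall>i<n1. \<forall>j<n2. AE p in lebesgue. p \<in> cell i j \<longrightarrow> u l p = U i j)" for l
    have V: "AE p in lebesgue. p \<in> cell i j \<longrightarrow> u l p = V l i j" if "l < m" "i < n1" "j < n2" for l i j
    proof -
      have "u l \<in> RT_scalar \<Omega> cells" using u that by (simp add: RT_eigenspace_def)
      from someI_ex[OF RT_scalar_const[OF this]] show ?thesis using that unfolding V_def by blast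
    qed
    show "\<exists>A. \<forall>c. (\<forall>z\<in>{z \<in> D. w z = \<mu>}. (\<Sum>l<m. A z l * c l) = 0) \<longrightarrow> (AE p in lebesgue_on \<Omega>. (\<Sum>l<m. c l * u l p) = 0)"
    proof (intro exI[of _ "\<lambda>z l. coef (V l) z"] allI impI)
      fix k assume k: "\<forall>z\<in>{z \<in> D. w z = \<mu>}. (\<Sum>l<m. coef (V l) z * k l) = 0"
      define U where "U i j = (\<Sum>l<m. k l * V l i j)" for i j
      have coefU: "coef U z = (\<Sum>l<m. coef (V l) z * k l)" for z
      proof -
        obtain p q where z: "z = (p, q)" by (cases z)
        have "coef U z = (\<Sum>i<n1. \<Sum>j<n2. \<Sum>l<m. V l i j * dS p i * dT q j * k l)"
          by (simp add: coef_def z U_def sum_distrib_left sum_distrib_right mult_ac)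
        also have "\<dots> = (\<Sum>i<n1. \<Sum>l<m. \<Sum>j<n2. V l i j * dS p i * dT q j * k l)"
          by (intro sum.cong refl sum.swap)
        also have "\<dots> = (\<Sum>l<m. \<Sum>i<n1. \<Sum>j<n2. V l i j * dS p i * dT q j * k l)"
          by (rule sum.swap)
        finally show ?thesis by (simp add: coef_def z sum_distrib_right)
      qed
      have "coef U z = 0" if z: "z \<in> D" for z
      proof (cases "w z = \<mu>")
        case True
        then show ?thesis using bspec[OF k, of z] z unfolding coefU by blast
      next
        case False
        have "coef (V l) z = 0" if "l < m" for l
        proof -
          have "w z * coef (V l) z = \<mu> * coef (V l) z"
            by (rule relation[OF _ _ z]) (use u that V in auto)
          then show ?thesis using False by simp
        qed
        then show ?thesis by (simp add: coefU)
      qed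
      then have U0: "U i j = 0" if "i < n1" "j < n2" for i j using complete that by blast
      show "AE p in lebesgue_on \<Omega>. (\<Sum>l<m. k l * u l p) = 0"
      proof (rule AE_cells)
        fix i j assume ij: "i < n1" "j < n2"
        have "AE p in lebesgue. \<forall>l\<in>{..<m}. p \<in> cell i j \<longrightarrow> u l p = V l i j"
          by (rule AE_finite_allI) (use V ij in auto)
        then show "AE p in lebesgue. p \<in> cell i j \<longrightarrow> (\<Sum>l<m. k l * u l p) = 0"
        proof eventually_elim
          case (elim p)
          show ?case
          proof
            assume "p \<in> cell i j"
            then have "(\<Sum>l<m. k l * u l p) = U i j" unfolding U_def using elim by (intro sum.cong) auto
            then show "(\<Sum>l<m. k l * u l p) = 0" using U0[OF ij] by simp
          qed
        qed
      qed
    qed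
  qed
  with w_ge show ?thesis by blast
qed

section \<open>Number of cells and mesh size\<close>

lemma card_cells: "card cells = n1 * n2"
proof -
  let ?f = "\<lambda>(i, j). {x i..x (Suc i)} \<times> {y j..y (Suc j)}"
  have "cells = ?f ` ({..<n1} \<times> {..<n2})"
  proof
    show "cells \<subseteq> ?f ` ({..<n1} \<times> {..<n2})"
    proof
      fix K assume "K \<in> cells"
      then show "K \<in> ?f ` ({..<n1} \<times> {..<n2})" by (rule cells_cases) force
    qed
    show "?f ` ({..<n1} \<times> {..<n2}) \<subseteq> cells" using closed_cell by auto
  qed
  moreover have "inj_on ?f ({..<n1} \<times> {..<n2})"
  proof (rule inj_onI, clarsimp)
    fix i j k l assume i: "i < n1" "j < n2" "k < n1" "l < n2"
      and eq: "{x i..x (Suc i)} \<times> {y j..y (Suc j)} = {x k..x (Suc k)} \<times> {y l..y (Suc l)}"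
    have "x i = x k" "y j = y l"
      using eq gx.x_step[OF i(1)] gy.x_step[OF i(2)] by (auto simp: times_eq_iff Icc_eq_Icc)
    then show "i = k \<and> j = l" using i gx.x_inj[of i k] gy.x_inj[of j l] by auto
  qed
  ultimately show ?thesis by (simp add: card_image)
qed

lemma mesh_size_bound: "b - a \<le> n1 * mesh_size n1 x n2 y"
proof -
  have "b - a = (\<Sum>i<n1. hx i)"
    using sum_lessThan_telescope[of x n1] by (simp add: gx.x_first gx.x_last)
  also have "\<dots> \<le> (\<Sum>i<n1. mesh_size n1 x n2 y)"
  proof (rule sum_mono)
    fix i assume "i \<in> {..<n1}"
    then have "hx i \<in> (\<lambda>i. x i - x (i - 1)) ` {1..n1}" by (intro image_eqI[of _ _ "Suc i"]) auto
    then show "hx i \<le> mesh_size n1 x n2 y" unfolding mesh_size_def by (intro Max_ge) auto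
  qed
  finally show ?thesis by simp
qed

end

theorem theorem6:
  fixes a b c d :: real and lam :: "nat \<Rightarrow> real"
  assumes "a < b" and "c < d"
    and "lists_eigenvalues (rectangle a b c d) (dirichlet_eigenspace (rectangle a b c d)) {1..} lam"
  shows "\<forall>k\<ge>1. \<exists>h0>0. \<forall>n1 n2 x y lamh.
           is_grid a b n1 x \<longrightarrow> is_grid c d n2 y \<longrightarrow> mesh_size n1 x n2 y < h0 \<longrightarrow>
           lists_eigenvalues (rectangle a b c d)
             (RT_eigenspace (rectangle a b c d) (mesh_cells n1 x n2 y))
             {1..card (mesh_cells n1 x n2 y)} lamh \<longrightarrow>
           k \<le> card (mesh_cells n1 x n2 y) \<and> lam k \<le> lamh k"
proof (intro allI impI)
  fix k :: nat assume k: "1 \<le> k"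
  show "\<exists>h0>0. \<forall>n1 n2 x y lamh.
           is_grid a b n1 x \<longrightarrow> is_grid c d n2 y \<longrightarrow> mesh_size n1 x n2 y < h0 \<longrightarrow>
           lists_eigenvalues (rectangle a b c d)
             (RT_eigenspace (rectangle a b c d) (mesh_cells n1 x n2 y))
             {1..card (mesh_cells n1 x n2 y)} lamh \<longrightarrow>
           k \<le> card (mesh_cells n1 x n2 y) \<and> lam k \<le> lamh k"
  \<comment> \<open>Steps shorter than (b - a)/k force more than \<open>k\<close> columns, hence at
    least \<open>k\<close> cells.\<close>
  proof (intro exI[of _ "(b - a) / k"] conjI allI impI)
    show "0 < (b - a) / k" using assms(1) k by simp
    fix n1 n2 x y lamh
    assume grids: "is_grid a b n1 x" "is_grid c d n2 y" and h: "mesh_size n1 x n2 y < (b - a) / k"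
      and L: "lists_eigenvalues (rectangle a b c d)
             (RT_eigenspace (rectangle a b c d) (mesh_cells n1 x n2 y))
             {1..card (mesh_cells n1 x n2 y)} lamh"
    interpret mesh a b c d n1 n2 x y
      by (intro mesh.intro grid.intro grids)
    have "b - a < n1 * ((b - a) / k)"
      using mesh_size_bound mult_strict_left_mono[OF h, of "real n1"] gx.n_pos by linarith
    then have "(b - a) * k < (b - a) * n1" using k by (simp add: field_simps)
    then have "k < n1" using assms(1) by (simp add: mult_less_cancel_left)
    then show N: "k \<le> card (mesh_cells n1 x n2 y)"
      using mult_le_mono[of k n1 1 n2] gy.n_pos by (simp add: card_cells)
    let ?D = "{1..n1} \<times> {1..n2}"
    obtain w where w: "\<And>z. z \<in> ?D \<Longrightarrow> mode_eigenvalue a b c d z \<le> w z"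
      "\<And>\<mu> m. has_dim_ae \<Omega> (RT_eigenspace \<Omega> cells \<mu>) m \<Longrightarrow> m \<le> card {z \<in> ?D. w z = \<mu>}"
      using RT_multiplicities by blast
    \<comment> \<open>Counting up to the level \<open>lamh k\<close>: passing from \<open>w\<close>
      to the smaller exact mode eigenvalues can only enlarge the set of pairs, in whatever order
      either family sorts them.\<close>
    have "k \<le> card {z \<in> ?D. w z \<le> lamh k}"
      by (rule lists_eigenvalues_card[OF L _ w(2) k N]) auto
    also have "\<dots> \<le> card {z \<in> ?D. mode_eigenvalue a b c d z \<le> lamh k}"
      by (rule card_mono) (use w(1) order_trans in \<open>auto, blast\<close>)
    finally have card: "k \<le> card {z \<in> ?D. mode_eigenvalue a b c d z \<le> lamh k}" .
    show "lam k \<le> lamh k"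
    proof (rule lists_eigenvalues_le[OF assms(3) _ _ k card])
      show "card {z \<in> ?D. mode_eigenvalue a b c d z = \<mu>} \<le> m"
        if "has_dim_ae (rectangle a b c d) (dirichlet_eigenspace (rectangle a b c d) \<mu>) m" for \<mu> m
        by (rule dirichlet_multiplicity[OF assms(1,2) _ _ that]) auto
    qed simp
  qed
qed

end
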